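(* $$\delta_d=\deg_d g=2\,\deg_{\{y_1,y_2\}}\Big(\operatorname{PP}_{\{x_1,x_2\}}\big(\operatorname{Res}_{y_3}(F(\bar y_H),N(\bar y_H,\bar x))\big)\Big).$$
   Context: Standing assumptions and notation. $f(y_1,y_2)\in\mathbb C[y_1,y_2]$ is an irreducible polynomial of degree $n$ defining an affine plane curve $\mathcal C\subset\mathbb C^2$; $\mathcal C$ is not a line, and $f$ does not divide $f_1^2+f_2^2$, where $f_i=\partial f/\partial y_i$. Write $\bar y=(y_1,y_2)$, $\bar x=(x_1,x_2)$, and let $d,u$ be further variables. Put $b(\bar y,\bar x,d)=(x_1-y_1)^2+(x_2-y_2)^2-d^2$, $n(\bar y,\bar x)=-f_2(\bar y)(x_1-y_1)+f_1(\bar y)(x_2-y_2)$, $w(\bar y,u)=u(f_1^2(\bar y)+f_2^2(\bar y))-1$. Let $\Omega(d)\subset\mathbb C^6$ be the common zero set of $f,b,n,w$ in the variables $(\bar y,\bar x,d,u)$. The generic offset $\mathcal O_d(\mathcal C)\subset\mathbb C^3$ is the Zariski closure of the projection of $\Omega(d)$ to the $(\bar x,d)$-coordinates (it is a surface). The generic offset equation $g(x_1,x_2,d)\in\mathbb C[\bar x,d]$ is a square-free polynomial defining the surface $\mathcal O_d(\mathcal C)$, normalized to have no factor of positive degree lying in $\mathbb C[d]$ (it is determined up to a nonzero constant factor). $F(y_1,y_2,y_3)=y_3^nf(y_1/y_3,y_2/y_3)$, $F_i=\partial F/\partial y_i$, $\bar y_H=(y_1,y_2,y_3)$, and $N(\bar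 y_H,\bar x)=-F_2(\bar y_H)(x_1y_3-y_1)+F_1(\bar y_H)(x_2y_3-y_2)\in\mathbb C[y_1,y_2,y_3,x_1,x_2]$. $\operatorname{Res}_{y_3}$ is the resultant with respect to $y_3$; $\operatorname{PP}_{\{x_1,x_2\}}$ is the primitive part with respect to $x_1,x_2$ (division by the gcd of the coefficients as a polynomial in $x_1,x_2$); $\deg_{\{y_1,y_2\}}$ is the total degree in $y_1,y_2$. *)

theory Defs
  imports "HOL-Library.Poly_Mapping" "HOL-Computational_Algebra.Squarefree"
    "Subresultants.Resultant_Prelim"
begin

text \<open>A polynomial in the variables indexed by natural numbers: a finitely supported
  map from monomials (finitely supported exponent vectors) to complex coefficients.\<close>
type_synonym mpoly = "(nat \<Rightarrow>\<^sub>0 nat) \<Rightarrow>\<^sub>0 complex"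

definition mVar :: "nat \<Rightarrow> mpoly" where
  "mVar i = Poly_Mapping.single (Poly_Mapping.single i 1) 1"

definition mvars :: "mpoly \<Rightarrow> nat set" where
  "mvars p = (\<Union>m\<in>Poly_Mapping.keys p. Poly_Mapping.keys m)"

definition meval :: "mpoly \<Rightarrow> (nat \<Rightarrow> complex) \<Rightarrow> complex" where
  "meval p a = (\<Sum>m\<in>Poly_Mapping.keys p.
      Poly_Mapping.lookup p m * (\<Prod>i\<in>Poly_Mapping.keys m. a i ^ Poly_Mapping.lookup m i))"

definition mpderiv :: "nat \<Rightarrow> mpoly \<Rightarrow> mpoly" where
  "mpderiv i p = (\<Sum>m\<in>Poly_Mapping.keys p.
      Poly_Mapping.single (m - Poly_Mapping.single i 1)
        (of_nat (Poly_Mapping.lookup m i) * Poly_Mapping.lookup p m))"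

definition deg_var :: "nat \<Rightarrow> mpoly \<Rightarrow> nat" where
  "deg_var i p = Max (insert 0 ((\<lambda>m. Poly_Mapping.lookup m i) ` Poly_Mapping.keys p))"

definition deg_set :: "nat set \<Rightarrow> mpoly \<Rightarrow> nat" where
  "deg_set V p = Max (insert 0 ((\<lambda>m. \<Sum>i\<in>V. Poly_Mapping.lookup m i) ` Poly_Mapping.keys p))"

definition mono_drop :: "nat set \<Rightarrow> (nat \<Rightarrow>\<^sub>0 nat) \<Rightarrow> (nat \<Rightarrow>\<^sub>0 nat)" where
  "mono_drop X m = m - (\<Sum>i\<in>X \<inter> Poly_Mapping.keys m. Poly_Mapping.single i (Poly_Mapping.lookup m i))"

definition to_univ :: "nat \<Rightarrow> mpoly \<Rightarrow> mpoly poly" where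
  "to_univ k p = (\<Sum>m\<in>Poly_Mapping.keys p.
      monom (Poly_Mapping.single (mono_drop {k} m) (Poly_Mapping.lookup p m))
            (Poly_Mapping.lookup m k))"

definition mres :: "nat \<Rightarrow> mpoly \<Rightarrow> mpoly \<Rightarrow> mpoly" where
  "mres k p q = resultant (to_univ k p) (to_univ k q)"

definition xcoeff :: "nat set \<Rightarrow> mpoly \<Rightarrow> (nat \<Rightarrow>\<^sub>0 nat) \<Rightarrow> mpoly" where
  "xcoeff X p alpha = (\<Sum>m\<in>{m\<in>Poly_Mapping.keys p. \<forall>i\<in>X. Poly_Mapping.lookup m i = Poly_Mapping.lookup alpha i}.
      Poly_Mapping.single (mono_drop X m) (Poly_Mapping.lookup p m))"

definition is_gcd_of :: "mpoly set \<Rightarrow> mpoly \<Rightarrow> bool" where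
  "is_gcd_of S c \<longleftrightarrow> (\<forall>s\<in>S. c dvd s) \<and> (\<forall>h. (\<forall>s\<in>S. h dvd s) \<longrightarrow> h dvd c)"

text \<open>Q is a primitive part of p with respect to the variables X: p divided by a gcd
  of its coefficients as a polynomial in the variables X (determined up to a
  nonzero constant factor).\<close>
definition is_PP :: "nat set \<Rightarrow> mpoly \<Rightarrow> mpoly \<Rightarrow> bool" where
  "is_PP X p Q \<longleftrightarrow> (\<exists>c. is_gcd_of (range (xcoeff X p)) c \<and> c \<noteq> 0 \<and> p = c * Q)"

text \<open>Variable conventions. For f: y1 = 0, y2 = 1. For F and N: y1 = 0, y2 = 1,
  y3 = 2, x1 = 3, x2 = 4. For the offset equation g: x1 = 0, x2 = 1, d = 2.\<close>

definition pt2 :: "complex \<Rightarrow> complex \<Rightarrow> nat \<Rightarrow> complex" where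
  "pt2 a b = (\<lambda>i. if i = 0 then a else if i = 1 then b else 0)"

definition pt3 :: "complex \<Rightarrow> complex \<Rightarrow> complex \<Rightarrow> nat \<Rightarrow> complex" where
  "pt3 a b c = (\<lambda>i. if i = 0 then a else if i = 1 then b else if i = 2 then c else 0)"

definition offset_proj :: "mpoly \<Rightarrow> (complex \<times> complex \<times> complex) set" where
  "offset_proj f = {(x1, x2, d). \<exists>y1 y2 u.
      meval f (pt2 y1 y2) = 0 \<and>
      (x1 - y1)^2 + (x2 - y2)^2 - d^2 = 0 \<and>
      - meval (mpderiv 1 f) (pt2 y1 y2) * (x1 - y1) + meval (mpderiv 0 f) (pt2 y1 y2) * (x2 - y2) = 0 \<and>
      u * ((meval (mpderiv 0 f) (pt2 y1 y2))^2 + (meval (mpderiv 1 f) (pt2 y1 y2))^2) - 1 = 0}"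

definition zariski_closure3 :: "(complex \<times> complex \<times> complex) set \<Rightarrow> (complex \<times> complex \<times> complex) set" where
  "zariski_closure3 S = {(a, b, c). \<forall>q. mvars q \<subseteq> {0, 1, 2} \<longrightarrow>
      (\<forall>(s1, s2, s3)\<in>S. meval q (pt3 s1 s2 s3) = 0) \<longrightarrow> meval q (pt3 a b c) = 0}"

definition generic_offset :: "mpoly \<Rightarrow> (complex \<times> complex \<times> complex) set" where
  "generic_offset f = zariski_closure3 (offset_proj f)"

definition is_generic_offset_eq :: "mpoly \<Rightarrow> mpoly \<Rightarrow> bool" where
  "is_generic_offset_eq f g \<longleftrightarrow>
     g \<noteq> 0 \<and> mvars g \<subseteq> {0, 1, 2} \<and> squarefree g \<and>
     {(a, b, c). meval g (pt3 a b c) = 0} = generic_offset f \<and>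
     (\<forall>h. h dvd g \<and> mvars h \<subseteq> {2} \<longrightarrow> deg_var 2 h = 0)"

definition homog :: "mpoly \<Rightarrow> mpoly" where
  "homog f = (\<Sum>m\<in>Poly_Mapping.keys f.
      Poly_Mapping.single (m + Poly_Mapping.single 2 (deg_set {0, 1} f - (Poly_Mapping.lookup m 0 + Poly_Mapping.lookup m 1)))
        (Poly_Mapping.lookup f m))"

definition Npoly :: "mpoly \<Rightarrow> mpoly" where
  "Npoly f = - mpderiv 1 (homog f) * (mVar 3 * mVar 2 - mVar 0)
             + mpderiv 0 (homog f) * (mVar 4 * mVar 2 - mVar 1)"

end

theory Submission
  imports Defs "Subresultants.Subresultant_Gcd" "HOL-Computational_Algebra.Field_as_Ring"
    "HOL-Computational_Algebra.Fundamental_Theorem_Algebra"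
begin

text \<open>For generic \<open>x = (s, b)\<close> both sides count the feet of normals through \<open>x\<close>, i.e. the points
  \<open>y\<close> of the curve with \<open>\<nabla>f(y) \<noteq> 0\<close> non-isotropic and \<open>x\<close> on the normal at \<open>y\<close>.

  The roots \<open>d\<close> of \<open>g(x, d)\<close> are simple and are the two square roots of the squared distances of
  \<open>x\<close> to its feet. Distinct feet have distinct distances, because the gradient in \<open>x\<close> of the squared
  distance is \<open>2 (x - y)\<close>, which recovers \<open>y\<close>. Conversely an equation satisfied on the whole offset
  and non-zero at \<open>(x, d)\<close> for every other \<open>d\<close> is obtained by eliminating \<open>y\<close> from the primitive part
  \<open>Q\<close> and a pencil spanned by the normal and the distance equation; the finitely many points \<open>y\<close> missed
  by the elimination are covered by multiplying with the equations of their normals, which do not involve \<open>d\<close>.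

  Dehomogenized by \<open>y\<^sub>1 = 1\<close>, \<open>y\<^sub>2 = t\<close>, the resultant is, for a fixed non-special slope \<open>t\<close>, a product of linear
  forms in \<open>x\<close>, one for each point of the curve on the line of slope \<open>t\<close>. So the order in \<open>s\<close> of a zero of
  \<open>Q\<close> is the number of feet of slope \<open>t\<close>; for generic \<open>s\<close> this equals the order in \<open>t\<close>, since all but
  finitely many zeros of an irreducible polynomial in \<open>s\<close> and \<open>t\<close> are simple in both variables. The
  orders in \<open>t\<close> add up to the degree of \<open>Q\<close>.\<close>

subsection \<open>Evaluation of polynomials\<close>

text \<open>The offset is a Zariski closure, so a point of it need not come from any foot. Excluding
  such points is the obstacle; it is overcome only at one generic \<open>(s, b)\<close>, where each
  unwanted \<open>d\<close> is refuted by a single explicit polynomial. Generic means: for all but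
  finitely many \<open>b\<close>, and then for all but finitely many \<open>s\<close>. Such
  conditions can be intersected, and each comes from a non-zero polynomial or from a finite
  exceptional set. The primitive part is the right object because the content \<open>c\<close> has
  zeros at fixed slopes, whatever \<open>x\<close> is. Being primitive, \<open>Q\<close> vanishes at
  no slope identically in \<open>x\<close>, so a generic \<open>x\<close> keeps the roots of
  \<open>Q\<close> away from any finite set of slopes where the geometry degenerates. The equation
  \<open>g\<close> is not assumed to be even in \<open>d\<close>. The gradient argument is therefore
  applied to its even and odd parts, which are polynomials in the squared distance.\<close>

abbreviation (input) "lookup \<equiv> Poly_Mapping.lookup"
abbreviation (input) "keys \<equiv> Poly_Mapping.keys"
abbreviation (input) "single \<equiv> Poly_Mapping.single"

definition mC :: "complex \<Rightarrow> mpoly" where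
  "mC c = single 0 c"

definition mono_ev :: "(nat \<Rightarrow> 'a::comm_ring_1) \<Rightarrow> (nat \<Rightarrow>\<^sub>0 nat) \<Rightarrow> 'a" where
  "mono_ev a m = (\<Prod>i\<in>keys m. a i ^ lookup m i)"

text \<open>The later views \<open>meval\<close>, \<open>msubst\<close>, \<open>to_univ\<close>,
  \<open>grade\<close> and \<open>to_bi\<close> are all instances of this evaluation along a map
  \<open>h\<close> of the coefficients, hence ring homomorphisms by one proof.\<close>

definition mev :: "(complex \<Rightarrow> 'a::comm_ring_1) \<Rightarrow> (nat \<Rightarrow> 'a) \<Rightarrow> mpoly \<Rightarrow> 'a" where
  "mev h a p = (\<Sum>m\<in>keys p. h (lookup p m) * mono_ev a m)"

lemma meval_mev: "meval p a = mev (\<lambda>c. c) a p"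
  by (simp add: meval_def mev_def mono_ev_def)

lemma mono_ev_superset:
  assumes "finite A" "keys m \<subseteq> A"
  shows "mono_ev a m = (\<Prod>i\<in>A. a i ^ lookup m i)"
  unfolding mono_ev_def
  by (rule prod.mono_neutral_left) (use assms in \<open>auto simp: in_keys_iff\<close>)

lemma mono_ev_0 [simp]: "mono_ev a 0 = 1"
  by (simp add: mono_ev_def)

lemma mono_ev_add: "mono_ev a (m + m') = mono_ev a m * mono_ev a m'"
proof -
  let ?A = "keys m \<union> keys m'"
  have "keys (m + m') \<subseteq> ?A"
    by (rule Poly_Mapping.keys_add)
  then show ?thesis
    by (simp add: mono_ev_superset[of ?A] lookup_add power_add prod.distrib)
qed

lemma mono_ev_single: "mono_ev a (single i k) = a i ^ k"
  by (simp add: mono_ev_def)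

lemma poly_mapping_sum_singles:
  "p = (\<Sum>m\<in>keys p. single m (lookup p m))"
  for p :: "'a \<Rightarrow>\<^sub>0 'b::comm_monoid_add"
  by (rule poly_mapping_eqI)
     (auto simp: lookup_sum lookup_single when_def in_keys_iff sum.delta')

lemma single_power_var: "mVar i ^ k = single (single i k) 1"
proof (induction k)
  case (Suc k)
  then show ?case by (simp add: mVar_def mult_single flip: single_add)
qed simp

lemma single_eq_prod_vars:
  "single m c = mC c * (\<Prod>i\<in>keys m. mVar i ^ lookup m i)"
proof -
  have *: "(\<Prod>i\<in>A. mVar i ^ k i) = single (\<Sum>i\<in>A. single i (k i)) 1"
    if "finite A" for A k
    using that by induction (simp_all add: single_power_var mult_single)
  show ?thesis
    by (subst *) (simp_all add: mC_def mult_single flip: poly_mapping_sum_singles)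
qed

lemma mpoly_induct [case_names const var add mult]:
  assumes "\<And>c. P (mC c)" "\<And>i. P (mVar i)" "\<And>p q. P p \<Longrightarrow> P q \<Longrightarrow> P (p + q)"
    "\<And>p q. P p \<Longrightarrow> P q \<Longrightarrow> P (p * q)"
  shows "P p"
proof -
  have "P 1" "P 0" using assms(1)[of 1] assms(1)[of 0] by (simp_all add: mC_def)
  have pw: "P (q ^ k)" if "P q" for q k
    by (induction k) (use \<open>P 1\<close> assms(4) that in auto)
  have pr: "P (prod f A)" if "finite A" "\<And>i. P (f i)" for f and A :: "nat set"
    using that by (induction A) (auto intro: \<open>P 1\<close> assms(4))
  have sm: "P (sum f A)" if "finite A" "\<And>i. P (f i)" for f and A :: "(nat \<Rightarrow>\<^sub>0 nat) set"
    using that by (induction A) (auto intro: \<open>P 0\<close> assms(3))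
  have "P (single m c)" for m c
    unfolding single_eq_prod_vars by (intro assms(4) assms(1) pr pw assms(2)) simp
  then show ?thesis
    by (subst poly_mapping_sum_singles) (auto intro: sm)
qed

lemma mev_add:
  assumes "comm_ring_hom h"
  shows "mev h a (p + q) = mev h a p + mev h a q"
proof -
  interpret comm_ring_hom h by fact
  show ?thesis
    unfolding mev_def
    by (rule setsum_keys_plus_distrib) (simp_all add: hom_distribs distrib_right)
qed

lemma mev_single: "h 0 = 0 \<Longrightarrow> mev h a (single m c) = h c * mono_ev a m"
  by (simp add: mev_def)

lemma mev_sum:
  assumes "comm_ring_hom h"
  shows "mev h a (sum f A) = (\<Sum>x\<in>A. mev h a (f x))"
proof (induction A rule: infinite_finite_induct)
  case (insert x F)
  then show ?case by (simp add: mev_add[OF assms])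
qed (simp_all add: mev_def)

lemma mev_mult:
  assumes "comm_ring_hom h"
  shows "mev h a (p * q) = mev h a p * mev h a q"
proof -
  interpret comm_ring_hom h by fact
  have [simp]: "h 0 = 0" by simp
  let ?s = "\<lambda>p m. single m (lookup p m)"
  have "p * q = (\<Sum>m\<in>keys p. \<Sum>m'\<in>keys q. ?s p m * ?s q m')"
    by (subst (1) poly_mapping_sum_singles, subst (2) poly_mapping_sum_singles)
       (simp add: sum_product)
  also have "mev h a \<dots> = (\<Sum>m\<in>keys p. \<Sum>m'\<in>keys q.
      (h (lookup p m) * mono_ev a m) * (h (lookup q m') * mono_ev a m'))"
    by (simp add: mev_sum[OF assms] mult_single mev_single mono_ev_add hom_distribs algebra_simps)
  also have "\<dots> = mev h a p * mev h a q"
    by (simp add: mev_def sum_product)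
  finally show ?thesis .
qed

lemma comm_ring_hom_mev:
  assumes "comm_ring_hom h"
  shows "comm_ring_hom (mev h a)"
proof -
  interpret comm_ring_hom h by fact
  show ?thesis
  proof unfold_locales
    show "mev h a 1 = 1" by (simp add: mev_def lookup_one)
    show "mev h a 0 = 0" by (simp add: mev_def)
  qed (simp_all add: mev_add[OF assms] mev_mult[OF assms])
qed

lemma mev_mC: "h 0 = 0 \<Longrightarrow> mev h a (mC c) = h c"
  by (simp add: mC_def mev_single)

lemma mev_mVar: "h 0 = 0 \<Longrightarrow> h 1 = 1 \<Longrightarrow> mev h a (mVar i) = a i"
  by (simp add: mVar_def mev_single mono_ev_single)

lemma mev_cong:
  assumes "\<And>i. i \<in> mvars p \<Longrightarrow> a i = b i"
  shows "mev h a p = mev h b p"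
proof -
  have "mono_ev a m = mono_ev b m" if "m \<in> keys p" for m
    unfolding mono_ev_def
  proof (rule prod.cong[OF refl])
    fix i assume "i \<in> keys m"
    then have "i \<in> mvars p" using that by (auto simp: mvars_def)
    then show "a i ^ lookup m i = b i ^ lookup m i"
      by (simp add: assms)
  qed
  then show ?thesis by (simp add: mev_def)
qed

lemma comm_ring_hom_eq_mev:
  assumes "comm_ring_hom \<phi>"
  shows "\<phi> p = mev (\<lambda>c. \<phi> (mC c)) (\<lambda>i. \<phi> (mVar i)) p"
proof -
  interpret comm_ring_hom \<phi> by fact
  show ?thesis
    by (subst (1) poly_mapping_sum_singles)
       (simp add: mev_def mono_ev_def single_eq_prod_vars hom_distribs)
qed

text \<open>Identities between views reduce to constants and variables. Only the variables in
  \<open>mvars p\<close> count, so two views may differ on all others.\<close>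

lemma mpoly_hom_ext:
  assumes "comm_ring_hom \<phi>" "comm_ring_hom \<psi>"
    and "\<And>c. \<phi> (mC c) = \<psi> (mC c)" "\<And>i. i \<in> mvars p \<Longrightarrow> \<phi> (mVar i) = \<psi> (mVar i)"
  shows "\<phi> p = \<psi> p"
proof -
  have "\<phi> p = mev (\<lambda>c. \<psi> (mC c)) (\<lambda>i. \<phi> (mVar i)) p"
    by (simp only: comm_ring_hom_eq_mev[OF assms(1), of p] assms(3))
  also have "\<dots> = mev (\<lambda>c. \<psi> (mC c)) (\<lambda>i. \<psi> (mVar i)) p"
    by (rule mev_cong) (rule assms(4))
  also have "\<dots> = \<psi> p"
    by (rule comm_ring_hom_eq_mev[OF assms(2), symmetric])
  finally show ?thesis .
qed

lemma comm_ring_hom_compose: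
  assumes "comm_ring_hom f" "comm_ring_hom g"
  shows "comm_ring_hom (\<lambda>x. f (g x))"
proof -
  interpret f: comm_ring_hom f by fact
  interpret g: comm_ring_hom g by fact
  show ?thesis
    by unfold_locales (simp_all add: g.hom_add g.hom_mult f.hom_add f.hom_mult)
qed

lemma comm_ring_hom_id: "comm_ring_hom (\<lambda>x. x)"
  by unfold_locales simp_all

lemma comm_ring_hom_const_poly: "comm_ring_hom (\<lambda>c. [:c:])"
  by unfold_locales (simp_all add: one_pCons)

lemma comm_ring_hom_poly: "comm_ring_hom (\<lambda>p. poly p z)"
  by unfold_locales simp_all

lemma comm_ring_hom_map_poly:
  assumes "comm_ring_hom h"
  shows "comm_ring_hom (map_poly h)"
proof -
  interpret comm_ring_hom h by fact
  show ?thesis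
    by unfold_locales (auto intro!: poly_eqI simp: coeff_map_poly coeff_mult hom_distribs)
qed

lemma comm_ring_hom_mC: "comm_ring_hom mC"
  by unfold_locales (simp_all add: mC_def single_add mult_single)

lemma comm_ring_hom_meval: "comm_ring_hom (\<lambda>p. meval p a)"
  unfolding meval_mev by (rule comm_ring_hom_mev[OF comm_ring_hom_id])

interpretation meval: comm_ring_hom "\<lambda>p. meval p a" for a
  by (rule comm_ring_hom_meval)

lemma meval_mC [simp]: "meval (mC c) a = c"
  and meval_mVar [simp]: "meval (mVar i) a = a i"
  by (simp_all add: meval_mev mev_mC mev_mVar)

lemma meval_cong: "(\<And>i. i \<in> mvars p \<Longrightarrow> a i = b i) \<Longrightarrow> meval p a = meval p b"
  unfolding meval_mev by (rule mev_cong)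

section \<open>Substitution and the variables that occur\<close>

definition msubst :: "(nat \<Rightarrow> mpoly) \<Rightarrow> mpoly \<Rightarrow> mpoly" where
  "msubst = mev mC"

lemma comm_ring_hom_msubst: "comm_ring_hom (msubst \<sigma>)"
  unfolding msubst_def by (rule comm_ring_hom_mev[OF comm_ring_hom_mC])

interpretation msubst: comm_ring_hom "msubst \<sigma>" for \<sigma>
  by (rule comm_ring_hom_msubst)

lemma msubst_mC [simp]: "msubst \<sigma> (mC c) = mC c"
  and msubst_mVar [simp]: "msubst \<sigma> (mVar i) = \<sigma> i"
proof -
  interpret comm_ring_hom mC by (rule comm_ring_hom_mC)
  show "msubst \<sigma> (mC c) = mC c" "msubst \<sigma> (mVar i) = \<sigma> i"
    by (simp_all add: msubst_def mev_mC mev_mVar)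
qed

lemma meval_msubst: "meval (msubst \<sigma> p) a = meval p (\<lambda>i. meval (\<sigma> i) a)"
  by (rule mpoly_hom_ext[of "\<lambda>p. meval (msubst \<sigma> p) a" "\<lambda>p. meval p (\<lambda>i. meval (\<sigma> i) a)"])
     (auto intro: comm_ring_hom_compose comm_ring_hom_meval comm_ring_hom_msubst)

lemma msubst_ident: "(\<And>i. i \<in> mvars p \<Longrightarrow> \<sigma> i = mVar i) \<Longrightarrow> msubst \<sigma> p = p"
  by (rule mpoly_hom_ext[of "msubst \<sigma>" "\<lambda>p. p"])
     (auto intro: comm_ring_hom_id comm_ring_hom_msubst)

lemma mvars_add: "mvars (p + q) \<subseteq> mvars p \<union> mvars q"
  unfolding mvars_def using Poly_Mapping.keys_add[of p q] by blast

lemma mvars_mult: "mvars (p * q) \<subseteq> mvars p \<union> mvars q"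
proof
  fix i assume "i \<in> mvars (p * q)"
  then obtain m where m: "m \<in> keys (p * q)" "i \<in> keys m"
    by (auto simp: mvars_def)
  then obtain a b where "m = a + b" "a \<in> keys p" "b \<in> keys q"
    using keys_mult[of p q] by blast
  with m(2) show "i \<in> mvars p \<union> mvars q"
    using Poly_Mapping.keys_add[of a b] by (auto simp: mvars_def)
qed

lemma mvars_0 [simp]: "mvars 0 = {}" and mvars_1 [simp]: "mvars 1 = {}"
  and mvars_mC [simp]: "mvars (mC c) = {}" and mvars_mVar [simp]: "mvars (mVar i) = {i}"
  and mvars_uminus [simp]: "mvars (- p) = mvars p"
  by (auto simp: mvars_def mC_def mVar_def in_keys_iff lookup_one when_def)

lemma mvars_diff: "mvars (p - q) \<subseteq> mvars p \<union> mvars q"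
  using mvars_add[of p "- q"] by simp

lemma mvars_power: "mvars (p ^ k) \<subseteq> mvars p"
proof (induction k)
  case (Suc k)
  then show ?case using mvars_mult[of p "p ^ k"] by auto
qed simp

lemma mvars_prod: "mvars (prod f A) \<subseteq> (\<Union>x\<in>A. mvars (f x))"
proof (induction A rule: infinite_finite_induct)
  case (insert x F)
  then show ?case using mvars_mult[of "f x" "prod f F"] by auto
qed simp_all

lemma mvars_sum: "mvars (sum f A) \<subseteq> (\<Union>x\<in>A. mvars (f x))"
proof (induction A rule: infinite_finite_induct)
  case (insert x F)
  then show ?case using mvars_add[of "f x" "sum f F"] by auto
qed simp_all

lemma mvars_msubst: "mvars (msubst \<sigma> p) \<subseteq> (\<Union>i\<in>mvars p. mvars (\<sigma> i))"
proof -
  have mono: "mvars (mC c * mono_ev \<sigma> m) \<subseteq> (\<Union>i\<in>keys m. mvars (\<sigma> i))" for c m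
  proof -
    have "mvars (mC c * mono_ev \<sigma> m) \<subseteq> mvars (mono_ev \<sigma> m)"
      using mvars_mult[of "mC c" "mono_ev \<sigma> m"] by simp
    also have "\<dots> \<subseteq> (\<Union>i\<in>keys m. mvars (\<sigma> i ^ lookup m i))"
      unfolding mono_ev_def by (rule mvars_prod)
    also have "\<dots> \<subseteq> (\<Union>i\<in>keys m. mvars (\<sigma> i))"
      by (rule UN_mono[OF order_refl]) (rule mvars_power)
    finally show ?thesis .
  qed
  have "mvars (msubst \<sigma> p) \<subseteq>
      (\<Union>m\<in>keys p. mvars (mC (lookup p m) * mono_ev \<sigma> m))"
    unfolding msubst_def mev_def by (rule mvars_sum)
  also have "\<dots> \<subseteq> (\<Union>m\<in>keys p. \<Union>i\<in>keys m. mvars (\<sigma> i))"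
    by (rule UN_mono[OF order_refl]) (rule mono)
  finally show ?thesis by (simp add: mvars_def[of p])
qed

subsection \<open>Resultants\<close>

lemma poly_eq_sum_atMost:
  fixes p :: "'a::comm_semiring_1 poly"
  assumes "degree p \<le> m"
  shows "poly p z = (\<Sum>k\<le>m. coeff p k * z ^ k)"
  unfolding poly_altdef
  by (rule sum.mono_neutral_left) (use assms in \<open>auto simp: coeff_eq_0\<close>)

text \<open>A Sylvester row lists the coefficients of a shifted polynomial, so pairing it with
  descending powers of \<open>z\<close> evaluates that shift. The number \<open>m\<close> only
  bounds the degree, which may drop under specialization.\<close>

lemma sylvester_row_sum:
  fixes p :: "'a::comm_ring_1 poly"
  assumes "degree p \<le> m" "i + m < N"
  shows "(\<Sum>j\<in>{0..<N}. (if i \<le> j \<and> j - i \<le> m then coeff p (m + i - j) else 0) * z ^ (N - 1 - j))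
    = z ^ (N - 1 - i - m) * poly p z"
proof -
  have "(\<Sum>j\<in>{0..<N}. (if i \<le> j \<and> j - i \<le> m then coeff p (m + i - j) else 0) * z ^ (N - 1 - j))
    = (\<Sum>j\<in>{i..i+m}. coeff p (m + i - j) * z ^ (N - 1 - j))"
    by (rule sum.mono_neutral_cong_right) (use assms(2) in auto)
  also have "\<dots> = (\<Sum>k\<le>m. coeff p k * z ^ (N - 1 - (i + m - k)))"
    by (rule sum.reindex_bij_witness[where i = "\<lambda>k. i + m - k" and j = "\<lambda>j. i + m - j"])
       (auto simp: add_ac)
  also have "\<dots> = (\<Sum>k\<le>m. z ^ (N - 1 - i - m) * (coeff p k * z ^ k))"
  proof (rule sum.cong[OF refl])
    fix k assume "k \<in> {..m}"
    then have "N - 1 - (i + m - k) = (N - 1 - i - m) + k" using assms(2) by auto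
    then show "coeff p k * z ^ (N - 1 - (i + m - k)) = z ^ (N - 1 - i - m) * (coeff p k * z ^ k)"
      by (simp add: power_add mult_ac)
  qed
  also have "\<dots> = z ^ (N - 1 - i - m) * poly p z"
    by (simp add: poly_eq_sum_atMost[OF assms(1)] sum_distrib_left)
  finally show ?thesis .
qed

lemma sylvester_mult_powers:
  fixes p q :: "'a::comm_ring_1 poly"
  assumes "degree p \<le> m" "degree q \<le> n" "i < m + n"
  shows "(\<Sum>j\<in>{0..<m+n}. sylvester_mat_sub m n p q $$ (i, j) * z ^ (m + n - 1 - j)) =
    (if i < n then z ^ (n - 1 - i) * poly p z else z ^ (m + n - 1 - i) * poly q z)"
proof (cases "i < n")
  case True
  have "(\<Sum>j\<in>{0..<m+n}. sylvester_mat_sub m n p q $$ (i, j) * z ^ (m + n - 1 - j)) =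
     (\<Sum>j\<in>{0..<m+n}. (if i \<le> j \<and> j - i \<le> m then coeff p (m + i - j) else 0) * z ^ (m + n - 1 - j))"
    by (rule sum.cong) (use True assms(3) in \<open>auto simp: sylvester_mat_sub_index\<close>)
  also have "\<dots> = z ^ (m + n - 1 - i - m) * poly p z"
    by (rule sylvester_row_sum) (use True assms in auto)
  also have "m + n - 1 - i - m = n - 1 - i" using True by simp
  finally show ?thesis using True by simp
next
  case False
  then have i: "n + (i - n) = i" by simp
  have "(\<Sum>j\<in>{0..<m+n}. sylvester_mat_sub m n p q $$ (i, j) * z ^ (m + n - 1 - j)) =
     (\<Sum>j\<in>{0..<m+n}. (if i - n \<le> j \<and> j - (i - n) \<le> n then coeff q (n + (i - n) - j) else 0)
        * z ^ (m + n - 1 - j))"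
    by (rule sum.cong) (use False assms(3) in \<open>auto simp: sylvester_mat_sub_index\<close>)
  also have "\<dots> = z ^ (m + n - 1 - (i - n) - n) * poly q z"
    by (rule sylvester_row_sum) (use False assms in auto)
  also have "m + n - 1 - (i - n) - n = m + n - 1 - i" using False by simp
  finally show ?thesis using False by simp
qed

text \<open>The vector of descending powers of \<open>z\<close> lies in the kernel of the Sylvester
  matrix. Formal degrees \<open>m\<close> and \<open>n\<close> are allowed because specialization
  can lower the actual ones.\<close>

lemma resultant_sub_common_root:
  fixes p q :: "'a::idom poly"
  assumes "degree p \<le> m" "degree q \<le> n" "0 < m + n" "poly p z = 0" "poly q z = 0"
  shows "resultant_sub m n p q = 0"
proof -
  let ?S = "sylvester_mat_sub m n p q"
  let ?v = "vec (m + n) (\<lambda>j. z ^ (m + n - 1 - j))"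
  have "?S *\<^sub>v ?v = 0\<^sub>v (m + n)"
  proof (rule eq_vecI)
    fix i assume "i < dim_vec (0\<^sub>v (m + n) :: 'a vec)"
    then have i: "i < m + n" by simp
    have "(?S *\<^sub>v ?v) $ i = (\<Sum>j\<in>{0..<m+n}. ?S $$ (i, j) * z ^ (m + n - 1 - j))"
      using i by (simp add: scalar_prod_def)
    then show "(?S *\<^sub>v ?v) $ i = 0\<^sub>v (m + n) $ i"
      using i sylvester_mult_powers[OF assms(1,2) i] assms(4,5) by simp
  qed simp
  moreover have "?v \<noteq> 0\<^sub>v (m + n)"
  proof
    assume "?v = 0\<^sub>v (m + n)"
    \<comment> \<open>The last entry is \<open>z ^ 0 = 1\<close>, also for
      \<open>z = 0\<close>.\<close>
    then have "?v $ (m + n - 1) = 0\<^sub>v (m + n) $ (m + n - 1)" by simp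
    then show False using assms(3) by simp
  qed
  ultimately have "det ?S = 0"
    by (subst det_0_iff_vec_prod_zero[OF sylvester_mat_sub_carrier]) (auto intro: exI[of _ ?v])
  then show ?thesis by (simp add: resultant_sub_def)
qed

section \<open>Product formula for the resultant over distinct roots\<close>

lemma det_scale_rows_cols:
  fixes a b :: "nat \<Rightarrow> 'a::comm_ring_1"
  shows "det (mat n n (\<lambda>(i, j). a i * b j * M i j)) =
    (\<Prod>i<n. a i) * (\<Prod>j<n. b j) * det (mat n n (\<lambda>(i, j). M i j))"
proof -
  have "(\<Prod>i = 0..<n. mat n n (\<lambda>(i, j). a i * b j * M i j) $$ (i, \<pi> i)) =
      (\<Prod>i<n. a i) * (\<Prod>j<n. b j) * (\<Prod>i = 0..<n. mat n n (\<lambda>(i, j). M i j) $$ (i, \<pi> i))"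
    if \<pi>: "\<pi> permutes {0..<n}" for \<pi>
  proof -
    have lt: "\<pi> i < n" if "i < n" for i
      using permutes_in_image[OF \<pi>, of i] that by simp
    have "(\<Prod>i = 0..<n. mat n n (\<lambda>(i, j). a i * b j * M i j) $$ (i, \<pi> i)) =
        (\<Prod>i = 0..<n. a i) * (\<Prod>i = 0..<n. b (\<pi> i)) * (\<Prod>i = 0..<n. M i (\<pi> i))"
      by (simp add: lt flip: prod.distrib)
    also have "(\<Prod>i = 0..<n. b (\<pi> i)) = (\<Prod>i = 0..<n. b i)"
      using prod.permute[OF \<pi>, of b] by (simp add: o_def)
    finally show ?thesis by (simp add: lt atLeast0LessThan)
  qed
  note eq = this
  show ?thesis
    unfolding det_def'[OF mat_carrier] sum_distrib_left
    by (rule sum.cong[OF refl]) (simp only: eq mem_Collect_eq mult.left_commute)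
qed

text \<open>A kernel vector of the transpose is the coefficient vector of a polynomial
  \<open>W\<close> of degree below \<open>m\<close> that vanishes at \<open>m\<close> distinct
  points.\<close>

lemma det_vandermonde_neq_0:
  fixes zs :: "'a::field list"
  assumes "distinct zs" "length zs = m"
  shows "det (mat m m (\<lambda>(i, j). zs ! j ^ (m - 1 - i))) \<noteq> 0" (is "det ?V \<noteq> 0")
proof
  assume "det ?V = 0"
  moreover have V: "?V \<in> carrier_mat m m" by simp
  ultimately have "det (transpose_mat ?V) = 0" by (simp only: det_transpose[OF V])
  then obtain w where w: "w \<in> carrier_vec m" "w \<noteq> 0\<^sub>v m" "transpose_mat ?V *\<^sub>v w = 0\<^sub>v m"
    by (subst (asm) det_0_iff_vec_prod_zero_field[of _ m]) auto
  define W where "W = (\<Sum>i<m. monom (w $ i) (m - 1 - i))"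
  have "degree W < m \<or> W = 0"
  proof (cases "m = 0")
    case False
    have "degree W \<le> m - 1"
      unfolding W_def by (rule degree_sum_le) (auto intro: order.trans[OF degree_monom_le])
    with False show ?thesis by linarith
  qed (simp add: W_def)
  moreover have "W = 0" if "degree W < m"
  proof (rule ccontr)
    assume "W \<noteq> 0"
    have "poly W (zs ! j) = 0" if "j < m" for j
    proof -
      have "0 = (transpose_mat ?V *\<^sub>v w) $ j" using w(3) that by simp
      also have "\<dots> = (\<Sum>i\<in>{0..<m}. zs ! j ^ (m - 1 - i) * w $ i)"
        using that w(1) by (simp add: scalar_prod_def)
      also have "\<dots> = poly W (zs ! j)"
        by (simp add: W_def poly_sum poly_monom atLeast0LessThan mult.commute)
      finally show ?thesis by simp
    qed
    then have "set zs \<subseteq> {z. poly W z = 0}"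
      using assms(2) by (auto simp: in_set_conv_nth)
    then have "card (set zs) \<le> card {z. poly W z = 0}"
      using poly_roots_finite[OF \<open>W \<noteq> 0\<close>] by (rule card_mono[rotated])
    also have "\<dots> \<le> degree W"
      using poly_roots_degree[OF \<open>W \<noteq> 0\<close>] .
    finally show False using that assms distinct_card[of zs] by simp
  qed
  ultimately have "W = 0" by blast
  have "w $ i = 0" if "i < m" for i
  proof -
    have "coeff W (m - 1 - i) = (\<Sum>k<m. if k = i then w $ k else 0)"
      unfolding W_def coeff_sum by (rule sum.cong) (use that in auto)
    then show ?thesis using that \<open>W = 0\<close> by simp
  qed
  then have "w = 0\<^sub>v m" using w(1) by (intro eq_vecI) auto
  with w(2) show False ..
qed

text \<open>The Sylvester matrix is multiplied by a matrix whose last columns are the power vectors of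
  the roots of the first polynomial; both the factor and the product are block triangular.\<close>
lemma resultant_sub_distinct_roots:
  fixes p q :: "'a::field poly"
  assumes p: "degree p = m" "card {z. poly p z = 0} = m" "p \<noteq> 0" and q: "degree q \<le> n"
  shows "resultant_sub m n p q = lead_coeff p ^ n * (\<Prod>z | poly p z = 0. poly q z)"
proof -
  have fin: "finite {z. poly p z = 0}" by (rule poly_roots_finite) fact
  obtain zs where zs: "set zs = {z. poly p z = 0}" "distinct zs"
    using finite_distinct_list[OF fin] by blast
  have len: "length zs = m"
    using distinct_card[OF zs(2)] unfolding zs(1) p(2) by (rule sym)
  let ?S = "sylvester_mat_sub m n p q"
  let ?V = "mat m m (\<lambda>(i, j). zs ! j ^ (m - 1 - i))"
  let ?A = "mat n m (\<lambda>(i, j). zs ! j ^ (m + n - 1 - i))"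
  let ?W = "four_block_mat (1\<^sub>m n) ?A (0\<^sub>m m n) ?V"
  let ?U = "mat n n (\<lambda>(i, j). ?S $$ (i, j))"
  let ?C = "mat m n (\<lambda>(i, j). ?S $$ (i + n, j))"
  let ?D = "mat m m (\<lambda>(i, j). zs ! j ^ (m - 1 - i) * poly q (zs ! j))"
  have root: "poly p (zs ! j) = 0" if "j < m" for j
  proof -
    have "zs ! j \<in> {z. poly p z = 0}" unfolding zs(1)[symmetric] using that len by (intro nth_mem) simp
    then show ?thesis by (rule CollectD)
  qed
  have Wc: "?W \<in> carrier_mat (n + m) (n + m)"
    by (rule four_block_carrier_mat) simp_all
  then have W: "?W \<in> carrier_mat (m + n) (m + n)"
    by (simp only: add.commute)
  define R where "R = four_block_mat ?U (0\<^sub>m n m) ?C ?D"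
  have Rc: "R \<in> carrier_mat (n + m) (n + m)"
    unfolding R_def by (rule four_block_carrier_mat) simp_all
  have W_index: "?W $$ (k, j) = (if j < n then if k = j then 1 else 0 else zs ! (j - n) ^ (m + n - 1 - k))"
    if "k < m + n" "j < m + n" for k j
  proof -
    have "m - 1 - (k - n) = m + n - 1 - k" if "n \<le> k" using that by simp
    then show ?thesis
      using that by (subst index_mat_four_block(1)) (auto split: if_splits)
  qed
  have R_index: "R $$ (i, j) = (if j < n then ?S $$ (i, j) else if i < n then 0
      else zs ! (j - n) ^ (m + n - 1 - i) * poly q (zs ! (j - n)))"
    if "i < m + n" "j < m + n" for i j
  proof -
    have "m - 1 - (i - n) = m + n - 1 - i" if "n \<le> i" using that by simp
    then show ?thesis
      unfolding R_def using that by (subst index_mat_four_block(1)) (auto split: if_splits)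
  qed
  have "?S * ?W = R"
  proof (rule eq_matI)
    fix i j assume "i < dim_row R" "j < dim_col R"
    then have ij: "i < m + n" "j < m + n" using Rc by auto
    have "(?S * ?W) $$ (i, j) = (\<Sum>k\<in>{0..<m+n}. ?S $$ (i, k) * ?W $$ (k, j))"
      using ij carrier_matD[OF W] by (subst index_mult_mat(1)) (auto simp: scalar_prod_def simp del: index_mat_four_block)
    also have "\<dots> = R $$ (i, j)"
    proof (cases "j < n")
      case True
      have "(\<Sum>k\<in>{0..<m+n}. ?S $$ (i, k) * ?W $$ (k, j)) =
          (\<Sum>k\<in>{0..<m+n}. if k = j then ?S $$ (i, k) else 0)"
        by (rule sum.cong[OF refl], subst W_index) (use True ij in auto)
      also have "\<dots> = ?S $$ (i, j)" using ij by simp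
      finally show ?thesis using True R_index[OF ij] by simp
    next
      case False
      have "(\<Sum>k\<in>{0..<m+n}. ?S $$ (i, k) * ?W $$ (k, j)) =
          (\<Sum>k\<in>{0..<m+n}. ?S $$ (i, k) * (zs ! (j - n)) ^ (m + n - 1 - k))"
        by (rule sum.cong[OF refl], subst W_index) (use False ij in auto)
      also have "\<dots> = (if i < n then 0 else (zs ! (j - n)) ^ (m + n - 1 - i) * poly q (zs ! (j - n)))"
      proof -
        have "poly p (zs ! (j - n)) = 0" by (rule root) (use False ij in simp)
        then show ?thesis
          using p(1) by (subst sylvester_mult_powers[OF _ q ij(1)]) simp_all
      qed
      finally show ?thesis using False R_index[OF ij] by simp
    qed
    finally show "(?S * ?W) $$ (i, j) = R $$ (i, j)" .
  next
    show "dim_row (?S * ?W) = dim_row R" "dim_col (?S * ?W) = dim_col R"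
      using carrier_matD[OF W] carrier_matD[OF Rc] by (simp_all only: index_mult_mat sylvester_mat_sub_dim add.commute)
  qed
  then have "det (?S * ?W) = det R" by (rule arg_cong)
  moreover have "det (?S * ?W) = det ?S * det ?W"
    by (rule det_mult[OF sylvester_mat_sub_carrier W])
  moreover have "det ?W = det ?V"
    by (subst det_four_block_mat_lower_left_zero[where n = n and m = m]) simp_all
  moreover have "det R = det ?U * det ?D"
    unfolding R_def by (subst det_four_block_mat_upper_right_zero[where n = n and m = m]) simp_all
  moreover have "det ?U = lead_coeff p ^ n"
  proof -
    have "upper_triangular ?U"
      by (auto simp: upper_triangular_def sylvester_mat_sub_index)
    then have "det ?U = prod_list (diag_mat ?U)"
      by (rule det_upper_triangular[where n = n]) simp
    also have "diag_mat ?U = map (\<lambda>i. lead_coeff p) [0..<n]"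
      using p(1) by (auto simp: diag_mat_def sylvester_mat_sub_index)
    finally show ?thesis by (simp add: map_replicate_const)
  qed
  \<comment> \<open>Column \<open>j\<close> of \<open>?D\<close> is column \<open>j\<close> of
    \<open>?V\<close> times the value of \<open>q\<close> at the root with index \<open>j\<close>;
    the Vandermonde determinant cancels at the end.\<close>
  moreover have "det ?D = (\<Prod>z | poly p z = 0. poly q z) * det ?V"
  proof -
    have "?D = mat m m (\<lambda>(i, j). (1::'a) * poly q (zs ! j) * zs ! j ^ (m - 1 - i))"
      by (rule cong_mat) (simp_all add: mult.commute)
    then have "det ?D = (\<Prod>j<m. poly q (zs ! j)) * det ?V"
      by (simp only: det_scale_rows_cols) simp
    also have "(\<Prod>j<m. poly q (zs ! j)) = (\<Prod>z | poly p z = 0. poly q z)"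
      unfolding zs(1)[symmetric] using len
      by (intro prod.reindex_bij_betw bij_betw_nth zs(2)) auto
    finally show ?thesis .
  qed
  ultimately have "det ?S * det ?V = lead_coeff p ^ n * (\<Prod>z | poly p z = 0. poly q z) * det ?V"
    by (metis mult.assoc)
  then show ?thesis
    unfolding resultant_sub_def by (rule mult_right_cancel[OF det_vandermonde_neq_0[OF zs(2) len], THEN iffD1])
qed

text \<open>A homomorphism may kill leading coefficients. The image of the resultant is therefore a
  resultant for the original degrees, not for those of the image polynomials.\<close>

lemma resultant_sub_hom:
  assumes "comm_ring_hom h"
  shows "h (resultant p q) = resultant_sub (degree p) (degree q) (map_poly h p) (map_poly h q)"
proof -
  interpret comm_ring_hom h by fact
  show ?thesis
    by (simp add: resultant_def resultant_sub_def sylvester_mat_def sylvester_mat_sub_map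
        flip: hom_det)
qed

subsection \<open>Bivariate polynomials over the complex numbers\<close>

text \<open>\<open>a\<close> is the value of the inner variable and \<open>b\<close> that of the
  outer one; for the curve these become \<open>y1\<close> and \<open>y2\<close>.\<close>

definition bi :: "complex poly poly \<Rightarrow> complex \<Rightarrow> complex \<Rightarrow> complex" where
  "bi P a b = poly (poly P [:b:]) a"

lemma bi_hom: "comm_ring_hom (\<lambda>P. bi P a b)"
  unfolding bi_def by unfold_locales simp_all

lemma bi_simps [simp]:
  "bi 0 a b = 0" "bi 1 a b = 1" "bi (P + R) a b = bi P a b + bi R a b"
  "bi (P - R) a b = bi P a b - bi R a b" "bi (- P) a b = - bi P a b"
  "bi (P * R) a b = bi P a b * bi R a b" "bi (P ^ k) a b = bi P a b ^ k"
  "bi (pCons q P) a b = poly q a + b * bi P a b" "bi (smult q P) a b = poly q a * bi P a b"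
  by (simp_all add: bi_def)

lemma comm_ring_hom_poly_eval: "comm_ring_hom (\<lambda>c::complex poly. poly c a)"
  by (rule comm_ring_hom_poly)

abbreviation inner_at :: "complex \<Rightarrow> complex poly poly \<Rightarrow> complex poly" where
  "inner_at a \<equiv> map_poly (\<lambda>c. poly c a)"

lemma comm_ring_hom_inner_at: "comm_ring_hom (inner_at a)"
  by (rule comm_ring_hom_map_poly[OF comm_ring_hom_poly_eval])

lemma inner_at_pCons [simp]: "inner_at a (pCons c P) = pCons (poly c a) (inner_at a P)"
  by (rule poly_eqI) (simp add: coeff_map_poly coeff_pCons split: nat.split)

lemma poly_inner_at [simp]: "poly (inner_at a P) b = bi P a b"
  by (induction P) (simp_all add: bi_def mult.commute)

lemma inner_at_mult: "inner_at a (P * R) = inner_at a P * inner_at a R"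
proof -
  interpret comm_ring_hom "inner_at a" by (rule comm_ring_hom_inner_at)
  show ?thesis by (rule hom_mult)
qed

lemma inner_at_eq_0_iff: "inner_at a P = 0 \<longleftrightarrow> [:[:- a, 1:]:] dvd P"
  unfolding const_poly_dvd_iff poly_eq_iff by (simp add: coeff_map_poly poly_eq_0_iff_dvd)

lemma finite_common_zeros_of_finite_proj:
  assumes "finite A" "\<And>a b. P a b \<Longrightarrow> a \<in> A" "\<And>a. a \<in> A \<Longrightarrow> finite {b. P a b}"
  shows "finite {(a, b). P a b}"
proof -
  have "{(a, b). P a b} \<subseteq> (SIGMA a:A. {b. P a b})" using assms(2) by auto
  then show ?thesis using assms(1,3) by (auto intro: finite_subset)
qed

text \<open>A weak form of Bezout. The resultant in the outer variable is non-zero and leaves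
  finitely many first coordinates. Over each \<open>a\<close> finitely many \<open>b\<close> remain,
  since a common factor \<open>X - a\<close> would be associated to \<open>P\<close> and divide
  \<open>A\<close>.\<close>

lemma finite_common_zeros:
  assumes irr: "irreducible P" and ndvd: "\<not> P dvd A"
  shows "finite {(a, b). bi P a b = 0 \<and> bi A a b = 0}"
proof -
  have nz: "inner_at a P \<noteq> 0 \<or> inner_at a A \<noteq> 0" for a
  proof (rule ccontr)
    assume "\<not> ?thesis"
    then have dv: "[:[:- a, 1:]:] dvd P" "[:[:- a, 1:]:] dvd A"
      using inner_at_eq_0_iff[of a P] inner_at_eq_0_iff[of a A] by auto
    have "\<not> is_unit [:[:- a, 1:]:]"
      by (simp add: is_unit_const_poly_iff is_unit_iff_degree)
    with irreducibleD'[OF irr dv(1)] have "P dvd [:[:- a, 1:]:]" by blast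
    from dvd_trans[OF this dv(2)] ndvd show False by contradiction
  qed
  have fin: "finite {b. bi P a b = 0 \<and> bi A a b = 0}" for a
  proof (cases "inner_at a P = 0")
    case False
    have "{b. bi P a b = 0 \<and> bi A a b = 0} \<subseteq> {b. poly (inner_at a P) b = 0}" by auto
    then show ?thesis using poly_roots_finite[OF False] by (rule finite_subset)
  next
    case True
    with nz have "inner_at a A \<noteq> 0" by blast
    have "{b. bi P a b = 0 \<and> bi A a b = 0} \<subseteq> {b. poly (inner_at a A) b = 0}" by auto
    then show ?thesis using poly_roots_finite[OF \<open>inner_at a A \<noteq> 0\<close>] by (rule finite_subset)
  qed
  show ?thesis
  proof (cases "degree P + degree A = 0")
    \<comment> \<open>Here the Sylvester matrix is empty and has determinant 1, so the resultant
      would not detect common zeros.\<close>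
    case True
    then obtain p q where pq: "P = [:p:]" "A = [:q:]"
      by (metis add_is_0 degree_eq_zeroE)
    have "{(a, b). bi P a b = 0 \<and> bi A a b = 0} = {}"
    proof -
      have "\<not> (bi P a b = 0 \<and> bi A a b = 0)" for a b
        using nz[of a] by (auto simp: pq)
      then show ?thesis by blast
    qed
    then show ?thesis by (simp only: finite.emptyI)
  next
    case False
    have "is_unit (gcd P A)"
      using irreducibleD'[OF irr gcd_dvd1[of P A]] ndvd dvd_trans[OF _ gcd_dvd2[of P A]] by blast
    then have "degree (gcd P A) = 0" by (auto simp: is_unit_poly_iff)
    then have \<rho>: "resultant P A \<noteq> 0" by (simp add: resultant_0_gcd)
    have "poly (resultant P A) a = 0" if "bi P a b = 0" "bi A a b = 0" for a b
      unfolding resultant_sub_hom[OF comm_ring_hom_poly_eval]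
      by (rule resultant_sub_common_root[where z = b]) (use that False in \<open>auto simp: degree_map_poly_le\<close>)
    then show ?thesis
      using poly_roots_finite[OF \<rho>] fin
      by (intro finite_common_zeros_of_finite_proj[of "{a. poly (resultant P A) a = 0}"]) auto
  qed
qed

text \<open>Genericity is always stated in this nested form. \<open>P\<close> has finitely many
  roots of the form \<open>[:b:]\<close>; for any other \<open>b\<close> a non-zero polynomial in
  \<open>a\<close> remains.\<close>

lemma eventually_cofinite_bi_neq_0:
  assumes "P \<noteq> 0"
  shows "\<forall>\<^sub>F b in cofinite. \<forall>\<^sub>F a in cofinite. bi P a b \<noteq> 0"
proof -
  have "finite {b. poly P [:b:] = 0}"
  proof (rule finite_imageD)
    show "finite ((\<lambda>b. [:b:]) ` {b. poly P [:b:] = 0})"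
      by (rule finite_subset[OF _ poly_roots_finite[OF assms]]) auto
  qed (auto intro: inj_onI)
  then have "\<forall>\<^sub>F b in cofinite. poly P [:b:] \<noteq> 0" by (simp add: eventually_cofinite)
  then show ?thesis
  proof eventually_elim
    case (elim b)
    then show ?case using poly_roots_finite[OF elim] by (simp add: eventually_cofinite bi_def)
  qed
qed

section \<open>Simple zeros in either variable, orders and discriminants\<close>

lemma order_eq_1_of_simple_root:
  fixes p :: "complex poly"
  assumes "poly p a = 0" "poly (pderiv p) a \<noteq> 0"
  shows "order a p = 1"
proof -
  have "pderiv p \<noteq> 0" "p \<noteq> 0" using assms(2) by auto
  then have "order a p = Suc (order a (pderiv p))"
    using assms(1) by (intro order_pderiv) (auto simp: order_root)
  moreover have "order a (pderiv p) = 0" using assms(2) by (rule order_0I)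
  ultimately show ?thesis by simp
qed

lemma pderiv_inner_at: "pderiv (inner_at a P) = inner_at a (pderiv P)"
  by (rule poly_eqI) (simp add: coeff_pderiv coeff_map_poly)

lemma pderiv_poly_const: "pderiv (poly P [:b:]) = poly (map_poly pderiv P) [:b:]"
  by (induction P) (simp_all add: map_poly_pCons pderiv_add pderiv_mult pderiv_pCons pderiv_smult)

text \<open>A quotient would have outer degree 0, so the leading coefficient would divide its own
  derivative. By degrees that derivative is zero, and with it the quotient.\<close>

lemma not_dvd_map_poly_pderiv:
  fixes P :: "complex poly poly"
  assumes "map_poly pderiv P \<noteq> 0"
  shows "\<not> P dvd map_poly pderiv P"
proof
  assume "P dvd map_poly pderiv P"
  then obtain k where k: "map_poly pderiv P = P * k" by (elim dvdE)
  with assms have "P \<noteq> 0" "k \<noteq> 0" by auto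
  have "degree (map_poly pderiv P) \<le> degree P" by (rule degree_map_poly_le)
  then have "degree k = 0" using k \<open>P \<noteq> 0\<close> \<open>k \<noteq> 0\<close> by (simp add: degree_mult_eq)
  then obtain c where c: "k = [:c:]" by (rule degree_eq_zeroE)
  with \<open>k \<noteq> 0\<close> have "c \<noteq> 0" by simp
  let ?l = "lead_coeff P"
  have "pderiv ?l = c * ?l"
    using arg_cong[OF k, of "\<lambda>p. coeff p (degree P)"] c by (simp add: coeff_map_poly mult.commute)
  moreover have "?l \<noteq> 0" using \<open>P \<noteq> 0\<close> by simp
  moreover have "degree (c * ?l) \<ge> degree ?l"
    using \<open>c \<noteq> 0\<close> \<open>?l \<noteq> 0\<close> by (simp add: degree_mult_eq)
  ultimately have "degree ?l \<le> degree ?l - 1" using degree_pderiv[of ?l] by simp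
  then have "pderiv ?l = 0" unfolding pderiv_eq_0_iff by linarith
  with \<open>pderiv ?l = c * ?l\<close> \<open>c \<noteq> 0\<close> \<open>?l \<noteq> 0\<close> show False by simp
qed

text \<open>For an irreducible factor of positive degree in both variables, all but finitely many of its
  zeros are simple in each variable; orders are additive in the factors.\<close>
lemma eventually_order_inner_eq_order_outer:
  fixes P :: "complex poly poly"
  assumes "P \<noteq> 0" "\<And>b. poly P [:b:] \<noteq> 0"
  shows "\<forall>\<^sub>F a in cofinite. inner_at a P \<noteq> 0 \<and>
    (\<forall>b. order b (inner_at a P) = order a (poly P [:b:]))"
  using assms
proof (induction P rule: prime_divisors_induct)
  case (unit P)
  then obtain c where c: "P = [:[:c:]:]" "c \<noteq> 0"
    by (auto simp: is_unit_poly_iff elim!: degree_eq_zeroE)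
  then show ?case by (simp add: order_0I)
next
  case (factor p P)
  have P0: "P \<noteq> 0" "p \<noteq> 0" and Pb: "\<And>b. poly P [:b:] \<noteq> 0" and pb: "\<And>b. poly p [:b:] \<noteq> 0"
    using factor.prems by auto
  have irr: "irreducible p" using factor.hyps by (simp add: prime_elem_imp_irreducible)
  have p: "\<forall>\<^sub>F a in cofinite. inner_at a p \<noteq> 0 \<and> (\<forall>b. order b (inner_at a p) = order a (poly p [:b:]))"
  proof (cases "degree p = 0")
    case True
    then obtain k where k: "p = [:k:]" by (rule degree_eq_zeroE)
    with P0 have "k \<noteq> 0" by simp
    then have "\<forall>\<^sub>F a in cofinite. poly k a \<noteq> 0"
      using poly_roots_finite by (simp add: eventually_cofinite)
    then show ?thesis
      by eventually_elim (simp add: k order_0I)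
  next
    case False
    have "pderiv p \<noteq> 0" using False by (simp add: pderiv_eq_0_iff)
    have "\<not> p dvd pderiv p"
      using dvd_imp_degree_le[of p "pderiv p"] \<open>pderiv p \<noteq> 0\<close> False by (auto simp: degree_pderiv)
    then have "finite {(a, b). bi p a b = 0 \<and> bi (pderiv p) a b = 0}"
      by (rule finite_common_zeros[OF irr])
    then have fin1: "finite (fst ` {(a, b). bi p a b = 0 \<and> bi (pderiv p) a b = 0})"
      by (rule finite_imageI)
    \<comment> \<open>If all coefficients were constant, \<open>p\<close> would involve the outer
      variable alone and vanish identically at one of its roots \<open>b\<close>, against the second
      assumption.\<close>
    have "map_poly pderiv p \<noteq> 0"
    proof
      assume "map_poly pderiv p = 0"
      then have "pderiv (coeff p i) = 0" for i
        by (metis coeff_0 coeff_map_poly pderiv_0)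
      then have "degree (coeff p i) = 0" for i by (simp add: pderiv_eq_0_iff)
      then have p_eq: "p = map_poly (\<lambda>c. [:c:]) (inner_at 0 p)"
        by (intro poly_eqI) (simp add: coeff_map_poly, metis degree_eq_zeroE poly_0_coeff_0 coeff_pCons_0)
      have "degree (inner_at 0 p) \<noteq> 0"
      proof
        assume "degree (inner_at 0 p) = 0"
        then have "degree p = 0" by (subst p_eq) (simp add: degree_map_poly)
        with False show False ..
      qed
      then have "\<not> constant (poly (inner_at 0 p))" by (simp add: constant_degree)
      then obtain b where b: "poly (inner_at 0 p) b = 0"
        using fundamental_theorem_of_algebra by blast
      have "poly p [:b:] = [:poly (inner_at 0 p) b:]"
      proof -
        have "poly (map_poly (\<lambda>c. [:c:]) r) [:b:] = [:poly r b:]" for r :: "complex poly"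
          by (induction r) (simp_all add: map_poly_pCons)
        then show ?thesis by (subst p_eq)
      qed
      with b pb show False by simp
    qed
    then have "\<not> p dvd map_poly pderiv p" by (rule not_dvd_map_poly_pderiv)
    then have "finite {(a, b). bi p a b = 0 \<and> bi (map_poly pderiv p) a b = 0}"
      by (rule finite_common_zeros[OF irr])
    then have fin2: "finite (fst ` {(a, b). bi p a b = 0 \<and> bi (map_poly pderiv p) a b = 0})"
      by (rule finite_imageI)
    have "finite {a. inner_at a p = 0}"
    proof (rule finite_subset)
      show "{a. inner_at a p = 0} \<subseteq> {a. poly (lead_coeff p) a = 0}"
        by (auto simp: poly_eq_iff coeff_map_poly)
      show "finite {a. poly (lead_coeff p) a = 0}"
        using P0 by (intro poly_roots_finite) simp
    qed
    then have "\<forall>\<^sub>F a in cofinite. inner_at a p \<noteq> 0" by (simp add: eventually_cofinite)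
    moreover have "\<forall>\<^sub>F a in cofinite. a \<notin> fst ` {(a, b). bi p a b = 0 \<and> bi (pderiv p) a b = 0}"
      using fin1 by (simp only: eventually_cofinite not_not Collect_mem_eq)
    moreover have "\<forall>\<^sub>F a in cofinite. a \<notin> fst ` {(a, b). bi p a b = 0 \<and> bi (map_poly pderiv p) a b = 0}"
      using fin2 by (simp only: eventually_cofinite not_not Collect_mem_eq)
    ultimately show ?thesis
    proof eventually_elim
      case (elim a)
      have "order b (inner_at a p) = order a (poly p [:b:])" for b
      proof (cases "bi p a b = 0")
        case True
        have 1: "bi (pderiv p) a b \<noteq> 0" using elim(2) True by force
        have 2: "bi (map_poly pderiv p) a b \<noteq> 0" using elim(3) True by force
        have "order b (inner_at a p) = 1"
          using True 1 by (intro order_eq_1_of_simple_root) (simp_all add: pderiv_inner_at)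
        moreover have "order a (poly p [:b:]) = 1"
          using True 2 by (intro order_eq_1_of_simple_root) (simp_all add: pderiv_poly_const bi_def)
        ultimately show ?thesis by simp
      next
        case False
        then show ?thesis by (simp add: order_0I bi_def[symmetric])
      qed
      with elim(1) show ?case by blast
    qed
  qed
  from p factor.IH[OF P0(1) Pb] show ?case
  proof eventually_elim
    case (elim a)
    then have "inner_at a (p * P) \<noteq> 0" by (simp add: inner_at_mult)
    moreover have "order b (inner_at a (p * P)) = order a (poly (p * P) [:b:])" for b
      using elim P0 Pb pb by (simp add: inner_at_mult order_mult)
    ultimately show ?case by blast
  qed
qed simp

lemma exists_prime_elem_degree_pos:
  fixes d :: "'a::{factorial_ring_gcd, semiring_gcd_mult_normalize} poly"
  assumes "degree d > 0"
  shows "\<exists>p. prime_elem p \<and> p dvd d \<and> degree p > 0"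
  using assms
proof (induction d rule: prime_divisors_induct)
  case (unit x)
  then show ?case by (auto simp: is_unit_poly_iff)
next
  case (factor p x)
  show ?case
  proof (cases "degree p > 0")
    case True
    then show ?thesis using factor.hyps by (intro exI[of _ p]) (simp add: prime_imp_prime_elem)
  next
    case False
    then have "degree x > 0" using factor.prems degree_mult_le[of p x] by simp
    with factor.IH show ?thesis by (auto intro: dvd_mult)
  qed
qed simp

text \<open>In characteristic 0 a prime of positive degree does not divide its own derivative, so a
  common prime factor of \<open>g\<close> and \<open>pderiv g\<close> divides \<open>g\<close>
  twice.\<close>

lemma squarefree_resultant_pderiv_neq_0:
  fixes g :: "'a::{factorial_ring_gcd, semiring_gcd_mult_normalize, ring_char_0} poly"
  assumes "squarefree g"
  shows "resultant g (pderiv g) \<noteq> 0"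
proof
  assume "resultant g (pderiv g) = 0"
  then have "degree (gcd g (pderiv g)) > 0" by (simp add: resultant_0_gcd)
  then obtain p where p: "prime_elem p" "p dvd gcd g (pderiv g)" "degree p > 0"
    using exists_prime_elem_degree_pos by blast
  then have "p dvd g" "p dvd pderiv g" by auto
  then obtain k where k: "g = p * k" by (elim dvdE)
  have "pderiv g = p * pderiv k + k * pderiv p"
    unfolding k by (simp add: pderiv_mult)
  with \<open>p dvd pderiv g\<close> have "p dvd k * pderiv p"
    by (metis dvd_add_right_iff dvd_triv_left)
  moreover have "pderiv p \<noteq> 0" using p(3) by (simp add: pderiv_eq_0_iff)
  then have "\<not> p dvd pderiv p"
    using dvd_imp_degree_le[of p "pderiv p"] p(3) by (auto simp: degree_pderiv)
  ultimately have "p dvd k" using p(1) by (simp add: prime_elem_dvd_mult_iff)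
  then have "p ^ 2 dvd g" unfolding k power2_eq_square by (rule mult_dvd_mono[OF dvd_refl])
  then have "is_unit p" using assms by (rule squarefreeD[rotated])
  with p(1) show False by (auto simp: prime_elem_def)
qed

subsection \<open>Univariate views\<close>

lemma lookup_mono_drop:
  assumes "finite X"
  shows "lookup (mono_drop X m) i = (if i \<in> X then 0 else lookup m i)"
proof -
  have "lookup (\<Sum>j\<in>X \<inter> keys m. single j (lookup m j)) i
      = (\<Sum>j\<in>X \<inter> keys m. if j = i then lookup m j else 0)"
    by (simp add: lookup_sum lookup_single when_def)
  also have "\<dots> = (if i \<in> X then lookup m i else 0)"
    by (simp add: in_keys_iff)
  finally show ?thesis by (simp add: mono_drop_def lookup_minus)
qed

lemma mono_drop_add: "finite X \<Longrightarrow> mono_drop X (m + m') = mono_drop X m + mono_drop X m'"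
  by (rule poly_mapping_eqI) (simp add: lookup_mono_drop lookup_add)

lemma mono_drop_ident: "finite X \<Longrightarrow> keys m \<inter> X = {} \<Longrightarrow> mono_drop X m = m"
  by (rule poly_mapping_eqI) (auto simp: lookup_mono_drop in_keys_iff)

lemma keys_mono_drop: "finite X \<Longrightarrow> keys (mono_drop X m) = keys m - X"
  by (auto simp: lookup_mono_drop in_keys_iff split: if_splits)

lemma mono_drop_plus_single: "mono_drop {k} m + single k (lookup m k) = m"
  by (rule poly_mapping_eqI) (auto simp: lookup_mono_drop lookup_add lookup_single when_def)

lemma single_eq_mono_ev: "single m c = mC c * mono_ev mVar m"
  by (simp add: single_eq_prod_vars mono_ev_def)

lemma mono_ev_hom:
  assumes "comm_ring_hom h"
  shows "h (mono_ev a m) = mono_ev (\<lambda>i. h (a i)) m"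
proof -
  interpret comm_ring_hom h by fact
  show ?thesis by (simp add: mono_ev_def hom_distribs)
qed

lemma mono_ev_cong: "(\<And>i. i \<in> keys m \<Longrightarrow> a i = b i) \<Longrightarrow> mono_ev a m = mono_ev b m"
  unfolding mono_ev_def by (intro prod.cong) auto

lemma comm_ring_hom_const_mC: "comm_ring_hom (\<lambda>c. [:mC c:])"
  by (rule comm_ring_hom_compose[OF comm_ring_hom_const_poly comm_ring_hom_mC])

lemma to_univ_eq_mev:
  "to_univ k = mev (\<lambda>c. [:mC c:]) (\<lambda>i. if i = k then [:0, 1:] else [:mVar i:])" (is "_ = mev _ ?a")
proof
  fix p
  have "monom (single (mono_drop {k} m) c) (lookup m k) = [:mC c:] * mono_ev ?a m" for m c
  proof -
    have "mono_ev ?a (mono_drop {k} m) = mono_ev (\<lambda>i. [:mVar i:]) (mono_drop {k} m)"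
      by (rule mono_ev_cong) (simp add: keys_mono_drop)
    also have "\<dots> = [:mono_ev mVar (mono_drop {k} m):]"
      by (simp add: mono_ev_hom[OF comm_ring_hom_const_poly])
    finally have "mono_ev ?a m = [:mono_ev mVar (mono_drop {k} m):] * [:0, 1:] ^ lookup m k"
      by (subst (1) mono_drop_plus_single[of k m, symmetric])
         (simp only: mono_ev_add mono_ev_single if_True simp_thms)
    then show ?thesis
      by (simp add: single_eq_mono_ev monom_altdef mult.commute)
  qed
  then show "to_univ k p = mev (\<lambda>c. [:mC c:]) ?a p"
    by (simp only: to_univ_def mev_def)
qed

lemma comm_ring_hom_to_univ: "comm_ring_hom (to_univ k)"
  unfolding to_univ_eq_mev by (rule comm_ring_hom_mev[OF comm_ring_hom_const_mC])

interpretation to_univ: comm_ring_hom "to_univ k" for k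
  by (rule comm_ring_hom_to_univ)

lemma to_univ_mC [simp]: "to_univ k (mC c) = [:mC c:]"
  and to_univ_mVar: "to_univ k (mVar i) = (if i = k then [:0, 1:] else [:mVar i:])"
proof -
  interpret comm_ring_hom "\<lambda>c. [:mC c:]" by (rule comm_ring_hom_const_mC)
  have "(\<lambda>c. [:mC c:]) 0 = 0" "(\<lambda>c. [:mC c:]) 1 = 1" by (rule hom_zero, rule hom_one)
  then show "to_univ k (mC c) = [:mC c:]" "to_univ k (mVar i) = (if i = k then [:0, 1:] else [:mVar i:])"
    unfolding to_univ_eq_mev by (simp_all only: mev_mC mev_mVar)
qed

lemma poly_to_univ: "poly (to_univ k p) q = msubst (mVar(k := q)) p"
  by (rule mpoly_hom_ext[of "\<lambda>p. poly (to_univ k p) q" "msubst (mVar(k := q))"])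
     (auto simp: to_univ_mVar intro: comm_ring_hom_msubst comm_ring_hom_compose[OF comm_ring_hom_poly comm_ring_hom_to_univ])

lemma poly_to_univ_mVar [simp]: "poly (to_univ k p) (mVar k) = p"
  by (simp add: poly_to_univ msubst_ident)

abbreviation eval_univ :: "nat \<Rightarrow> (nat \<Rightarrow> complex) \<Rightarrow> mpoly \<Rightarrow> complex poly" where
  "eval_univ k a p \<equiv> map_poly (\<lambda>q. meval q a) (to_univ k p)"

lemma comm_ring_hom_eval_univ: "comm_ring_hom (eval_univ k a)"
  by (rule comm_ring_hom_compose[OF comm_ring_hom_map_poly[OF comm_ring_hom_meval] comm_ring_hom_to_univ])

lemma map_poly_const [simp]: "h 0 = 0 \<Longrightarrow> map_poly h [:c:] = [:h c:]"
  by (rule poly_eqI) (simp add: coeff_map_poly coeff_pCons split: nat.split)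

lemma poly_eval_univ [simp]: "poly (eval_univ k a p) z = meval p (a(k := z))"
proof (rule mpoly_hom_ext[of "\<lambda>p. poly (eval_univ k a p) z" "\<lambda>p. meval p (a(k := z))"])
  show "comm_ring_hom (\<lambda>p. poly (eval_univ k a p) z)"
    by (rule comm_ring_hom_compose[OF comm_ring_hom_poly comm_ring_hom_eval_univ])
qed (auto simp: to_univ_mVar map_poly_pCons comm_ring_hom_meval)

lemma mvars_single: "mvars (single m c) \<subseteq> keys m"
  by (auto simp: mvars_def split: if_splits)

lemma coeff_to_univ:
  "coeff (to_univ k p) j = (\<Sum>m\<in>keys p.
     if lookup m k = j then single (mono_drop {k} m) (lookup p m) else 0)"
  by (simp add: to_univ_def coeff_sum if_distrib)

lemma mvars_coeff_to_univ: "mvars (coeff (to_univ k p) j) \<subseteq> mvars p - {k}"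
proof -
  have "mvars (coeff (to_univ k p) j) \<subseteq> (\<Union>m\<in>keys p. keys (mono_drop {k} m))"
    unfolding coeff_to_univ
    by (rule order.trans[OF mvars_sum], rule UN_mono[OF order_refl]) (auto dest: subsetD[OF mvars_single])
  also have "\<dots> = mvars p - {k}"
    by (auto simp: keys_mono_drop mvars_def)
  finally show ?thesis .
qed

lemma mvars_empty: "mvars p = {} \<Longrightarrow> p = mC (lookup p 0)"
  by (rule poly_mapping_eqI) (auto simp: mvars_def mC_def lookup_single when_def in_keys_iff)

lemma finite_mvars [simp]: "finite (mvars p)"
  by (simp add: mvars_def)

text \<open>Induction on the variables: the leading coefficient in one variable is non-zero at some
  point, and the univariate polynomial obtained there has a non-root.\<close>

lemma exists_meval_neq_0:
  assumes "p \<noteq> 0"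
  shows "\<exists>a. meval p a \<noteq> 0"
proof -
  have "\<exists>a. meval p a \<noteq> 0" if "finite A" "mvars p \<subseteq> A" "p \<noteq> 0" for A p
    using that
  proof (induction A arbitrary: p)
    case empty
    then have p: "p = mC (lookup p 0)" by (intro mvars_empty) auto
    with empty have "lookup p 0 \<noteq> 0" by (metis mC_def single_zero)
    then show ?case by (subst p) simp
  next
    case (insert k A)
    have "to_univ k p \<noteq> 0"
      using insert.prems poly_to_univ_mVar[of k p] by fastforce
    then have "lead_coeff (to_univ k p) \<noteq> 0" by simp
    moreover have "mvars (lead_coeff (to_univ k p)) \<subseteq> A"
      using mvars_coeff_to_univ[of k p "degree (to_univ k p)"] insert.prems by auto
    ultimately obtain a where "meval (lead_coeff (to_univ k p)) a \<noteq> 0"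
      using insert.IH by blast
    then have "coeff (eval_univ k a p) (degree (to_univ k p)) \<noteq> 0"
      by (simp add: coeff_map_poly)
    then have "eval_univ k a p \<noteq> 0" by (metis coeff_0)
    then obtain z where "poly (eval_univ k a p) z \<noteq> 0"
      by (meson poly_all_0_iff_0)
    then show ?case by auto
  qed
  from this[OF finite_mvars order_refl assms] show ?thesis .
qed

lemma mpoly_eq_0I: "(\<And>a. meval p a = 0) \<Longrightarrow> p = 0"
  using exists_meval_neq_0 by blast

subsection \<open>Grading\<close>

abbreviation wt :: "nat set \<Rightarrow> (nat \<Rightarrow>\<^sub>0 nat) \<Rightarrow> nat" where
  "wt V m \<equiv> (\<Sum>i\<in>V. lookup m i)"

definition hom_in :: "nat set \<Rightarrow> nat \<Rightarrow> mpoly \<Rightarrow> bool" where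
  "hom_in V n p \<longleftrightarrow> (\<forall>m\<in>keys p. wt V m = n)"

text \<open>Multiplies each variable in \<open>V\<close> by a grading variable. Homogeneity of
  degree \<open>n\<close> becomes the equation \<open>grade V p = monom p n\<close>, which can be
  carried through products and determinants because \<open>grade V\<close> is a ring
  homomorphism.\<close>

definition grade :: "nat set \<Rightarrow> mpoly \<Rightarrow> mpoly poly" where
  "grade V = mev (\<lambda>c. [:mC c:]) (\<lambda>i. if i \<in> V then monom (mVar i) 1 else [:mVar i:])"

lemma comm_ring_hom_grade: "comm_ring_hom (grade V)"
  unfolding grade_def by (rule comm_ring_hom_mev[OF comm_ring_hom_const_mC])

interpretation grade: comm_ring_hom "grade V" for V
  by (rule comm_ring_hom_grade)

lemma grade_eq_sum:
  assumes "finite V"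
  shows "grade V p = (\<Sum>m\<in>keys p. monom (single m (lookup p m)) (wt V m))"
proof -
  let ?a = "\<lambda>i. if i \<in> V then monom (mVar i) 1 else [:mVar i:]"
  have "[:mC c:] * mono_ev ?a m = monom (single m c) (wt V m)" for c m
  proof -
    let ?e = "lookup m"
    have pm: "monom q 1 ^ k = monom (q ^ k) k" for q :: mpoly and k
      by (induction k) (simp_all add: mult_monom)
    have "mono_ev ?a m = (\<Prod>i\<in>keys m. monom (mVar i ^ ?e i) (if i \<in> V then ?e i else 0))"
      unfolding mono_ev_def by (rule prod.cong) (auto simp: pm[unfolded One_nat_def] poly_const_pow monom_0)
    also have "\<dots> = monom (mono_ev mVar m) (\<Sum>i\<in>keys m. if i \<in> V then ?e i else 0)"
    proof -
      have "(\<Prod>i\<in>A. monom (u i) (w i)) = monom (\<Prod>i\<in>A. u i) (\<Sum>i\<in>A. w i)" if "finite A"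
        for A and u :: "nat \<Rightarrow> mpoly" and w
        using that by induction (simp_all add: mult_monom)
      then show ?thesis by (simp add: mono_ev_def)
    qed
    also have "(\<Sum>i\<in>keys m. if i \<in> V then ?e i else 0) = wt V m"
      by (subst sum.inter_restrict[symmetric], simp, rule sum.mono_neutral_left)
         (use assms in \<open>auto simp: in_keys_iff\<close>)
    finally show ?thesis by (simp add: single_eq_mono_ev smult_monom)
  qed
  then show ?thesis by (simp only: grade_def mev_def)
qed

lemma lookup_coeff_grade:
  assumes "finite V"
  shows "lookup (coeff (grade V p) j) m = (if wt V m = j then lookup p m else 0)"
proof -
  have "lookup (coeff (grade V p) j) m =
      (\<Sum>m'\<in>keys p. if m' = m then (if wt V m' = j then lookup p m' else 0) else 0)"
    unfolding grade_eq_sum[OF assms] coeff_sum lookup_sum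
    by (rule sum.cong) (auto simp: lookup_single when_def)
  also have "\<dots> = (if wt V m = j then lookup p m else 0)"
    by (simp add: in_keys_iff)
  finally show ?thesis .
qed

lemma hom_in_iff_grade:
  assumes "finite V"
  shows "hom_in V n p \<longleftrightarrow> grade V p = monom p n"
proof
  assume h: "hom_in V n p"
  show "grade V p = monom p n"
  proof (intro poly_eqI poly_mapping_eqI)
    fix j m show "lookup (coeff (grade V p) j) m = lookup (coeff (monom p n) j) m"
      using h by (cases "m \<in> keys p")
        (auto simp: lookup_coeff_grade[OF assms] hom_in_def in_keys_iff)
  qed
next
  assume g: "grade V p = monom p n"
  show "hom_in V n p"
    unfolding hom_in_def
  proof
    fix m assume "m \<in> keys p"
    moreover have "lookup (coeff (grade V p) (wt V m)) m = lookup p m"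
      by (simp add: lookup_coeff_grade[OF assms])
    ultimately show "wt V m = n" unfolding g by (auto simp: in_keys_iff split: if_splits)
  qed
qed

text \<open>Split off the powers of the variable: the cofactors have the constant product
  \<open>[:c:]\<close>, so they are constants themselves.\<close>

lemma monom_factors:
  fixes A B :: "'a::idom poly"
  assumes "A * B = monom c n" "c \<noteq> 0"
  shows "\<exists>a i b j. A = monom a i \<and> B = monom b j"
proof -
  have nz: "A \<noteq> 0" "B \<noteq> 0" using assms by (auto simp: monom_eq_0_iff)
  obtain A' where A: "A = [:- 0, 1:] ^ order 0 A * A'" "\<not> [:- 0, 1:] dvd A'"
    using order_decomp[OF nz(1), of 0] by blast
  obtain B' where B: "B = [:- 0, 1:] ^ order 0 B * B'" "\<not> [:- 0, 1:] dvd B'"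
    using order_decomp[OF nz(2), of 0] by blast
  have n: "order 0 (monom c n) = n"
    using assms(2) by simp
  have "order 0 A + order 0 B = n"
    using order_mult[of A B 0] nz n assms by simp
  have "[:0, 1:] ^ n * (A' * B') = ([:- 0, 1:] ^ order 0 A * A') * ([:- 0, 1:] ^ order 0 B * B')"
    unfolding \<open>order 0 A + order 0 B = n\<close>[symmetric] by (simp add: power_add mult_ac)
  also have "\<dots> = A * B" by (simp only: A(1)[symmetric] B(1)[symmetric])
  also have "\<dots> = [:0, 1:] ^ n * [:c:]" by (simp add: assms(1) monom_altdef)
  finally have *: "[:0, 1:] ^ n * (A' * B') = [:0, 1:] ^ n * [:c:]" .
  have "[:0, 1:] ^ n \<noteq> (0 :: 'a poly)" by simp
  from mult_left_cancel[OF this] * have "A' * B' = [:c:]" by blast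
  then have "degree A' = 0" "degree B' = 0"
    using degree_mult_eq[of A' B'] assms(2) by (cases "A' = 0 \<or> B' = 0"; force)+
  then obtain a b where "A' = [:a:]" "B' = [:b:]" by (meson degree_eq_zeroE)
  then have "A = monom a (order 0 A)" "B = monom b (order 0 B)"
    using A(1) B(1) by (simp_all add: monom_altdef)
  then show ?thesis by blast
qed

text \<open>Used to pass homogeneity from the resultant to its content and its primitive
  part.\<close>

lemma hom_in_factors:
  assumes "finite V" "hom_in V n (p * q)" "p * q \<noteq> 0"
  shows "\<exists>k l. hom_in V k p \<and> hom_in V l q"
proof -
  have "grade V p * grade V q = monom (p * q) n"
    using assms(2) unfolding hom_in_iff_grade[OF assms(1)] by (simp add: grade.hom_mult)
  from monom_factors[OF this assms(3)]
  obtain a i b j where g: "grade V p = monom a i" "grade V q = monom b j" by blast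
  have "hom_in V i p" if "grade V p = monom a i" for p a i
    unfolding hom_in_def
  proof
    fix m assume "m \<in> keys p"
    moreover have "lookup (coeff (grade V p) (wt V m)) m = lookup p m"
      by (simp add: lookup_coeff_grade[OF assms(1)])
    ultimately show "wt V m = i" unfolding that by (auto simp: in_keys_iff split: if_splits)
  qed
  with g show ?thesis by blast
qed

lemma not_in_mvars_iff: "i \<notin> mvars p \<longleftrightarrow> hom_in {i} 0 p"
  by (auto simp: mvars_def hom_in_def in_keys_iff)

text \<open>The degree of \<open>grade {i}\<close> is the degree in the variable \<open>i\<close>
  and is additive over a domain, so a divisor of a polynomial free of \<open>i\<close> is free of
  \<open>i\<close> as well.\<close>

lemma mvars_dvd:
  assumes "p dvd q" "q \<noteq> 0"
  shows "mvars p \<subseteq> mvars q"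
proof
  fix i assume i: "i \<in> mvars p"
  show "i \<in> mvars q"
  proof (rule ccontr)
    assume "i \<notin> mvars q"
    then have h: "hom_in {i} 0 q" by (simp add: not_in_mvars_iff)
    obtain r where q: "q = p * r" using assms(1) by (elim dvdE)
    have "grade {i} p * grade {i} r = monom q 0"
      using h unfolding hom_in_iff_grade[OF finite.insertI[OF finite.emptyI]] by (simp add: q grade.hom_mult)
    then have "degree (grade {i} p * grade {i} r) = 0" by (simp add: degree_monom_eq assms(2))
    moreover have "grade {i} p * grade {i} r \<noteq> 0"
      unfolding \<open>grade {i} p * grade {i} r = _\<close> using assms(2) by simp
    ultimately have "degree (grade {i} p) = 0" by (auto simp: degree_mult_eq)
    moreover obtain m where m: "m \<in> keys p" "i \<in> keys m"
      using i by (auto simp: mvars_def)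
    have "lookup (coeff (grade {i} p) (wt {i} m)) m \<noteq> 0"
      using m by (subst lookup_coeff_grade) (auto simp: in_keys_iff)
    then have "coeff (grade {i} p) (wt {i} m) \<noteq> 0" by auto
    then have "wt {i} m \<le> degree (grade {i} p)" by (rule le_degree)
    ultimately show False using m(2) by (simp add: in_keys_iff)
  qed
qed

lemma deg_set_hom_in:
  assumes "hom_in V n p" "p \<noteq> 0"
  shows "deg_set V p = n"
proof -
  have "(\<lambda>m. wt V m) ` keys p = {n}"
  proof -
    obtain m where "m \<in> keys p" using assms(2) by fastforce
    then show ?thesis using assms(1) by (force simp: hom_in_def)
  qed
  then show ?thesis by (simp add: deg_set_def)
qed

lemma meval_hom_in:
  assumes "finite V" "hom_in V n p"
  shows "meval p (\<lambda>i. if i \<in> V then r * a i else a i) = r ^ n * meval p a"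
proof -
  have "mono_ev (\<lambda>i. if i \<in> V then r * a i else a i) m = r ^ wt V m * mono_ev a m" for m
  proof -
    let ?K = "keys m \<union> V"
    have "mono_ev (\<lambda>i. if i \<in> V then r * a i else a i) m =
        (\<Prod>i\<in>?K. (if i \<in> V then r ^ lookup m i else 1) * a i ^ lookup m i)"
      unfolding mono_ev_superset[of ?K m, OF finite_UnI[OF finite_keys assms(1)] Un_upper1]
      by (rule prod.cong) (auto simp: power_mult_distrib)
    also have "\<dots> = (\<Prod>i\<in>?K. (if i \<in> V then r ^ lookup m i else 1)) * mono_ev a m"
      using assms(1) by (simp add: prod.distrib mono_ev_superset[of ?K])
    also have "(\<Prod>i\<in>?K. (if i \<in> V then r ^ lookup m i else 1)) = (\<Prod>i\<in>V. r ^ lookup m i)"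
      using assms(1) by (intro prod.mono_neutral_cong_right) auto
    finally show ?thesis by (simp add: power_sum)
  qed
  then show ?thesis
    using assms(2) by (simp add: meval_mev mev_def sum_distrib_left hom_in_def mult_ac)
qed

lemma hom_in_add: "hom_in V n p \<Longrightarrow> hom_in V n q \<Longrightarrow> hom_in V n (p + q)"
  unfolding hom_in_def using Poly_Mapping.keys_add[of p q] by blast

lemma hom_in_uminus: "hom_in V n p \<Longrightarrow> hom_in V n (- p)"
  by (simp add: hom_in_def)

lemma hom_in_diff: "hom_in V n p \<Longrightarrow> hom_in V n q \<Longrightarrow> hom_in V n (p - q)"
  using hom_in_add[of V n p "- q"] by (simp add: hom_in_uminus)

lemma hom_in_mult: "hom_in V n p \<Longrightarrow> hom_in V k q \<Longrightarrow> hom_in V (n + k) (p * q)"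
  unfolding hom_in_def using keys_mult[of p q] by (fastforce simp: lookup_add sum.distrib)

lemma hom_in_mVar: "finite V \<Longrightarrow> hom_in V (if i \<in> V then 1 else 0) (mVar i)"
  by (simp add: hom_in_def mVar_def lookup_single when_def)

lemma hom_in_sum: "(\<And>x. x \<in> A \<Longrightarrow> hom_in V n (f x)) \<Longrightarrow> hom_in V n (sum f A)"
proof (induction A rule: infinite_finite_induct)
  case (insert x F)
  then show ?case by (simp add: hom_in_add)
qed (simp_all add: hom_in_def)

lemma hom_in_single: "wt V m = n \<Longrightarrow> hom_in V n (single m c)"
  by (simp add: hom_in_def)

subsection \<open>Partial derivatives\<close>

lemma mpderiv_add: "mpderiv i (p + q) = mpderiv i p + mpderiv i q"
  unfolding mpderiv_def
  by (rule setsum_keys_plus_distrib) (simp_all add: distrib_left single_add)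

lemma mpderiv_single:
  "mpderiv i (single m c) =
    single (m - single i 1) (of_nat (lookup m i) * c)"
  by (simp add: mpderiv_def)

lemma mpderiv_sum: "mpderiv i (sum f A) = (\<Sum>x\<in>A. mpderiv i (f x))"
proof (induction A rule: infinite_finite_induct)
  case (insert x F)
  then show ?case by (simp add: mpderiv_add)
qed (simp_all add: mpderiv_def)

lemma mono_minus_single_add:
  "lookup m i > 0 \<Longrightarrow>
    m - single i 1 + m' = m + m' - single i (1::nat)"
  by (rule poly_mapping_eqI) (auto simp: lookup_add lookup_minus lookup_single when_def)

lemma mpderiv_mult: "mpderiv i (p * q) = mpderiv i p * q + p * mpderiv i q"
proof -
  let ?s = "\<lambda>p m. single m (lookup p m)"
  have prod: "p * q = (\<Sum>m\<in>keys p. \<Sum>m'\<in>keys q. ?s p m * ?s q m')" for p q :: mpoly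
    by (subst (1) poly_mapping_sum_singles, subst (2) poly_mapping_sum_singles)
       (simp add: sum_product)
  have single: "mpderiv i (single m c * single m' c') =
      mpderiv i (single m c) * single m' c' +
      single m c * mpderiv i (single m' c')" for m m' c c'
  proof -
    let ?e = "single i (1::nat)"
    \<comment> \<open>If the variable does not occur in \<open>m\<close>, truncated subtraction
      makes the two exponents differ, but then the coefficient is 0 on both sides.\<close>
    have "single (m - ?e + m') (of_nat (lookup m i) * c * c') =
        single (m + m' - ?e) (of_nat (lookup m i) * c * c')"
      by (cases "lookup m i > 0") (simp_all only: mono_minus_single_add, simp)
    moreover have "single (m + (m' - ?e)) (c * (of_nat (lookup m' i) * c')) =
        single (m + m' - ?e) (c * (of_nat (lookup m' i) * c'))"
      using mono_minus_single_add[of m' i m]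
      by (cases "lookup m' i > 0") (simp_all only: add.commute, simp)
    ultimately show ?thesis
      by (simp add: mult_single mpderiv_single lookup_add algebra_simps flip: single_add)
  qed
  have "mpderiv i (p * q) = (\<Sum>m\<in>keys p. \<Sum>m'\<in>keys q.
      mpderiv i (?s p m) * ?s q m' + ?s p m * mpderiv i (?s q m'))"
    by (subst prod) (simp only: mpderiv_sum single)
  also have "\<dots> = (\<Sum>m\<in>keys p. mpderiv i (?s p m)) * (\<Sum>m\<in>keys q. ?s q m) +
      (\<Sum>m\<in>keys p. ?s p m) * (\<Sum>m\<in>keys q. mpderiv i (?s q m))"
    by (simp add: sum.distrib sum_product)
  also have "\<dots> = mpderiv i p * q + p * mpderiv i q"
    by (simp only: mpderiv_sum[symmetric] poly_mapping_sum_singles[symmetric])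
  finally show ?thesis .
qed

lemma mpderiv_mC [simp]: "mpderiv i (mC c) = 0"
  by (simp add: mC_def mpderiv_single)

lemma mpderiv_mVar: "mpderiv i (mVar j) = (if i = j then 1 else 0)"
  by (auto simp: mVar_def mpderiv_single lookup_single when_def)

text \<open>The bridge from formal to analytic derivatives: the later relations between partial
  derivatives all come from the chain rule and the uniqueness of derivatives.\<close>

lemma has_field_derivative_meval:
  assumes "finite V" "\<And>i. ((\<lambda>z. a z i) has_field_derivative a' i) (at x)" "\<And>i. i \<notin> V \<Longrightarrow> a' i = 0"
  shows "((\<lambda>z. meval p (a z)) has_field_derivative (\<Sum>i\<in>V. meval (mpderiv i p) (a x) * a' i)) (at x)"
proof (induction p rule: mpoly_induct)
  case (const c)
  then show ?case by simp
next
  case (var j)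
  have "(\<Sum>i\<in>V. meval (mpderiv i (mVar j)) (a x) * a' i) = (\<Sum>i\<in>V. if i = j then a' i else 0)"
    by (rule sum.cong) (auto simp: mpderiv_mVar)
  also have "\<dots> = a' j" using assms(1,3) by simp
  finally show ?case using assms(2)[of j] by simp
next
  case (add p q)
  have "(\<Sum>i\<in>V. meval (mpderiv i (p + q)) (a x) * a' i) =
      (\<Sum>i\<in>V. meval (mpderiv i p) (a x) * a' i) + (\<Sum>i\<in>V. meval (mpderiv i q) (a x) * a' i)"
    by (simp add: mpderiv_add meval.hom_add algebra_simps sum.distrib)
  then show ?case using DERIV_add[OF add] by (simp add: meval.hom_add)
next
  case (mult p q)
  have "(\<Sum>i\<in>V. meval (mpderiv i (p * q)) (a x) * a' i) =
      (\<Sum>i\<in>V. meval (mpderiv i p) (a x) * a' i) * meval q (a x) +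
      (\<Sum>i\<in>V. meval (mpderiv i q) (a x) * a' i) * meval p (a x)"
    by (simp add: mpderiv_mult meval.hom_add meval.hom_mult algebra_simps sum.distrib sum_distrib_left)
  then show ?case using DERIV_mult[OF mult] by (simp add: meval.hom_mult)
qed

lemma mvars_mpderiv: "mvars (mpderiv i p) \<subseteq> mvars p"
proof -
  have "mvars (mpderiv i p) \<subseteq> (\<Union>m\<in>keys p. keys (m - single i (1::nat)))"
    unfolding mpderiv_def
    by (rule order.trans[OF mvars_sum], rule UN_mono[OF order_refl], rule mvars_single)
  also have "\<dots> \<subseteq> (\<Union>m\<in>keys p. keys m)"
    by (rule UN_mono[OF order_refl]) (auto simp: in_keys_iff lookup_minus)
  finally show ?thesis by (simp add: mvars_def[of p])
qed

lemma hom_in_mpderiv: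
  assumes "finite V" "i \<in> V" "hom_in V (Suc n) p"
  shows "hom_in V n (mpderiv i p)"
  unfolding mpderiv_def
proof (rule hom_in_sum)
  fix m assume m: "m \<in> keys p"
  show "hom_in V n (single (m - single i 1)
      (of_nat (lookup m i) * lookup p m))"
  proof (cases "lookup m i = 0")
    case False
    have "wt V (m - single i 1 + single i 1) =
        wt V (m - single i 1) + wt V (single i 1)"
      by (simp add: lookup_add sum.distrib)
    moreover have "m - single i 1 + single i 1 = m"
      using False by (intro poly_mapping_eqI) (auto simp: lookup_add lookup_minus lookup_single when_def)
    moreover have "wt V (single i 1) = 1"
      using assms(1,2) by (simp add: lookup_single when_def)
    moreover have "wt V m = Suc n" using assms(3) m by (simp add: hom_in_def)
    ultimately show ?thesis by (intro hom_in_single) simp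
  qed (simp add: hom_in_def)
qed

subsection \<open>Coefficients with respect to a set of variables\<close>

lemma xcoeff_add:
  assumes "finite X"
  shows "xcoeff X (p + q) \<alpha> = xcoeff X p \<alpha> + xcoeff X q \<alpha>"
proof -
  have eq: "xcoeff X p \<alpha> = (\<Sum>m\<in>keys p.
      if \<forall>i\<in>X. lookup m i = lookup \<alpha> i
      then single (mono_drop X m) (lookup p m) else 0)" for p
    unfolding xcoeff_def by (simp add: sum.If_cases Int_def)
  show ?thesis
    unfolding eq by (rule setsum_keys_plus_distrib) (simp_all add: single_add)
qed

lemma xcoeff_sum: "finite X \<Longrightarrow> xcoeff X (sum f A) \<alpha> = (\<Sum>x\<in>A. xcoeff X (f x) \<alpha>)"
proof (induction A rule: infinite_finite_induct)
  case (insert x F)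
  then show ?case by (simp add: xcoeff_add)
qed (simp_all add: xcoeff_def)

lemma xcoeff_mult:
  assumes "finite X" "mvars p \<inter> X = {}"
  shows "xcoeff X (p * q) \<alpha> = p * xcoeff X q \<alpha>"
proof -
  let ?s = "\<lambda>p m. single m (lookup p m)"
  have single: "xcoeff X (single m c) \<alpha> =
      (if \<forall>i\<in>X. lookup m i = lookup \<alpha> i then single (mono_drop X m) c else 0)"
    for m c
    by (cases "c = 0") (auto simp: xcoeff_def Collect_conv_if)
  have "xcoeff X (?s p m * ?s q m') \<alpha> = ?s p m * xcoeff X (?s q m') \<alpha>"
    if "m \<in> keys p" for m m'
  proof -
    have K: "keys m \<inter> X = {}" using assms(2) that by (auto simp: mvars_def)
    then have "lookup m i = 0" if "i \<in> X" for i
      using that by (auto simp: in_keys_iff)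
    then show ?thesis
      by (simp add: mult_single single lookup_add mono_drop_add assms(1) mono_drop_ident[OF assms(1) K])
  qed
  moreover have "p * q = (\<Sum>m\<in>keys p. \<Sum>m'\<in>keys q. ?s p m * ?s q m')"
    by (subst (1) poly_mapping_sum_singles, subst (2) poly_mapping_sum_singles)
       (simp add: sum_product)
  ultimately have "xcoeff X (p * q) \<alpha> = (\<Sum>m\<in>keys p. \<Sum>m'\<in>keys q.
      ?s p m * xcoeff X (?s q m') \<alpha>)"
    by (simp add: xcoeff_sum assms(1))
  also have "\<dots> = (\<Sum>m\<in>keys p. ?s p m) * (\<Sum>m\<in>keys q. xcoeff X (?s q m) \<alpha>)"
    by (simp add: sum_product)
  also have "(\<Sum>m\<in>keys q. xcoeff X (?s q m) \<alpha>) = xcoeff X q \<alpha>"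
    unfolding xcoeff_sum[OF assms(1), symmetric] poly_mapping_sum_singles[symmetric] ..
  finally show ?thesis by (simp only: poly_mapping_sum_singles[symmetric])
qed

lemma mvars_xcoeff: "finite X \<Longrightarrow> mvars (xcoeff X p \<alpha>) \<subseteq> mvars p - X"
  unfolding xcoeff_def
  by (rule order.trans[OF mvars_sum])
     (auto simp: mvars_def[of p] keys_mono_drop dest!: subsetD[OF mvars_single])

text \<open>Distinct monomials with equal exponents on \<open>X\<close> still differ outside
  \<open>X\<close>, so nothing cancels in this coefficient.\<close>

lemma xcoeff_self: 
  assumes "finite X" "m \<in> keys p"
  shows "xcoeff X p m \<noteq> 0"
proof -
  let ?M = "{m'\<in>keys p. \<forall>i\<in>X. lookup m' i = lookup m i}"
  have "lookup (xcoeff X p m) (mono_drop X m) =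
      (\<Sum>m'\<in>?M. if m' = m then lookup p m' else 0)"
    unfolding xcoeff_def lookup_sum
  proof (rule sum.cong[OF refl])
    fix m' assume m': "m' \<in> ?M"
    have "m' = m" if "mono_drop X m' = mono_drop X m"
    proof (rule poly_mapping_eqI)
      fix i show "lookup m' i = lookup m i"
        using arg_cong[OF that, of "\<lambda>k. lookup k i"] m'
        by (auto simp: lookup_mono_drop[OF assms(1)] split: if_splits)
    qed
    then show "lookup (single (mono_drop X m') (lookup p m')) (mono_drop X m) =
        (if m' = m then lookup p m' else 0)"
      by (auto simp: lookup_single when_def)
  qed
  also have "\<dots> = lookup p m" using assms(2) by simp
  finally show ?thesis using assms(2) by (auto simp: in_keys_iff)
qed

subsection \<open>Bivariate and trivariate views\<close>

lemma comm_ring_hom_const2: "comm_ring_hom (\<lambda>c::complex. [:[:c:]:])"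
  by (rule comm_ring_hom_compose[OF comm_ring_hom_const_poly comm_ring_hom_const_poly])

definition to_bi :: "(nat \<Rightarrow> complex poly poly) \<Rightarrow> mpoly \<Rightarrow> complex poly poly" where
  "to_bi = mev (\<lambda>c. [:[:c:]:])"

lemma comm_ring_hom_to_bi: "comm_ring_hom (to_bi \<sigma>)"
  unfolding to_bi_def by (rule comm_ring_hom_mev[OF comm_ring_hom_const2])

interpretation to_bi: comm_ring_hom "to_bi \<sigma>" for \<sigma>
  by (rule comm_ring_hom_to_bi)

lemma to_bi_mC [simp]: "to_bi \<sigma> (mC c) = [:[:c:]:]"
  and to_bi_mVar [simp]: "to_bi \<sigma> (mVar i) = \<sigma> i"
proof -
  interpret comm_ring_hom "\<lambda>c::complex. [:[:c:]:]" by (rule comm_ring_hom_const2)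
  show "to_bi \<sigma> (mC c) = [:[:c:]:]" "to_bi \<sigma> (mVar i) = \<sigma> i"
    unfolding to_bi_def using hom_zero hom_one by (simp_all only: mev_mC mev_mVar)
qed

lemma bi_to_bi: "bi (to_bi \<sigma> p) a b = meval p (\<lambda>i. bi (\<sigma> i) a b)"
  by (rule mpoly_hom_ext[of "\<lambda>p. bi (to_bi \<sigma> p) a b" "\<lambda>p. meval p (\<lambda>i. bi (\<sigma> i) a b)"])
     (auto intro: comm_ring_hom_compose[OF bi_hom comm_ring_hom_to_bi] comm_ring_hom_meval)

lemma poly2_eq_0I:
  fixes P :: "complex poly poly"
  assumes "\<And>a b. bi P a b = 0"
  shows "P = 0"
proof (rule ccontr)
  assume "P \<noteq> 0"
  from eventually_cofinite_bi_neq_0[OF this] assms show False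
    by (simp add: eventually_cofinite infinite_UNIV_char_0)
qed

lemma pt_simps [simp]:
  "pt2 a b 0 = a" "pt2 a b 1 = b" "pt2 a b (Suc 0) = b"
  "pt3 a b c 0 = a" "pt3 a b c 1 = b" "pt3 a b c (Suc 0) = b" "pt3 a b c 2 = c"
  by (simp_all add: pt2_def pt3_def)

abbreviation coord2 :: "nat \<Rightarrow> complex poly poly" where
  "coord2 i \<equiv> (if i = 0 then [:[:0, 1:]:] else if i = 1 then [:0, 1:] else 0)"

lemma bi_coord2: "(\<lambda>i. bi (coord2 i) a b) = pt2 a b"
  by (rule ext) (simp add: pt2_def)

lemma bi_to_bi_coord2: "bi (to_bi coord2 p) a b = meval p (pt2 a b)"
  by (simp only: bi_to_bi bi_coord2)

text \<open>Inverse of \<open>to_bi coord2\<close> on the polynomials in the variables 0 and 1.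
  Through this pair irreducibility and divisibility are transported to and from
  \<open>complex poly poly\<close>, where gcds and resultants are at hand.\<close>

definition of_bi :: "complex poly poly \<Rightarrow> mpoly" where
  "of_bi P = poly (map_poly (\<lambda>q. poly (map_poly mC q) (mVar 0)) P) (mVar 1)"

lemma comm_ring_hom_of_bi: "comm_ring_hom of_bi"
  unfolding of_bi_def
  by (intro comm_ring_hom_compose[OF comm_ring_hom_poly comm_ring_hom_map_poly]
      comm_ring_hom_compose[OF comm_ring_hom_poly comm_ring_hom_map_poly[OF comm_ring_hom_mC]])

interpretation of_bi: comm_ring_hom of_bi
  by (rule comm_ring_hom_of_bi)

lemma of_bi_simps [simp]: "of_bi [:[:c:]:] = mC c" "of_bi [:pCons 0 1:] = mVar 0" "of_bi (pCons 0 1) = mVar 1"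
proof -
  interpret comm_ring_hom mC by (rule comm_ring_hom_mC)
  show "of_bi [:[:c:]:] = mC c" "of_bi [:pCons 0 1:] = mVar 0" "of_bi (pCons 0 1) = mVar 1"
    by (simp_all add: of_bi_def map_poly_pCons)
qed

lemma of_bi_to_bi: "mvars p \<subseteq> {0, 1} \<Longrightarrow> of_bi (to_bi coord2 p) = p"
  by (rule mpoly_hom_ext[of "\<lambda>p. of_bi (to_bi coord2 p)" "\<lambda>p. p"])
     (auto intro: comm_ring_hom_compose[OF comm_ring_hom_of_bi comm_ring_hom_to_bi] comm_ring_hom_id)

lemma to_bi_of_bi: "to_bi coord2 (of_bi P) = P"
proof -
  have "bi (to_bi coord2 (of_bi P)) a b = bi P a b" for a b
  proof -
    have in0: "meval (poly (map_poly mC q) (mVar 0)) (pt2 a b) = poly q a" for q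
    proof -
      interpret comm_ring_hom mC by (rule comm_ring_hom_mC)
      show ?thesis
        by (induction q) (simp_all add: map_poly_pCons meval.hom_add meval.hom_mult)
    qed
    show ?thesis
      unfolding bi_to_bi_coord2 of_bi_def
    proof (induction P)
      case (pCons c P)
      have "(\<lambda>q. poly (map_poly mC q) (mVar 0)) 0 = 0" by simp
      with pCons show ?case
        by (simp add: map_poly_pCons meval.hom_add meval.hom_mult in0 bi_def)
    qed simp
  qed
  then have "to_bi coord2 (of_bi P) - P = 0" by (intro poly2_eq_0I) simp
  then show ?thesis by simp
qed

lemma irreducible_to_bi:
  assumes "mvars f \<subseteq> {0, 1}" "irreducible f"
  shows "irreducible (to_bi coord2 f)"
proof (rule irreducibleI)
  show "to_bi coord2 f \<noteq> 0"
    using assms(2) of_bi_to_bi[OF assms(1)] by (auto simp: irreducible_def)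
  show "\<not> is_unit (to_bi coord2 f)"
    using assms(2) of_bi_to_bi[OF assms(1)] of_bi.hom_dvd_1[of "to_bi coord2 f"] by (auto simp: irreducible_def)
next
  fix A B assume "to_bi coord2 f = A * B"
  then have "f = of_bi A * of_bi B"
    using of_bi_to_bi[OF assms(1)] by (simp flip: of_bi.hom_mult)
  then have "of_bi A dvd 1 \<or> of_bi B dvd 1"
    using assms(2) by (auto simp: irreducible_def)
  then show "is_unit A \<or> is_unit B"
    using to_bi.hom_dvd_1[of "of_bi A" coord2] to_bi.hom_dvd_1[of "of_bi B" coord2] by (auto simp: to_bi_of_bi)
qed

lemma to_bi_dvdD:
  assumes "mvars f \<subseteq> {0, 1}" "mvars p \<subseteq> {0, 1}" "to_bi coord2 f dvd to_bi coord2 p"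
  shows "f dvd p"
  using of_bi.hom_dvd[OF assms(3)] by (simp only: of_bi_to_bi assms(1,2))

text \<open>Sets the variable \<open>d\<close> apart as the main variable of a polynomial over \<open>\<complex>[x\<^sub>1][x\<^sub>2]\<close>.\<close>
definition to_tri :: "mpoly \<Rightarrow> complex poly poly poly" where
  "to_tri p = map_poly (to_bi coord2) (to_univ 2 p)"

definition of_tri :: "complex poly poly poly \<Rightarrow> mpoly" where
  "of_tri P = poly (map_poly of_bi P) (mVar 2)"

lemma comm_ring_hom_to_tri: "comm_ring_hom to_tri"
  unfolding to_tri_def by (rule comm_ring_hom_compose[OF comm_ring_hom_map_poly[OF comm_ring_hom_to_bi] comm_ring_hom_to_univ])

lemma comm_ring_hom_of_tri: "comm_ring_hom of_tri"
  unfolding of_tri_def by (rule comm_ring_hom_compose[OF comm_ring_hom_poly comm_ring_hom_map_poly[OF comm_ring_hom_of_bi]])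

interpretation to_tri: comm_ring_hom to_tri by (rule comm_ring_hom_to_tri)
interpretation of_tri: comm_ring_hom of_tri by (rule comm_ring_hom_of_tri)

lemma of_tri_to_tri:
  assumes "mvars p \<subseteq> {0, 1, 2}"
  shows "of_tri (to_tri p) = p"
proof -
  have "map_poly of_bi (to_tri p) = to_univ 2 p"
  proof (rule poly_eqI)
    fix j
    have "mvars (coeff (to_univ 2 p) j) \<subseteq> {0, 1}" using mvars_coeff_to_univ[of 2 p j] assms by auto
    then show "coeff (map_poly of_bi (to_tri p)) j = coeff (to_univ 2 p) j"
      by (simp add: to_tri_def coeff_map_poly of_bi_to_bi)
  qed
  then show ?thesis by (simp add: of_tri_def)
qed

lemma to_tri_of_tri: "to_tri (of_tri P) = P"
proof -
  have const: "to_univ 2 (of_bi q) = [:of_bi q:]" for q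
  proof -
    have c: "to_univ 2 (poly (map_poly mC q) (mVar 0)) = [:poly (map_poly mC q) (mVar 0):]" for q
    proof -
      interpret comm_ring_hom mC by (rule comm_ring_hom_mC)
      show ?thesis
        by (induction q) (simp_all add: map_poly_pCons to_univ.hom_add to_univ.hom_mult to_univ_mVar)
    qed
    show ?thesis
      unfolding of_bi_def
    proof (induction q)
      case (pCons c q)
      have "(\<lambda>q. poly (map_poly mC q) (mVar 0)) 0 = 0" by simp
      with pCons show ?case
        by (simp add: map_poly_pCons to_univ.hom_add to_univ.hom_mult c to_univ_mVar)
    qed simp
  qed
  show ?thesis
    unfolding of_tri_def
  proof (induction P)
    case (pCons q P)
    have "to_tri (of_bi q + mVar 2 * poly (map_poly of_bi P) (mVar 2)) = to_tri (of_bi q) + to_tri (mVar 2) * P"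
      using pCons by (simp add: to_tri.hom_add to_tri.hom_mult)
    also have "to_tri (of_bi q) = [:q:]" by (simp add: to_tri_def const to_bi_of_bi)
    also have "to_tri (mVar 2) = [:0, 1:]" by (simp add: to_tri_def to_univ_mVar map_poly_pCons)
    finally show ?case using pCons by (simp add: map_poly_pCons)
  qed simp
qed

lemma squarefree_to_tri:
  assumes "mvars g \<subseteq> {0, 1, 2}" "squarefree g"
  shows "squarefree (to_tri g)"
proof (rule squarefreeI)
  fix A assume "A ^ 2 dvd to_tri g"
  then have "of_tri (A ^ 2) dvd of_tri (to_tri g)" by (rule of_tri.hom_dvd)
  then have "of_tri A ^ 2 dvd g" by (simp add: of_tri_to_tri[OF assms(1)] of_tri.hom_power)
  then have "of_tri A dvd 1" by (rule squarefreeD[OF assms(2)])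
  then show "is_unit A" using to_tri.hom_dvd_1[of "of_tri A"] by (simp add: to_tri_of_tri)
qed

text \<open>Separates \<open>g\<close> into two polynomials in the squared distance, the quantity
  whose gradient is known geometrically.\<close>

lemma even_odd_decomposition:
  "\<exists>g0 g1. \<forall>a b c. meval g (pt3 a b c) = meval g0 (pt3 a b (c ^ 2)) + c * meval g1 (pt3 a b (c ^ 2))"
proof (induction g rule: mpoly_induct)
  case (const c)
  show ?case by (rule exI[of _ "mC c"], rule exI[of _ 0]) simp
next
  case (var i)
  show ?case
  proof (cases "i = 2")
    case True
    then show ?thesis by (intro exI[of _ 0] exI[of _ 1]) (simp add: pt3_def)
  next
    case False
    then show ?thesis by (intro exI[of _ "mVar i"] exI[of _ 0]) (simp add: pt3_def)
  qed
next
  case (add p q)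
  then obtain p0 p1 q0 q1 where
    "\<forall>a b c. meval p (pt3 a b c) = meval p0 (pt3 a b (c ^ 2)) + c * meval p1 (pt3 a b (c ^ 2))"
    "\<forall>a b c. meval q (pt3 a b c) = meval q0 (pt3 a b (c ^ 2)) + c * meval q1 (pt3 a b (c ^ 2))" by blast
  then show ?case
    by (intro exI[of _ "p0 + q0"] exI[of _ "p1 + q1"]) (simp add: meval.hom_add algebra_simps)
next
  case (mult p q)
  then obtain p0 p1 q0 q1 where
    "\<forall>a b c. meval p (pt3 a b c) = meval p0 (pt3 a b (c ^ 2)) + c * meval p1 (pt3 a b (c ^ 2))"
    "\<forall>a b c. meval q (pt3 a b c) = meval q0 (pt3 a b (c ^ 2)) + c * meval q1 (pt3 a b (c ^ 2))" by blast
  then show ?case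
    by (intro exI[of _ "p0 * q0 + mVar 2 * p1 * q1"] exI[of _ "p0 * q1 + p1 * q0"])
       (simp add: meval.hom_add meval.hom_mult pt3_def algebra_simps power2_eq_square)
qed

subsection \<open>The curve and its normals\<close>

text \<open>Keeps the variable index \<open>1\<close> from being rewritten to \<open>Suc 0\<close>.\<close>
declare One_nat_def [simp del]

lemma meval_poly_curve: "\<exists>q. \<forall>z. meval p (\<lambda>i. poly (\<sigma> i) z) = poly q z"
proof (induction p rule: mpoly_induct)
  case (const c)
  show ?case by (rule exI[of _ "[:c:]"]) simp
next
  case (var i)
  show ?case by (rule exI[of _ "\<sigma> i"]) simp
next
  case (add p q)
  then obtain p' q' where "\<forall>z. meval p (\<lambda>i. poly (\<sigma> i) z) = poly p' z"
    "\<forall>z. meval q (\<lambda>i. poly (\<sigma> i) z) = poly q' z" by blast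
  then show ?case by (intro exI[of _ "p' + q'"]) (simp add: meval.hom_add)
next
  case (mult p q)
  then obtain p' q' where "\<forall>z. meval p (\<lambda>i. poly (\<sigma> i) z) = poly p' z"
    "\<forall>z. meval q (\<lambda>i. poly (\<sigma> i) z) = poly q' z" by blast
  then show ?case by (intro exI[of _ "p' * q'"]) (simp add: meval.hom_mult)
qed

lemma pt2_poly_line: "pt2 (u + v * z) (u' + v' * z) = (\<lambda>i. poly (if i = 0 then [:u, v:] else if i = 1 then [:u', v':] else 0) z)"
  by (rule ext) (simp add: pt2_def mult.commute)

lemma meval_pt2_line: "\<exists>q. \<forall>z. meval p (pt2 (u + v * z) (u' + v' * z)) = poly q z"
  unfolding pt2_poly_line by (rule meval_poly_curve)

lemma infinite_UNIV_complex: "infinite (UNIV :: complex set)"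
  by (rule infinite_UNIV_char_0)

lemma infinite_if_eventually_cofinite:
  "\<forall>\<^sub>F a in cofinite. P a \<Longrightarrow> infinite {a::complex. P a}"
proof
  assume "\<forall>\<^sub>F a in cofinite. P a" "finite {a. P a}"
  then have "finite ({a. P a} \<union> {a. \<not> P a})" by (simp add: eventually_cofinite)
  moreover have "{a. P a} \<union> {a. \<not> P a} = UNIV" by blast
  ultimately show False using infinite_UNIV_complex by simp
qed

lemma DERIV_meval_pt2:
  assumes "(u has_field_derivative u') (at x)" "(v has_field_derivative v') (at x)"
  shows "((\<lambda>z. meval p (pt2 (u z) (v z))) has_field_derivative
    meval (mpderiv 0 p) (pt2 (u x) (v x)) * u' + meval (mpderiv 1 p) (pt2 (u x) (v x)) * v') (at x)"
proof -
  have "((\<lambda>z. meval p (pt2 (u z) (v z))) has_field_derivative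
      (\<Sum>i\<in>{0, 1}. meval (mpderiv i p) (pt2 (u x) (v x)) * pt2 u' v' i)) (at x)"
    by (rule has_field_derivative_meval) (use assms in \<open>auto simp: pt2_def\<close>)
  then show ?thesis by (simp add: pt2_def)
qed

lemma DERIV_meval_pt3:
  assumes "(u has_field_derivative u') (at x)" "(v has_field_derivative v') (at x)"
    "(w has_field_derivative w') (at x)"
  shows "((\<lambda>z. meval p (pt3 (u z) (v z) (w z))) has_field_derivative
    meval (mpderiv 0 p) (pt3 (u x) (v x) (w x)) * u' + meval (mpderiv 1 p) (pt3 (u x) (v x) (w x)) * v' +
    meval (mpderiv 2 p) (pt3 (u x) (v x) (w x)) * w') (at x)"
proof -
  have "((\<lambda>z. meval p (pt3 (u z) (v z) (w z))) has_field_derivative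
      (\<Sum>i\<in>{0, 1, 2}. meval (mpderiv i p) (pt3 (u x) (v x) (w x)) * pt3 u' v' w' i)) (at x)"
    by (rule has_field_derivative_meval) (use assms in \<open>auto simp: pt3_def\<close>)
  then show ?thesis by (simp add: pt3_def add.assoc)
qed

lemma poly_dvd_pderiv_imp_0:
  fixes q :: "complex poly"
  assumes "q dvd pderiv q" "poly q b = 0"
  shows "q = 0"
proof (rule ccontr)
  assume "q \<noteq> 0"
  have "pderiv q = 0"
  proof (rule ccontr)
    assume nz: "pderiv q \<noteq> 0"
    then have "degree q \<le> degree q - 1"
      using dvd_imp_degree_le[OF assms(1)] by (simp add: degree_pderiv)
    moreover have "degree q \<noteq> 0" using nz by (simp add: pderiv_eq_0_iff)
    ultimately show False by linarith
  qed
  then obtain c where "q = [:c:]" by (metis pderiv_eq_0_iff degree_eq_zeroE)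
  with assms(2) \<open>q \<noteq> 0\<close> show False by simp
qed

locale plane_curve =
  fixes f :: mpoly
  assumes f_vars: "mvars f \<subseteq> {0, 1}"
    and f_irred: "irreducible f"
    and not_line: "\<not> (\<exists>a b c. (a, b) \<noteq> (0, 0) \<and>
          {(y1, y2). meval f (pt2 y1 y2) = 0} = {(y1, y2). a * y1 + b * y2 + c = 0})"
    and not_dvd: "\<not> f dvd (mpderiv 0 f)^2 + (mpderiv 1 f)^2"
begin

abbreviation F0 :: "complex \<Rightarrow> complex \<Rightarrow> complex" where "F0 y1 y2 \<equiv> meval f (pt2 y1 y2)"
abbreviation F1 :: "complex \<Rightarrow> complex \<Rightarrow> complex" where "F1 y1 y2 \<equiv> meval (mpderiv 0 f) (pt2 y1 y2)"
abbreviation F2 :: "complex \<Rightarrow> complex \<Rightarrow> complex" where "F2 y1 y2 \<equiv> meval (mpderiv 1 f) (pt2 y1 y2)"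
abbreviation H :: "complex \<Rightarrow> complex \<Rightarrow> complex" where "H y1 y2 \<equiv> (F1 y1 y2)^2 + (F2 y1 y2)^2"
abbreviation nrm :: "complex \<Rightarrow> complex \<Rightarrow> complex \<Rightarrow> complex \<Rightarrow> complex" where
  "nrm y1 y2 x1 x2 \<equiv> - F2 y1 y2 * (x1 - y1) + F1 y1 y2 * (x2 - y2)"
abbreviation dist2 :: "complex \<Rightarrow> complex \<Rightarrow> complex \<Rightarrow> complex \<Rightarrow> complex" where
  "dist2 y1 y2 x1 x2 \<equiv> (x1 - y1)^2 + (x2 - y2)^2"

definition foot :: "complex \<Rightarrow> complex \<Rightarrow> (complex \<times> complex) set" where
  "foot x1 x2 = {(y1, y2). F0 y1 y2 = 0 \<and> nrm y1 y2 x1 x2 = 0 \<and> H y1 y2 \<noteq> 0}"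

lemma offset_proj_iff:
  "(x1, x2, d) \<in> offset_proj f \<longleftrightarrow> (\<exists>(y1, y2)\<in>foot x1 x2. dist2 y1 y2 x1 x2 = d^2)"
proof
  assume "(x1, x2, d) \<in> offset_proj f"
  then obtain y1 y2 u where y: "F0 y1 y2 = 0" "dist2 y1 y2 x1 x2 - d^2 = 0" "nrm y1 y2 x1 x2 = 0"
      "u * H y1 y2 - 1 = 0"
    unfolding offset_proj_def by blast
  then have "H y1 y2 \<noteq> 0" by auto
  with y(1,3) have "(y1, y2) \<in> foot x1 x2" unfolding foot_def by blast
  moreover have "dist2 y1 y2 x1 x2 = d^2" using y(2) by (simp only: right_minus_eq)
  ultimately show "\<exists>(y1, y2)\<in>foot x1 x2. dist2 y1 y2 x1 x2 = d^2" by blast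
next
  assume "\<exists>(y1, y2)\<in>foot x1 x2. dist2 y1 y2 x1 x2 = d^2"
  then obtain y1 y2 where y: "(y1, y2) \<in> foot x1 x2" "dist2 y1 y2 x1 x2 = d^2" by auto
  then have "F0 y1 y2 = 0" "nrm y1 y2 x1 x2 = 0" "1 / H y1 y2 * H y1 y2 - 1 = 0"
    unfolding foot_def by auto
  moreover have "dist2 y1 y2 x1 x2 - d^2 = 0" using y(2) by simp
  ultimately show "(x1, x2, d) \<in> offset_proj f"
    unfolding offset_proj_def by blast
qed

section \<open>A Nullstellensatz for the curve and finiteness of its exceptional points\<close>

lemma common_zeros_dvd:
  assumes "infinite {(a, b). F0 a b = 0 \<and> bi P a b = 0}"
  shows "to_bi coord2 f dvd P"
  using finite_common_zeros[OF irreducible_to_bi[OF f_vars f_irred], of P] assms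
  by (auto simp: bi_to_bi_coord2)

lemma common_zeros_factor:
  assumes "infinite {(a, b). F0 a b = 0 \<and> bi P a b = 0}"
  shows "\<exists>k. \<forall>a b. bi P a b = F0 a b * bi k a b"
proof -
  obtain k where "P = to_bi coord2 f * k" using common_zeros_dvd[OF assms] by (elim dvdE)
  then have "bi P a b = F0 a b * bi k a b" for a b by (simp add: bi_to_bi_coord2)
  then show ?thesis by blast
qed

text \<open>If \<open>f\<close> is free of the outer variable, the curve contains a vertical line;
  otherwise every \<open>a\<close> that is no root of the leading coefficient has a curve point
  above it.\<close>

lemma infinite_curve: "infinite {(a, b). F0 a b = 0}"
proof (cases "degree (to_bi coord2 f) = 0")
  case True
  then obtain k where k: "to_bi coord2 f = [:k:]" by (rule degree_eq_zeroE)
  have "irreducible [:k:]" using irreducible_to_bi[OF f_vars f_irred] by (simp only: k)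
  then have "degree k \<noteq> 0"
    by (auto simp: irreducible_def is_unit_const_poly_iff is_unit_iff_degree)
  then have "\<not> constant (poly k)" by (simp add: constant_degree)
  then obtain a where a: "poly k a = 0" using fundamental_theorem_of_algebra by blast
  have "F0 a b = 0" for b
    using bi_to_bi_coord2[of f a b] a by (simp add: k)
  then have "range (\<lambda>b. (a, b)) \<subseteq> {(a, b). F0 a b = 0}" by auto
  moreover have "infinite (range (\<lambda>b::complex. (a, b)))"
    by (subst finite_image_iff) (auto intro: inj_onI simp: infinite_UNIV_complex)
  ultimately show ?thesis using finite_subset by blast
next
  case False
  let ?P = "to_bi coord2 f"
  have "lead_coeff ?P \<noteq> 0" using False by auto
  from poly_roots_finite[OF this] have "infinite {a. poly (lead_coeff ?P) a \<noteq> 0}"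
    by (intro infinite_if_eventually_cofinite) (simp add: eventually_cofinite)
  moreover have "{a. poly (lead_coeff ?P) a \<noteq> 0} \<subseteq> fst ` {(a, b). F0 a b = 0}"
  proof
    fix a assume "a \<in> {a. poly (lead_coeff ?P) a \<noteq> 0}"
    then have "coeff (inner_at a ?P) (degree ?P) \<noteq> 0" by (simp add: coeff_map_poly)
    then have "degree (inner_at a ?P) \<noteq> 0" using False le_degree by fastforce
    then have "\<not> constant (poly (inner_at a ?P))" by (simp add: constant_degree)
    then obtain b where "poly (inner_at a ?P) b = 0" using fundamental_theorem_of_algebra by blast
    then have "F0 a b = 0" by (simp add: bi_to_bi_coord2)
    then show "a \<in> fst ` {(a, b). F0 a b = 0}" by force
  qed
  ultimately show ?thesis using finite_surj by blast
qed

text \<open>With infinitely many common points, \<open>f\<close> divides the linear form, so the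
  curve lies on the line; and \<open>f\<close> restricted to the line has infinitely many zeros, so
  the line lies on the curve. Equality contradicts \<open>not_line\<close>.\<close>

lemma finite_curve_inter_line:
  assumes "(a, b) \<noteq> (0, 0)"
  shows "finite {(y1, y2). F0 y1 y2 = 0 \<and> a * y1 + b * y2 + c = 0}"
proof (rule ccontr)
  assume inf: "infinite {(y1, y2). F0 y1 y2 = 0 \<and> a * y1 + b * y2 + c = 0}"
  let ?L = "[:[:c, a:], [:b:]:]"
  have L: "bi ?L y1 y2 = a * y1 + b * y2 + c" for y1 y2 by (simp add: algebra_simps)
  obtain k where k: "bi ?L y1 y2 = F0 y1 y2 * bi k y1 y2" for y1 y2
    using common_zeros_factor[of ?L] inf unfolding L by blast
  obtain u v where uv: "a * u + b * v + c = 0" using inf not_finite_existsD by blast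
  obtain q where q: "F0 (u + b * z) (v + - a * z) = poly q z" for z
    using meval_pt2_line[of f u b v "- a"] by blast
  have param: "\<exists>z. y1 = u + b * z \<and> y2 = v + - a * z" if "a * y1 + b * y2 + c = 0" for y1 y2
  proof (cases "b = 0")
    case False
    have "a * y1 + b * y2 + c = a * u + b * v + c" using that uv by (simp only:)
    then have "a * (y1 - u) + b * (y2 - v) = 0" by (simp add: algebra_simps)
    then have "y2 = v + - a * ((y1 - u) / b)" using False by (simp add: field_simps)
    then show ?thesis using False by (intro exI[of _ "(y1 - u) / b"]) simp
  next
    case True
    with assms have "a \<noteq> 0" by simp
    have "a * y1 + b * y2 + c = a * u + b * v + c" using that uv by (simp only:)
    then have "a * (y1 - u) = 0" using True by (simp add: algebra_simps)
    then show ?thesis using \<open>a \<noteq> 0\<close> True by (intro exI[of _ "(v - y2) / a"]) simp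
  qed
  have "q = 0"
  proof (rule ccontr)
    assume "q \<noteq> 0"
    have "{(y1, y2). F0 y1 y2 = 0 \<and> a * y1 + b * y2 + c = 0} \<subseteq>
        (\<lambda>z. (u + b * z, v + - a * z)) ` {z. poly q z = 0}"
      using param q by (auto simp: image_iff) metis
    with inf show False using poly_roots_finite[OF \<open>q \<noteq> 0\<close>] finite_surj by blast
  qed
  have "{(y1, y2). F0 y1 y2 = 0} = {(y1, y2). a * y1 + b * y2 + c = 0}"
  proof (intro equalityI subsetI; clarify)
    fix y1 y2 assume "F0 y1 y2 = 0"
    then show "a * y1 + b * y2 + c = 0" using k[of y1 y2] L[of y1 y2] by simp
  next
    fix y1 y2 assume "a * y1 + b * y2 + c = 0"
    then obtain z where "y1 = u + b * z" "y2 = v + - a * z" using param by blast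
    then show "F0 y1 y2 = 0" using q[of z] \<open>q = 0\<close> by simp
  qed
  with not_line assms show False by blast
qed

text \<open>Otherwise \<open>f\<close> divides its derivative in \<open>y2\<close>. On the vertical
  line through a curve point, \<open>f\<close> becomes a polynomial that has a root and divides its
  derivative, hence zero, and the curve contains that line.\<close>

lemma finite_F2_zeros: "finite {(y1, y2). F0 y1 y2 = 0 \<and> F2 y1 y2 = 0}"
proof (rule ccontr)
  assume "infinite {(y1, y2). F0 y1 y2 = 0 \<and> F2 y1 y2 = 0}"
  then obtain k where k: "F2 y1 y2 = F0 y1 y2 * bi k y1 y2" for y1 y2
    using common_zeros_factor[of "to_bi coord2 (mpderiv 1 f)"] by (auto simp: bi_to_bi_coord2)
  obtain a b where ab: "F0 a b = 0" using infinite_curve not_finite_existsD by blast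
  obtain q where q: "F0 a z = poly q z" for z
    using meval_pt2_line[of f a 0 0 1] by auto
  have "poly (pderiv q) z = poly (q * inner_at a k) z" for z
  proof -
    have "((\<lambda>z. F0 a z) has_field_derivative F2 a z) (at z)"
      using DERIV_meval_pt2[OF DERIV_const[of a] DERIV_ident, of f z] by simp
    then have "(poly q has_field_derivative F2 a z) (at z)"
      by (simp only: q)
    from DERIV_unique[OF this poly_DERIV] show ?thesis by (simp add: k q)
  qed
  then have "pderiv q = q * inner_at a k" by (intro poly_eqI_degree poly_eq_poly_eq_iff[THEN iffD1] ext)
  then have "q = 0"
    using ab q[of b] by (intro poly_dvd_pderiv_imp_0[of q b]) auto
  then have "range (\<lambda>b. (a, b)) \<subseteq> {(y1, y2). F0 y1 y2 = 0 \<and> 1 * y1 + 0 * y2 + (- a) = 0}"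
    using q by auto
  moreover have "infinite (range (\<lambda>b::complex. (a, b)))"
    by (subst finite_image_iff) (auto intro: inj_onI simp: infinite_UNIV_complex)
  ultimately show False
    using finite_curve_inter_line[of 1 0 "- a"] finite_subset by auto
qed

lemma finite_H_zeros: "finite {(y1, y2). F0 y1 y2 = 0 \<and> H y1 y2 = 0}"
proof (rule ccontr)
  assume inf: "infinite {(y1, y2). F0 y1 y2 = 0 \<and> H y1 y2 = 0}"
  let ?h = "(mpderiv 0 f)^2 + (mpderiv 1 f)^2"
  have "to_bi coord2 f dvd to_bi coord2 ?h"
    by (rule common_zeros_dvd)
       (use inf in \<open>simp add: bi_to_bi_coord2 to_bi.hom_add to_bi.hom_power meval.hom_add meval.hom_power\<close>)
  moreover have "mvars ?h \<subseteq> {0, 1}"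
    using mvars_add[of "(mpderiv 0 f)^2" "(mpderiv 1 f)^2"] mvars_power[of "mpderiv 0 f" 2]
      mvars_power[of "mpderiv 1 f" 2] mvars_mpderiv[of 0 f] mvars_mpderiv[of 1 f] f_vars by blast
  ultimately show False using to_bi_dvdD[OF f_vars] not_dvd by blast
qed

text \<open>These are the singular points and the points whose tangent passes through the origin. If
  there were infinitely many, \<open>f\<close> along the line from the origin through a curve point
  would be some \<open>q\<close> with \<open>z q' = q \<kappa>\<close>. Comparing orders at
  \<open>z = 1\<close> gives \<open>q = 0\<close>, so the curve would contain a line.\<close>

lemma finite_Euler_zeros: "finite {(y1, y2). F0 y1 y2 = 0 \<and> y1 * F1 y1 y2 + y2 * F2 y1 y2 = 0}"
proof (rule ccontr)
  let ?P = "[:[:0, 1:]:] * to_bi coord2 (mpderiv 0 f) + [:0, 1:] * to_bi coord2 (mpderiv 1 f)"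
  assume "infinite {(y1, y2). F0 y1 y2 = 0 \<and> y1 * F1 y1 y2 + y2 * F2 y1 y2 = 0}"
  then obtain k where k: "y1 * F1 y1 y2 + y2 * F2 y1 y2 = F0 y1 y2 * bi k y1 y2" for y1 y2
    using common_zeros_factor[of ?P] by (auto simp: bi_to_bi_coord2)
  have "infinite ({(a, b). F0 a b = 0} - {(0, 0)})" using infinite_curve by simp
  then have "{(a, b). F0 a b = 0} - {(0, 0)} \<noteq> {}" by (metis finite.emptyI)
  then obtain a b where ab: "F0 a b = 0" "(a, b) \<noteq> (0, 0)" by auto
  obtain q where q: "F0 (a * z) (b * z) = poly q z" for z
    using meval_pt2_line[of f 0 a 0 b] by auto
  obtain \<kappa> where \<kappa>: "bi k (a * z) (b * z) = poly \<kappa> z" for z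
  proof -
    have "bi k (a * z) (b * z) = meval (of_bi k) (pt2 (0 + a * z) (0 + b * z))" for z
      using bi_to_bi_coord2[of "of_bi k" "a * z" "b * z"] by (simp add: to_bi_of_bi)
    then show ?thesis using that meval_pt2_line[of "of_bi k" 0 a 0 b] by metis
  qed
  have "poly ([:0, 1:] * pderiv q) z = poly (q * \<kappa>) z" for z
  proof -
    have "((\<lambda>z. F0 (a * z) (b * z)) has_field_derivative F1 (a * z) (b * z) * a + F2 (a * z) (b * z) * b) (at z)"
      by (rule DERIV_meval_pt2) (auto intro!: derivative_eq_intros)
    then have "(poly q has_field_derivative F1 (a * z) (b * z) * a + F2 (a * z) (b * z) * b) (at z)"
      by (simp only: q)
    from DERIV_unique[OF this poly_DERIV]
    have "poly (pderiv q) z = F1 (a * z) (b * z) * a + F2 (a * z) (b * z) * b" by (rule sym)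
    then have "z * poly (pderiv q) z = (a * z) * F1 (a * z) (b * z) + (b * z) * F2 (a * z) (b * z)"
      by (simp add: algebra_simps)
    also have "\<dots> = poly q z * poly \<kappa> z" by (simp only: k q \<kappa>)
    finally show ?thesis by simp
  qed
  then have eq: "[:0, 1:] * pderiv q = q * \<kappa>" by (intro poly_eq_poly_eq_iff[THEN iffD1] ext)
  have q1: "poly q 1 = 0" using q[of 1] ab by simp
  have "q = 0"
  proof (rule ccontr)
    assume "q \<noteq> 0"
    then have "order 1 q = Suc (order 1 (pderiv q))" using q1 by (rule order_pderiv)
    have "pderiv q \<noteq> 0"
    proof
      assume "pderiv q = 0"
      then have "q dvd pderiv q" by (simp only: dvd_0_right)
      from poly_dvd_pderiv_imp_0[OF this q1] \<open>q \<noteq> 0\<close> show False by contradiction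
    qed
    then have nz: "[:0, 1:] * pderiv q \<noteq> 0" by simp
    then have "order 1 ([:0, 1:] * pderiv q) = order 1 [:0, 1::complex:] + order 1 (pderiv q)" by (rule order_mult)
    also have "order 1 [:0, 1::complex:] = (0::nat)" by (rule order_0I) simp
    finally have "order 1 (q * \<kappa>) = order 1 (pderiv q)" by (simp only: eq)
    moreover have "order 1 (q * \<kappa>) = order 1 q + order 1 \<kappa>"
      by (rule order_mult) (use nz in \<open>simp only: eq not_False_eq_True\<close>)
    ultimately show False using \<open>order 1 q = _\<close> by simp
  qed
  then have "range (\<lambda>z. (a * z, b * z)) \<subseteq> {(y1, y2). F0 y1 y2 = 0 \<and> b * y1 + (- a) * y2 + 0 = 0}"
    using q by auto
  moreover have "infinite (range (\<lambda>z. (a * z, b * z)))"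
    using ab(2) by (subst finite_image_iff) (auto intro!: inj_onI simp: infinite_UNIV_complex)
  ultimately show False
    using finite_curve_inter_line[of b "- a" 0] ab(2) finite_subset by auto
qed

end

subsection \<open>Feet of normals and their distances\<close>

context plane_curve
begin

text \<open>The determinant of the gradient and its derivative along the tangent
  \<open>(F2, - F1)\<close>; up to sign, the numerator of the curvature of the curve.\<close>

definition curv :: mpoly where
  "curv = mpderiv 0 f * (mpderiv 0 (mpderiv 1 f) * mpderiv 1 f - mpderiv 1 (mpderiv 1 f) * mpderiv 0 f)
    - mpderiv 1 f * (mpderiv 0 (mpderiv 0 f) * mpderiv 1 f - mpderiv 1 (mpderiv 0 f) * mpderiv 0 f)"

abbreviation K :: "complex \<Rightarrow> complex \<Rightarrow> complex" where "K y1 y2 \<equiv> meval curv (pt2 y1 y2)"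

text \<open>The point \<open>y + l \<nabla>f(y)\<close> is the centre of curvature at \<open>y\<close> iff \<open>l K(y) = H(y)\<close>; with
  second coordinate \<open>b\<close> this is \<open>(b - y\<^sub>2) K(y) = H(y) f\<^sub>2(y)\<close>.\<close>
lemma eventually_finite_evolute:
  "\<forall>\<^sub>F b in cofinite. finite {(y1, y2). F0 y1 y2 = 0 \<and> (b - y2) * K y1 y2 = H y1 y2 * F2 y1 y2}"
proof -
  let ?E = "\<lambda>b. {(y1, y2). F0 y1 y2 = 0 \<and> (b - y2) * K y1 y2 = H y1 y2 * F2 y1 y2}"
  have factor: "\<exists>k. \<forall>y1 y2. (b - y2) * K y1 y2 - H y1 y2 * F2 y1 y2 = F0 y1 y2 * bi k y1 y2"
    if "infinite (?E b)" for b
  proof -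
    let ?P = "[:[:b:], - 1:] * to_bi coord2 curv -
      ((to_bi coord2 (mpderiv 0 f))^2 + (to_bi coord2 (mpderiv 1 f))^2) * to_bi coord2 (mpderiv 1 f)"
    have P: "bi ?P y1 y2 = (b - y2) * K y1 y2 - H y1 y2 * F2 y1 y2" for y1 y2
      by (simp add: bi_to_bi_coord2 algebra_simps)
    show ?thesis
      using common_zeros_factor[of ?P] that unfolding P by simp
  qed
  \<comment> \<open>Subtracting the equations for two heights gives \<open>K = 0\<close> on the
    curve, and then \<open>H = 0\<close> or \<open>F2 = 0\<close> at each of its infinitely many
    points.\<close>
  have "b = b'" if inf: "infinite (?E b)" "infinite (?E b')" for b b'
  proof (rule ccontr)
    assume "b \<noteq> b'"
    obtain k where k: "(b - y2) * K y1 y2 - H y1 y2 * F2 y1 y2 = F0 y1 y2 * bi k y1 y2" for y1 y2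
      using factor[OF inf(1)] by blast
    obtain k' where k': "(b' - y2) * K y1 y2 - H y1 y2 * F2 y1 y2 = F0 y1 y2 * bi k' y1 y2" for y1 y2
      using factor[OF inf(2)] by blast
    have "H y1 y2 = 0 \<or> F2 y1 y2 = 0" if "F0 y1 y2 = 0" for y1 y2
    proof -
      have 1: "(b - y2) * K y1 y2 - H y1 y2 * F2 y1 y2 = 0" "(b' - y2) * K y1 y2 - H y1 y2 * F2 y1 y2 = 0"
        by (simp_all only: k k' that mult_zero_left)
      then have "(b - b') * K y1 y2 = 0" by (simp add: algebra_simps)
      with \<open>b \<noteq> b'\<close> have "K y1 y2 = 0" by simp
      with 1 show ?thesis by simp
    qed
    then have "{(y1, y2). F0 y1 y2 = 0} \<subseteq>
        {(y1, y2). F0 y1 y2 = 0 \<and> H y1 y2 = 0} \<union> {(y1, y2). F0 y1 y2 = 0 \<and> F2 y1 y2 = 0}"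
      by blast
    moreover have "finite ({(y1, y2). F0 y1 y2 = 0 \<and> H y1 y2 = 0} \<union> {(y1, y2). F0 y1 y2 = 0 \<and> F2 y1 y2 = 0})"
      using finite_H_zeros finite_F2_zeros by (rule finite_UnI)
    ultimately show False using infinite_curve finite_subset by blast
  qed
  note unique = this
  have "finite {b. infinite (?E b)}"
  proof (cases "\<exists>b. infinite (?E b)")
    case True
    then obtain b where "infinite (?E b)" by blast
    then have "{b. infinite (?E b)} \<subseteq> {b}" using unique by blast
    then show ?thesis by (rule finite_subset) (rule finite.insertI[OF finite.emptyI])
  next
    case False
    then have "{b. infinite (?E b)} = {}" by blast
    then show ?thesis by (simp only: finite.emptyI)
  qed
  then show ?thesis by (simp only: eventually_cofinite)
qed

lemma eventually_not_snd_F2_zero: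
  "\<forall>\<^sub>F b in cofinite. \<forall>y1. F0 y1 b = 0 \<longrightarrow> F2 y1 b \<noteq> 0"
proof -
  have "finite (snd ` {(y1, y2). F0 y1 y2 = 0 \<and> F2 y1 y2 = 0})"
    by (rule finite_imageI[OF finite_F2_zeros])
  moreover have "{b. \<not> (\<forall>y1. F0 y1 b = 0 \<longrightarrow> F2 y1 b \<noteq> 0)} \<subseteq> snd ` {(y1, y2). F0 y1 y2 = 0 \<and> F2 y1 y2 = 0}"
    by force
  ultimately show ?thesis unfolding eventually_cofinite by (rule finite_subset[rotated])
qed

text \<open>On the line of height \<open>b\<close> the normal at \<open>(y1, y2)\<close> is given by
  a linear polynomial in \<open>s\<close>. It is non-zero: where its coefficient \<open>F2\<close>
  vanishes, \<open>F1\<close> does not, and the condition on \<open>b\<close> ensures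
  \<open>b \<noteq> y2\<close>.\<close>

lemma eventually_off_normals:
  assumes "finite Y" "\<And>y1 y2. (y1, y2) \<in> Y \<Longrightarrow> F0 y1 y2 = 0 \<and> H y1 y2 \<noteq> 0"
    and b: "\<forall>y1. F0 y1 b = 0 \<longrightarrow> F2 y1 b \<noteq> 0"
  shows "\<forall>\<^sub>F s in cofinite. \<forall>(y1, y2)\<in>Y. nrm y1 y2 s b \<noteq> 0"
proof (rule eventually_ball_finite[OF assms(1)], clarify)
  fix y1 y2 assume y: "(y1, y2) \<in> Y"
  show "\<forall>\<^sub>F s in cofinite. nrm y1 y2 s b \<noteq> 0"
  proof (cases "F2 y1 y2 = 0")
    case True
    then have "F1 y1 y2 \<noteq> 0" "b \<noteq> y2" using assms(2)[OF y] b by auto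
    then show ?thesis using True by simp
  next
    case False
    have "{s. \<not> nrm y1 y2 s b \<noteq> 0} \<subseteq> {y1 + F1 y1 y2 * (b - y2) / F2 y1 y2}"
      using False by (auto simp: field_simps)
    then show ?thesis unfolding eventually_cofinite by (rule finite_subset) simp
  qed
qed

lemma foot_param:
  assumes "(y1, y2) \<in> foot x1 x2"
  obtains r where "x1 = y1 + r * F1 y1 y2" "x2 = y2 + r * F2 y1 y2" "dist2 y1 y2 x1 x2 = r^2 * H y1 y2"
proof -
  \<comment> \<open>Since \<open>x - y\<close> is parallel to the gradient, \<open>r\<close> is its
    component along the gradient for the complex bilinear form, whose value \<open>H\<close> on the
    gradient is non-zero.\<close>
  define r where "r = (F1 y1 y2 * (x1 - y1) + F2 y1 y2 * (x2 - y2)) / H y1 y2"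
  have H: "H y1 y2 \<noteq> 0" and n: "F1 y1 y2 * (x2 - y2) = F2 y1 y2 * (x1 - y1)"
    using assms by (auto simp: foot_def)
  have rH: "r * H y1 y2 = F1 y1 y2 * (x1 - y1) + F2 y1 y2 * (x2 - y2)"
    using H by (simp add: r_def)
  have "r * F1 y1 y2 * H y1 y2 = (r * H y1 y2) * F1 y1 y2" by (simp only: mult_ac)
  also have "\<dots> = F1 y1 y2 * F1 y1 y2 * (x1 - y1) + F2 y1 y2 * (F1 y1 y2 * (x2 - y2))"
    unfolding rH by (simp add: algebra_simps)
  also have "\<dots> = (x1 - y1) * H y1 y2" unfolding n by (simp add: algebra_simps power2_eq_square)
  finally have 1: "x1 = y1 + r * F1 y1 y2" using H by simp
  have "r * F2 y1 y2 * H y1 y2 = (r * H y1 y2) * F2 y1 y2" by (simp only: mult_ac)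
  also have "\<dots> = F1 y1 y2 * (F2 y1 y2 * (x1 - y1)) + F2 y1 y2 * F2 y1 y2 * (x2 - y2)"
    unfolding rH by (simp add: algebra_simps)
  also have "\<dots> = (x2 - y2) * H y1 y2" unfolding n[symmetric] by (simp add: algebra_simps power2_eq_square)
  finally have 2: "x2 = y2 + r * F2 y1 y2" using H by simp
  have "dist2 y1 y2 x1 x2 = (r * F1 y1 y2)^2 + (r * F2 y1 y2)^2"
    using 1 2 by (metis add_diff_cancel_left')
  then have 3: "dist2 y1 y2 x1 x2 = r^2 * H y1 y2" by (simp only: power_mult_distrib distrib_left)
  from 1 2 3 show ?thesis by (rule that)
qed

lemma foot_intro:
  assumes "F0 y1 y2 = 0" "H y1 y2 \<noteq> 0"
  shows "(y1, y2) \<in> foot (y1 + r * F1 y1 y2) (y2 + r * F2 y1 y2)"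
  using assms by (simp add: foot_def algebra_simps)

text \<open>The feet for which \<open>(s, b)\<close> is the centre of curvature lie in a finite set
  fixed by \<open>b\<close>, and a generic \<open>s\<close> avoids the normals there. Distance 0
  would mean that \<open>(s, b)\<close> is its own foot and lies on the curve.\<close>

lemma eventually_foot_regular:
  "\<forall>\<^sub>F b in cofinite. \<forall>\<^sub>F s in cofinite. \<forall>(y1, y2)\<in>foot s b.
     (b - y2) * K y1 y2 \<noteq> H y1 y2 * F2 y1 y2 \<and> F2 y1 y2 \<noteq> 0 \<and> dist2 y1 y2 s b \<noteq> 0"
proof -
  have "to_bi coord2 f \<noteq> 0" using irreducible_to_bi[OF f_vars f_irred] by auto
  from eventually_cofinite_bi_neq_0[OF this]
  have "\<forall>\<^sub>F b in cofinite. \<forall>\<^sub>F s in cofinite. F0 s b \<noteq> 0" by (simp add: bi_to_bi_coord2)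
  with eventually_finite_evolute eventually_not_snd_F2_zero show ?thesis
  proof eventually_elim
    case (elim b)
    let ?Y = "{(y1, y2). F0 y1 y2 = 0 \<and> (b - y2) * K y1 y2 = H y1 y2 * F2 y1 y2} \<inter> {(y1, y2). H y1 y2 \<noteq> 0}"
    have "\<forall>\<^sub>F s in cofinite. \<forall>(y1, y2)\<in>?Y. nrm y1 y2 s b \<noteq> 0"
      by (rule eventually_off_normals) (use elim(1,2) in auto)
    with elim(3) show ?case
    proof eventually_elim
      case (elim s)
      show ?case
      proof clarify
        fix y1 y2 assume y: "(y1, y2) \<in> foot s b"
        then have y': "F0 y1 y2 = 0" "nrm y1 y2 s b = 0" "H y1 y2 \<noteq> 0" unfolding foot_def by blast+
        have "(y1, y2) \<notin> ?Y" using elim(2) y'(2) by blast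
        then have "(b - y2) * K y1 y2 \<noteq> H y1 y2 * F2 y1 y2" using y' by blast
        moreover have "F2 y1 y2 \<noteq> 0"
        proof
          assume F2: "F2 y1 y2 = 0"
          then have "F1 y1 y2 \<noteq> 0" using y'(3) by auto
          then have "b = y2" using y'(2) F2 by simp
          with \<open>F2 y1 y2 = 0\<close> y'(1) \<open>\<forall>y1. F0 y1 b = 0 \<longrightarrow> F2 y1 b \<noteq> 0\<close> show False by blast
        qed
        moreover have "dist2 y1 y2 s b \<noteq> 0"
        proof -
          from y obtain r where r: "s = y1 + r * F1 y1 y2" "b = y2 + r * F2 y1 y2" "dist2 y1 y2 s b = r^2 * H y1 y2"
            by (rule foot_param)
          have "r \<noteq> 0"
          proof
            assume "r = 0"
            with r have "s = y1" "b = y2" by auto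
            with elim(1) y'(1) show False by blast
          qed
          with r(3) y'(3) show ?thesis by simp
        qed
        ultimately show "(b - y2) * K y1 y2 \<noteq> H y1 y2 * F2 y1 y2 \<and> F2 y1 y2 \<noteq> 0 \<and> dist2 y1 y2 s b \<noteq> 0"
          by blast
      qed
    qed
  qed
qed

text \<open>The eikonal argument: on the offset, the gradient of the squared distance is \<open>2 (x - y)\<close>, so
  that away from the evolute \<open>y\<close> is determined by any equation satisfied by \<open>(x, d\<^sup>2)\<close>. The
  gradient is computed along \<open>\<nabla>f(y)\<close> and along the tangent direction \<open>(f\<^sub>2, - f\<^sub>1)\<close>.\<close>
lemma offset_gradient:
  assumes van: "\<And>y1 y2 r. F0 y1 y2 = 0 \<Longrightarrow> H y1 y2 \<noteq> 0 \<Longrightarrow> r \<noteq> 0 \<Longrightarrow>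
      meval G (pt3 (y1 + r * F1 y1 y2) (y2 + r * F2 y1 y2) (r^2 * H y1 y2)) = 0"
    and y: "F0 y1 y2 = 0" "H y1 y2 \<noteq> 0" "r \<noteq> 0" "r * K y1 y2 \<noteq> H y1 y2"
    and x: "x1 = y1 + r * F1 y1 y2" "x2 = y2 + r * F2 y1 y2" "\<delta> = r^2 * H y1 y2"
  shows "meval (mpderiv 0 G) (pt3 x1 x2 \<delta>) + 2 * meval (mpderiv 2 G) (pt3 x1 x2 \<delta>) * (x1 - y1) = 0"
    and "meval (mpderiv 1 G) (pt3 x1 x2 \<delta>) + 2 * meval (mpderiv 2 G) (pt3 x1 x2 \<delta>) * (x2 - y2) = 0"
proof -
  let ?G0 = "meval (mpderiv 0 G) (pt3 x1 x2 \<delta>)" and ?G1 = "meval (mpderiv 1 G) (pt3 x1 x2 \<delta>)"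
    and ?G2 = "meval (mpderiv 2 G) (pt3 x1 x2 \<delta>)"
  define p where "p = F1 y1 y2"
  define q where "q = F2 y1 y2"
  have normal: "?G0 * p + ?G1 * q + ?G2 * (2 * r * (p^2 + q^2)) = 0"
  proof -
    have "((\<lambda>z. meval G (pt3 (y1 + z * p) (y2 + z * q) (z^2 * (p^2 + q^2)))) has_field_derivative
      meval (mpderiv 0 G) (pt3 (y1 + r * p) (y2 + r * q) (r^2 * (p^2 + q^2))) * p +
      meval (mpderiv 1 G) (pt3 (y1 + r * p) (y2 + r * q) (r^2 * (p^2 + q^2))) * q +
      meval (mpderiv 2 G) (pt3 (y1 + r * p) (y2 + r * q) (r^2 * (p^2 + q^2))) * (2 * r * (p^2 + q^2))) (at r)"
      by (rule DERIV_meval_pt3) (auto intro!: derivative_eq_intros)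
    then have D: "((\<lambda>z. meval G (pt3 (y1 + z * p) (y2 + z * q) (z^2 * (p^2 + q^2)))) has_field_derivative
      ?G0 * p + ?G1 * q + ?G2 * (2 * r * (p^2 + q^2))) (at r)"
      by (simp only: x p_def q_def)
    have "((\<lambda>z. 0) has_field_derivative ?G0 * p + ?G1 * q + ?G2 * (2 * r * (p^2 + q^2))) (at r)"
      by (rule has_field_derivative_transform_within_open[OF D, of "- {0}"])
         (use van[OF y(1,2)] y(3) in \<open>auto simp: p_def q_def\<close>)
    from DERIV_unique[OF this DERIV_const] show ?thesis .
  qed
  \<comment> \<open>The point at parameter \<open>r\<close> on the normal, with its squared
    distance, as polynomials in the foot. The composite with \<open>G\<close> vanishes at all but
    finitely many points of the curve, so \<open>f\<close> divides it.\<close>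
  define \<sigma> :: "nat \<Rightarrow> complex poly poly" where "\<sigma> = (\<lambda>i.
    if i = 0 then coord2 0 + [:[:r:]:] * to_bi coord2 (mpderiv 0 f)
    else if i = 1 then coord2 1 + [:[:r:]:] * to_bi coord2 (mpderiv 1 f)
    else if i = 2 then [:[:r^2:]:] * ((to_bi coord2 (mpderiv 0 f))^2 + (to_bi coord2 (mpderiv 1 f))^2) else 0)"
  have \<sigma>: "bi (to_bi \<sigma> G) a b = meval G (pt3 (a + r * F1 a b) (b + r * F2 a b) (r^2 * H a b))" for a b
  proof -
    have "(\<lambda>i. bi (\<sigma> i) a b) = pt3 (a + r * F1 a b) (b + r * F2 a b) (r^2 * H a b)"
      by (rule ext) (simp add: \<sigma>_def pt3_def bi_to_bi_coord2)
    then show ?thesis by (simp only: bi_to_bi)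
  qed
  have "infinite ({(a, b). F0 a b = 0} - {(a, b). F0 a b = 0 \<and> H a b = 0})"
    using infinite_curve finite_H_zeros by (rule Diff_infinite_finite[rotated])
  moreover have "{(a, b). F0 a b = 0} - {(a, b). F0 a b = 0 \<and> H a b = 0} \<subseteq>
      {(a, b). F0 a b = 0 \<and> bi (to_bi \<sigma> G) a b = 0}"
    using van y(3) by (auto simp: \<sigma>)
  ultimately have "infinite {(a, b). F0 a b = 0 \<and> bi (to_bi \<sigma> G) a b = 0}"
    using finite_subset by blast
  then obtain k where k: "meval G (pt3 (a + r * F1 a b) (b + r * F2 a b) (r^2 * H a b)) = F0 a b * bi k a b" for a b
    using common_zeros_factor[of "to_bi \<sigma> G"] unfolding \<sigma> by blast
  \<comment> \<open>The straight tangent line leaves the curve. Divisibility by \<open>f\<close>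
    replaces a parametrization: at a zero of \<open>f\<close>, a product of \<open>f\<close> and
    \<open>k\<close> has derivative 0 in a tangent direction.\<close>
  let ?u = "\<lambda>z. y1 + z * q" and ?v = "\<lambda>z. y2 - z * p"
  have du: "(?u has_field_derivative q) (at 0)" and dv: "(?v has_field_derivative - p) (at 0)"
    by (auto intro!: derivative_eq_intros)
  define D1 where "D1 = meval (mpderiv 0 (mpderiv 0 f)) (pt2 y1 y2) * q - meval (mpderiv 1 (mpderiv 0 f)) (pt2 y1 y2) * p"
  define D2 where "D2 = meval (mpderiv 0 (mpderiv 1 f)) (pt2 y1 y2) * q - meval (mpderiv 1 (mpderiv 1 f)) (pt2 y1 y2) * p"
  have dF1: "((\<lambda>z. F1 (?u z) (?v z)) has_field_derivative D1) (at 0)"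
    using DERIV_meval_pt2[OF du dv, of "mpderiv 0 f"] by (simp add: D1_def)
  have dF2: "((\<lambda>z. F2 (?u z) (?v z)) has_field_derivative D2) (at 0)"
    using DERIV_meval_pt2[OF du dv, of "mpderiv 1 f"] by (simp add: D2_def)
  have dF0: "((\<lambda>z. F0 (?u z) (?v z)) has_field_derivative 0) (at 0)"
    using DERIV_meval_pt2[OF du dv, of f] by (simp add: p_def q_def mult.commute)
  obtain k' where dk: "((\<lambda>z. bi k (?u z) (?v z)) has_field_derivative k') (at 0)"
  proof -
    have "((\<lambda>z. meval (of_bi k) (pt2 (?u z) (?v z))) has_field_derivative
      meval (mpderiv 0 (of_bi k)) (pt2 (?u 0) (?v 0)) * q + meval (mpderiv 1 (of_bi k)) (pt2 (?u 0) (?v 0)) * (- p)) (at 0)"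
      by (rule DERIV_meval_pt2[OF du dv])
    moreover have "meval (of_bi k) (pt2 a b) = bi k a b" for a b
      using bi_to_bi_coord2[of "of_bi k" a b] by (simp add: to_bi_of_bi)
    ultimately show ?thesis using that by simp
  qed
  have tangent: "?G0 * (q + r * D1) + ?G1 * (- p + r * D2) + ?G2 * (r^2 * (2 * p * D1 + 2 * q * D2)) = 0"
  proof -
    let ?X = "\<lambda>z. ?u z + r * F1 (?u z) (?v z)" and ?Y = "\<lambda>z. ?v z + r * F2 (?u z) (?v z)"
      and ?Z = "\<lambda>z. r^2 * H (?u z) (?v z)"
    have "(?X has_field_derivative q + r * D1) (at 0)"
      using DERIV_add[OF du DERIV_cmult[OF dF1]] .
    moreover have "(?Y has_field_derivative - p + r * D2) (at 0)"
      using DERIV_add[OF dv DERIV_cmult[OF dF2]] .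
    moreover have "(?Z has_field_derivative r^2 * (2 * p * D1 + 2 * q * D2)) (at 0)"
      using DERIV_cmult[OF DERIV_add[OF DERIV_power[OF dF1, of 2] DERIV_power[OF dF2, of 2]], of "r^2"]
      by (simp add: p_def q_def algebra_simps)
    ultimately have "((\<lambda>z. meval G (pt3 (?X z) (?Y z) (?Z z))) has_field_derivative
        meval (mpderiv 0 G) (pt3 (?X 0) (?Y 0) (?Z 0)) * (q + r * D1) +
        meval (mpderiv 1 G) (pt3 (?X 0) (?Y 0) (?Z 0)) * (- p + r * D2) +
        meval (mpderiv 2 G) (pt3 (?X 0) (?Y 0) (?Z 0)) * (r^2 * (2 * p * D1 + 2 * q * D2))) (at 0)"
      by (rule DERIV_meval_pt3)
    moreover have "pt3 (?X 0) (?Y 0) (?Z 0) = pt3 x1 x2 \<delta>" by (simp add: x)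
    ultimately have "((\<lambda>z. F0 (?u z) (?v z) * bi k (?u z) (?v z)) has_field_derivative
        ?G0 * (q + r * D1) + ?G1 * (- p + r * D2) + ?G2 * (r^2 * (2 * p * D1 + 2 * q * D2))) (at 0)"
      by (simp only: k)
    moreover have "((\<lambda>z. F0 (?u z) (?v z) * bi k (?u z) (?v z)) has_field_derivative 0) (at 0)"
      using DERIV_mult[OF dF0 dk] y(1) by simp
    ultimately show ?thesis by (rule DERIV_unique)
  qed
  define A where "A = ?G0 + 2 * ?G2 * (r * p)"
  define B where "B = ?G1 + 2 * ?G2 * (r * q)"
  have AB1: "A * p + B * q = 0"
    using normal by (simp add: A_def B_def algebra_simps power2_eq_square)
  have AB2: "A * (q + r * D1) + B * (- p + r * D2) = 0"
    using tangent by (simp add: A_def B_def algebra_simps power2_eq_square)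
  have K: "K y1 y2 = p * D2 - q * D1"
    unfolding curv_def D1_def D2_def p_def q_def meval.hom_minus meval.hom_mult ..
  \<comment> \<open>This is the determinant of the two linear equations for \<open>(A, B)\<close>;
    the hypothesis that \<open>x\<close> is not the centre of curvature says that it is
    non-zero.\<close>
  have "p * (- p + r * D2) - q * (q + r * D1) = r * K y1 y2 - H y1 y2"
    unfolding K p_def[symmetric] q_def[symmetric] by (simp add: algebra_simps power2_eq_square)
  then have det: "p * (- p + r * D2) - q * (q + r * D1) \<noteq> 0"
    using y(4) by simp
  have "A * (p * (- p + r * D2) - q * (q + r * D1)) =
      (A * p + B * q) * (- p + r * D2) - (A * (q + r * D1) + B * (- p + r * D2)) * q"
    by (simp add: algebra_simps)
  then have "A = 0" using AB1 AB2 det by simp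
  have "B * (p * (- p + r * D2) - q * (q + r * D1)) =
      (A * (q + r * D1) + B * (- p + r * D2)) * p - (A * p + B * q) * (q + r * D1)"
    by (simp add: algebra_simps)
  then have "B = 0" using AB1 AB2 det by simp
  from \<open>A = 0\<close> \<open>B = 0\<close> show
    "?G0 + 2 * ?G2 * (x1 - y1) = 0" "?G1 + 2 * ?G2 * (x2 - y2) = 0"
    by (simp_all add: A_def B_def x p_def q_def)
qed

text \<open>\<open>offset_gradient\<close> applies to the even part and to the odd part of
  \<open>g\<close>. As \<open>d\<close> is a simple root, one of them has non-zero derivative in the
  squared distance at \<open>(s, b, d^2)\<close>, and its gradient recovers the foot.\<close>

lemma foot_distance_injective:
  assumes van: "\<And>x1 x2 d. (x1, x2, d) \<in> offset_proj f \<Longrightarrow> meval g (pt3 x1 x2 d) = 0"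
    and reg: "\<forall>(y1, y2)\<in>foot s b. (b - y2) * K y1 y2 \<noteq> H y1 y2 * F2 y1 y2 \<and> F2 y1 y2 \<noteq> 0 \<and> dist2 y1 y2 s b \<noteq> 0"
    and y: "(y1, y2) \<in> foot s b" "dist2 y1 y2 s b = d^2"
    and y': "(y1', y2') \<in> foot s b" "dist2 y1' y2' s b = d^2"
    and simple: "meval (mpderiv 2 g) (pt3 s b d) \<noteq> 0"
  shows "(y1, y2) = (y1', y2')"
proof -
  obtain g0 g1 where dec: "meval g (pt3 a b c) = meval g0 (pt3 a b (c^2)) + c * meval g1 (pt3 a b (c^2))" for a b c
    using even_odd_decomposition[of g] by blast
  \<comment> \<open>The offset contains \<open>(x, d)\<close> together with \<open>(x, - d)\<close>,
    so the two parts vanish separately.\<close>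
  have van01: "meval g0 (pt3 (y1 + r * F1 y1 y2) (y2 + r * F2 y1 y2) (r^2 * H y1 y2)) = 0 \<and>
      meval g1 (pt3 (y1 + r * F1 y1 y2) (y2 + r * F2 y1 y2) (r^2 * H y1 y2)) = 0"
    if "F0 y1 y2 = 0" "H y1 y2 \<noteq> 0" "r \<noteq> 0" for y1 y2 r
  proof -
    let ?x1 = "y1 + r * F1 y1 y2" and ?x2 = "y2 + r * F2 y1 y2" and ?h = "r * csqrt (H y1 y2)"
    have h: "?h^2 = r^2 * H y1 y2" "?h \<noteq> 0" using that by (simp_all add: power_mult_distrib)
    have "dist2 y1 y2 ?x1 ?x2 = r^2 * H y1 y2" by (simp add: power_mult_distrib algebra_simps)
    then have "(?x1, ?x2, ?h) \<in> offset_proj f" "(?x1, ?x2, - ?h) \<in> offset_proj f"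
      using foot_intro[OF that(1,2), of r] h(1) by (force simp: offset_proj_iff)+
    then have 1: "meval g0 (pt3 ?x1 ?x2 (r^2 * H y1 y2)) + ?h * meval g1 (pt3 ?x1 ?x2 (r^2 * H y1 y2)) = 0"
      "meval g0 (pt3 ?x1 ?x2 (r^2 * H y1 y2)) - ?h * meval g1 (pt3 ?x1 ?x2 (r^2 * H y1 y2)) = 0"
      using van dec[of ?x1 ?x2 ?h] dec[of ?x1 ?x2 "- ?h"] by (simp_all only: h power2_minus mult_minus_left diff_conv_add_uminus)
    have "2 * (?h * meval g1 (pt3 ?x1 ?x2 (r^2 * H y1 y2))) = 0"
      using arg_cong2[OF 1, of "(-)"] by simp
    then have "meval g1 (pt3 ?x1 ?x2 (r^2 * H y1 y2)) = 0" using h(2) by simp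
    with 1(1) show ?thesis by simp
  qed
  have grad: "meval (mpderiv 0 G) (pt3 s b (d^2)) + 2 * meval (mpderiv 2 G) (pt3 s b (d^2)) * (s - z1) = 0 \<and>
      meval (mpderiv 1 G) (pt3 s b (d^2)) + 2 * meval (mpderiv 2 G) (pt3 s b (d^2)) * (b - z2) = 0"
    if "G = g0 \<or> G = g1" and z: "(z1, z2) \<in> foot s b" "dist2 z1 z2 s b = d^2" for G z1 z2
  proof -
    obtain r where r: "s = z1 + r * F1 z1 z2" "b = z2 + r * F2 z1 z2" "dist2 z1 z2 s b = r^2 * H z1 z2"
      using foot_param[OF z(1)] .
    have z0: "F0 z1 z2 = 0" "H z1 z2 \<noteq> 0" using z(1) by (auto simp: foot_def)
    have zr: "(b - z2) * K z1 z2 \<noteq> H z1 z2 * F2 z1 z2" "dist2 z1 z2 s b \<noteq> 0"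
      using reg z(1) by auto
    have "r \<noteq> 0" using zr(2) r(3) by auto
    have "r * K z1 z2 \<noteq> H z1 z2"
    proof
      assume "r * K z1 z2 = H z1 z2"
      then have "(b - z2) * K z1 z2 = H z1 z2 * F2 z1 z2"
        using r(2) by (metis add_diff_cancel_left' mult.commute mult.left_commute)
      with zr(1) show False ..
    qed
    show ?thesis
      using offset_gradient[of G z1 z2 r s b "d^2"] van01 that(1) z0 \<open>r \<noteq> 0\<close> \<open>r * K z1 z2 \<noteq> H z1 z2\<close> r z(2)
      by (metis (no_types, lifting))
  qed
  \<comment> \<open>With \<open>g0'\<close> and \<open>g1'\<close> the derivatives in the last
    variable, the derivative of \<open>g\<close> in \<open>d\<close> is
    \<open>2 d g0' + g1 + 2 d^2 g1'\<close>, and \<open>g1\<close> vanishes at this point.\<close>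
  have "\<exists>G. (G = g0 \<or> G = g1) \<and> meval (mpderiv 2 G) (pt3 s b (d^2)) \<noteq> 0"
  proof (rule ccontr)
    assume "\<not> ?thesis"
    then have z: "meval (mpderiv 2 g0) (pt3 s b (d^2)) = 0" "meval (mpderiv 2 g1) (pt3 s b (d^2)) = 0" by auto
    obtain r where r: "s = y1 + r * F1 y1 y2" "b = y2 + r * F2 y1 y2" "dist2 y1 y2 s b = r^2 * H y1 y2"
      using foot_param[OF y(1)] .
    have "F0 y1 y2 = 0" "H y1 y2 \<noteq> 0" using y(1) by (auto simp: foot_def)
    moreover have "r \<noteq> 0" using reg y(1) r(3) by auto
    ultimately have "meval g1 (pt3 s b (d^2)) = 0"
      using van01[of y1 y2 r] r y(2) by (metis (no_types, lifting))
    have Dg: "((\<lambda>z. meval g (pt3 s b z)) has_field_derivative meval (mpderiv 2 g) (pt3 s b d)) (at d)"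
      using DERIV_meval_pt3[OF DERIV_const[of s] DERIV_const[of b] DERIV_ident, where p = g and x = d] by simp
    have dq: "((\<lambda>z. z^2) has_field_derivative 2 * d) (at d)" by (auto intro!: derivative_eq_intros)
    have D: "((\<lambda>z. meval G (pt3 s b (z^2))) has_field_derivative meval (mpderiv 2 G) (pt3 s b (d^2)) * (2 * d)) (at d)" for G
      using DERIV_meval_pt3[OF DERIV_const[of s] DERIV_const[of b] dq, where p = G] by simp
    have "((\<lambda>z. meval g (pt3 s b z)) has_field_derivative 0) (at d)"
      unfolding dec using DERIV_add[OF D[of g0] DERIV_mult[OF DERIV_ident D[of g1]]] z \<open>meval g1 _ = 0\<close> by simp
    from DERIV_unique[OF Dg this] simple show False by contradiction
  qed
  then obtain G where G: "G = g0 \<or> G = g1" "meval (mpderiv 2 G) (pt3 s b (d^2)) \<noteq> 0" by blast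
  let ?c = "meval (mpderiv 2 G) (pt3 s b (d^2))"
  have "2 * ?c * (s - y1) = 2 * ?c * (s - y1')" "2 * ?c * (b - y2) = 2 * ?c * (b - y2')"
    using grad[OF G(1) y] grad[OF G(1) y'] by (metis add_left_imp_eq)+
  with G(2) show ?thesis by simp
qed

end

subsection \<open>Counting roots\<close>

lemma degree_eq_sum_order:
  fixes p :: "complex poly"
  assumes "p \<noteq> 0"
  shows "degree p = (\<Sum>z | poly p z = 0. order z p)"
  using assms by (simp add: size_proots_complex[symmetric] size_multiset_overloaded_eq)

lemma card_roots_simple:
  fixes p :: "complex poly"
  assumes "p \<noteq> 0" "\<And>z. poly p z = 0 \<Longrightarrow> poly (pderiv p) z \<noteq> 0"
  shows "card {z. poly p z = 0} = degree p"
proof -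
  have "(\<Sum>z | poly p z = 0. order z p) = (\<Sum>z | poly p z = 0. 1)"
    by (rule sum.cong[OF refl]) (use assms(2) in \<open>simp add: order_eq_1_of_simple_root\<close>)
  then show ?thesis by (simp add: degree_eq_sum_order[OF assms(1)])
qed

lemma coeff_to_univ_eq_xcoeff: "coeff (to_univ k p) (lookup m k) = xcoeff {k} p m"
  unfolding coeff_to_univ xcoeff_def by (simp add: sum.If_cases Int_def)

lemma coeff_to_univ_neq_0:
  "m \<in> keys p \<Longrightarrow> coeff (to_univ k p) (lookup m k) \<noteq> 0"
  unfolding coeff_to_univ_eq_xcoeff by (rule xcoeff_self) simp_all

lemma degree_to_univ: "degree (to_univ k p) = deg_var k p"
proof (rule antisym)
  show "degree (to_univ k p) \<le> deg_var k p"
  proof (rule degree_le, intro allI impI)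
    fix j assume j: "deg_var k p < j"
    have "lookup m k \<le> deg_var k p" if "m \<in> keys p" for m
      unfolding deg_var_def using that by (intro Max_ge) auto
    with j have "lookup m k \<noteq> j" if "m \<in> keys p" for m
      using that leD by blast
    then show "coeff (to_univ k p) j = 0"
      unfolding coeff_to_univ by (intro sum.neutral) auto
  qed
  show "deg_var k p \<le> degree (to_univ k p)"
    unfolding deg_var_def
  proof (rule Max.boundedI)
    fix j assume "j \<in> insert 0 ((\<lambda>m. lookup m k) ` keys p)"
    then show "j \<le> degree (to_univ k p)" using le_degree[OF coeff_to_univ_neq_0[of _ p k]] by auto
  qed simp_all
qed

lemma DERIV_meval_fun_upd:
  "((\<lambda>z. meval p (a(k := z))) has_field_derivative meval (mpderiv k p) (a(k := x))) (at x)"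
proof -
  have "((\<lambda>z. meval p (a(k := z))) has_field_derivative
      (\<Sum>i\<in>{k}. meval (mpderiv i p) (a(k := x)) * (if i = k then 1 else 0))) (at x)"
    by (rule has_field_derivative_meval) auto
  then show ?thesis by simp
qed

lemma poly_pderiv_eval_univ: "poly (pderiv (eval_univ k a p)) z = meval (mpderiv k p) (a(k := z))"
proof -
  have "((\<lambda>z. poly (eval_univ k a p) z) has_field_derivative poly (pderiv (eval_univ k a p)) z) (at z)"
    by (rule poly_DERIV)
  then have "((\<lambda>z. meval p (a(k := z))) has_field_derivative poly (pderiv (eval_univ k a p)) z) (at z)"
    by simp
  from DERIV_unique[OF this DERIV_meval_fun_upd] show ?thesis .
qed

lemma pt2_upd: "(pt2 a b)(2 := c) = pt3 a b c"
  by (rule ext) (simp add: pt2_def pt3_def)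

text \<open>It suffices to avoid the zeros of two non-zero polynomials in \<open>x\<close>: the
  leading coefficient in \<open>d\<close>, which preserves the degree, and the resultant with the
  derivative, which excludes multiple roots.\<close>

lemma eventually_simple_roots:
  assumes "mvars g \<subseteq> {0, 1, 2}" "squarefree g"
  shows "\<forall>\<^sub>F b in cofinite. \<forall>\<^sub>F s in cofinite.
    card {d. meval g (pt3 s b d) = 0} = deg_var 2 g \<and>
    (\<forall>d. meval g (pt3 s b d) = 0 \<longrightarrow> meval (mpderiv 2 g) (pt3 s b d) \<noteq> 0)"
proof -
  let ?T = "to_tri g"
  have T0: "?T \<noteq> 0"
    using squarefree_to_tri[OF assms] by auto
  have deg: "degree ?T = deg_var 2 g"
  proof -
    have "to_univ 2 g \<noteq> 0" using T0 by (auto simp: to_tri_def)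
    have "mvars (lead_coeff (to_univ 2 g)) \<subseteq> {0, 1}"
      using mvars_coeff_to_univ[of 2 g "degree (to_univ 2 g)"] assms(1) by auto
    then have "of_bi (to_bi coord2 (lead_coeff (to_univ 2 g))) \<noteq> 0"
      using \<open>to_univ 2 g \<noteq> 0\<close> by (simp only: of_bi_to_bi) simp
    then have "to_bi coord2 (lead_coeff (to_univ 2 g)) \<noteq> 0" by auto
    then have "degree ?T = degree (to_univ 2 g)"
      unfolding to_tri_def by (rule map_poly_degree_eq)
    then show ?thesis by (simp add: degree_to_univ)
  qed
  have "\<forall>\<^sub>F b in cofinite. \<forall>\<^sub>F s in cofinite. bi (lead_coeff ?T) s b \<noteq> 0"
    using T0 by (intro eventually_cofinite_bi_neq_0) simp
  moreover have "\<forall>\<^sub>F b in cofinite. \<forall>\<^sub>F s in cofinite. bi (resultant ?T (pderiv ?T)) s b \<noteq> 0"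
    by (intro eventually_cofinite_bi_neq_0 squarefree_resultant_pderiv_neq_0 squarefree_to_tri assms)
  ultimately show ?thesis
  proof eventually_elim
    case (elim b)
    then show ?case
    proof eventually_elim
      case (elim s)
      let ?h = "\<lambda>q. bi q s b"
      let ?p = "map_poly ?h ?T"
      have p_eq: "?p = eval_univ 2 (pt2 s b) g"
        by (rule poly_eqI) (simp add: to_tri_def coeff_map_poly bi_to_bi_coord2)
      have val: "poly ?p d = meval g (pt3 s b d)" for d
        unfolding p_eq by (simp add: pt2_upd)
      have der: "poly (pderiv ?p) d = meval (mpderiv 2 g) (pt3 s b d)" for d
        unfolding p_eq by (simp add: pt2_upd poly_pderiv_eval_univ)
      have degp: "degree ?p = degree ?T"
        using elim(1) by (rule map_poly_degree_eq)
      have p0: "?p \<noteq> 0"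
        using elim(1) by (auto simp: poly_eq_iff coeff_map_poly)
      have pderiv_eq: "map_poly ?h (pderiv ?T) = pderiv ?p"
      proof (rule poly_eqI)
        fix i
        have "?h (of_nat (Suc i) * coeff ?T (Suc i)) = of_nat (Suc i) * ?h (coeff ?T (Suc i))"
        proof -
          interpret comm_ring_hom ?h by (rule bi_hom)
          show ?thesis by (simp only: hom_mult hom_of_nat)
        qed
        then show "coeff (map_poly ?h (pderiv ?T)) i = coeff (pderiv ?p) i"
          by (simp only: coeff_map_poly bi_simps coeff_pderiv)
      qed
      have simple: "poly (pderiv ?p) d \<noteq> 0" if d: "poly ?p d = 0" for d
      proof
        assume d': "poly (pderiv ?p) d = 0"
        \<comment> \<open>Guarantees a non-empty Sylvester matrix, as
          \<open>resultant_sub_common_root\<close> demands.\<close>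
        have "degree ?T \<noteq> 0"
        proof
          assume "degree ?T = 0"
          then obtain c where "?p = [:c:]" using degp by (metis degree_eq_zeroE)
          with p0 d show False by simp
        qed
        then have "resultant_sub (degree ?T) (degree (pderiv ?T)) ?p (pderiv ?p) = 0"
          using d d' degp degree_map_poly_le[of ?h "pderiv ?T"]
          by (intro resultant_sub_common_root[where z = d]) (auto simp: pderiv_eq)
        then have "?h (resultant ?T (pderiv ?T)) = 0"
          by (simp add: resultant_sub_hom[OF bi_hom] pderiv_eq)
        with elim(2) show False by contradiction
      qed
      have "card {d. poly ?p d = 0} = degree ?p"
        using p0 simple by (rule card_roots_simple)
      then show ?case using simple by (simp add: val der degp deg)
    qed
  qed
qed

subsection \<open>Homogeneity of resultants\<close>

text \<open>Truncation in \<open>n - j\<close> is harmless: for \<open>j > n\<close> the coefficient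
  is zero, and zero is homogeneous of every degree.\<close>

lemma hom_in_coeff_to_univ:
  assumes "finite V" "k \<notin> V" "hom_in (insert k V) n p"
  shows "hom_in V (n - j) (coeff (to_univ k p) j)"
  unfolding coeff_to_univ
proof (rule hom_in_sum)
  fix m assume m: "m \<in> keys p"
  have "wt V (mono_drop {k} m) = wt V m"
    using assms(2) by (intro sum.cong) (auto simp: lookup_mono_drop)
  moreover have "lookup m k + wt V m = n"
    using assms m by (simp add: hom_in_def)
  ultimately show "hom_in V (n - j) (if lookup m k = j
      then single (mono_drop {k} m) (lookup p m) else 0)"
    by (auto intro: hom_in_single simp: hom_in_def[of V "n - j" 0])
qed

lemma degree_to_univ_le_hom:
  assumes "finite V" "hom_in (insert k V) n p"
  shows "degree (to_univ k p) \<le> n"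
proof -
  have "lookup m k \<le> n" if "m \<in> keys p" for m
  proof -
    have "lookup m k \<le> wt (insert k V) m"
      by (rule member_le_sum) (use assms(1) in auto)
    then show ?thesis using assms(2) that by (simp add: hom_in_def)
  qed
  then show ?thesis unfolding degree_to_univ deg_var_def by (intro Max.boundedI) auto
qed

text \<open>Grading the coefficients multiplies the \<open>(i, j)\<close> entry of the Sylvester matrix by a power of
  the grading variable \<open>X\<close> which, after multiplying row \<open>i\<close> by \<open>X\<^sup>i\<close>, is a product of a
  row factor and the column factor \<open>X\<^sup>j\<close>.\<close>
lemma hom_in_mres:
  assumes V: "finite V" "k \<notin> V" and p: "hom_in (insert k V) n p" and q: "hom_in (insert k V) n q"
  shows "\<exists>e. hom_in V e (mres k p q)"
proof -
  let ?P = "to_univ k p" and ?Q = "to_univ k q"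
  let ?m = "degree ?P" and ?l = "degree ?Q"
  let ?N = "?m + ?l"
  let ?X = "\<lambda>i. monom (1::mpoly) i"
  let ?S = "sylvester_mat_sub ?m ?l ?P ?Q"
  let ?S' = "sylvester_mat_sub ?m ?l (map_poly (grade V) ?P) (map_poly (grade V) ?Q)"
  \<comment> \<open>Row \<open>i\<close> holds the coefficients of index \<open>m + i - j\<close> of
    the first polynomial if \<open>i < l\<close>, and of index \<open>i - j\<close> of the second
    otherwise. Their weights \<open>n - (m + i - j)\<close> and \<open>n - (i - j)\<close>, raised
    by \<open>i\<close>, are \<open>e i + j\<close>.\<close>
  define e where "e = (\<lambda>i. if i < ?l then n - ?m else n)"
  have mn: "?m \<le> n" "?l \<le> n" using degree_to_univ_le_hom V(1) p q by blast+
  have gP: "grade V (coeff ?P j) = monom (coeff ?P j) (n - j)"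
    and gQ: "grade V (coeff ?Q j) = monom (coeff ?Q j) (n - j)" for j
    using hom_in_coeff_to_univ[OF V p] hom_in_coeff_to_univ[OF V q]
    by (simp_all add: hom_in_iff_grade[OF V(1)])
  have g0: "grade V 0 = 0" by simp
  have entry: "?X i * ?S' $$ (i, j) = ?X (e i) * ?X j * [:?S $$ (i, j):]" if "i < ?N" "j < ?N" for i j
  proof (cases "i < ?l")
    case True
    show ?thesis
    proof (cases "i \<le> j \<and> j - i \<le> ?m")
      case ij: True
      then have "i + (n - (?m + i - j)) = n - ?m + j" using mn by linarith
      then show ?thesis
        using that True ij
        by (simp only: sylvester_mat_sub_index coeff_map_poly[where f = "grade V", OF g0] gP e_def if_True mult_monom
            smult_monom mult_1_left mult_1_right add_0_right simp_thms flip: monom_0)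
    next
      case False
      then show ?thesis
        using that True by (simp only: sylvester_mat_sub_index if_True if_False pCons_0_0 mult_zero_right)
    qed
  next
    case False
    have "i + (n - (i - j)) = n + j" if "i - ?l \<le> j" "j \<le> i" using that mn by linarith
    then show ?thesis
      using that False
      by (simp add: sylvester_mat_sub_index coeff_map_poly gQ e_def mult_monom smult_monom)
  qed
  have prodX: "(\<Prod>i<N. ?X (w i)) = ?X (\<Sum>i<N. w i)" for N :: nat and w
    by (induction N) (simp_all add: mult_monom)
  have grR: "grade V (mres k p q) = det ?S'"
    unfolding mres_def resultant_sub_hom[OF comm_ring_hom_grade] resultant_sub_def ..
  have S': "mat ?N ?N (\<lambda>(i, j). ?S' $$ (i, j)) = ?S'" by (rule eq_matI) auto
  have S: "mat ?N ?N (\<lambda>(i, j). [:?S $$ (i, j):]) = map_mat (\<lambda>c. [:c:]) ?S" by (rule eq_matI) auto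
  have "(\<Prod>i<?N. ?X i) * (\<Prod>j<?N. 1) * det (mat ?N ?N (\<lambda>(i, j). ?S' $$ (i, j)))
      = det (mat ?N ?N (\<lambda>(i, j). ?X i * 1 * ?S' $$ (i, j)))"
    by (rule det_scale_rows_cols[symmetric])
  also have "mat ?N ?N (\<lambda>(i, j). ?X i * 1 * ?S' $$ (i, j)) =
      mat ?N ?N (\<lambda>(i, j). ?X (e i) * ?X j * [:?S $$ (i, j):])"
    by (rule cong_mat) (simp_all only: prod.case mult_1_right entry)
  also have "det \<dots> = (\<Prod>i<?N. ?X (e i)) * (\<Prod>j<?N. ?X j) * det (mat ?N ?N (\<lambda>(i, j). [:?S $$ (i, j):]))"
    by (rule det_scale_rows_cols)
  also have "det (mat ?N ?N (\<lambda>(i, j). [:?S $$ (i, j):])) = [:mres k p q:]"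
    unfolding S comm_ring_hom.hom_det[OF comm_ring_hom_const_poly]
    by (simp add: mres_def resultant_sub resultant_sub_def)
  finally have "(\<Prod>i<?N. ?X i) * det ?S' = (\<Prod>i<?N. ?X i) * ((\<Prod>i<?N. ?X (e i)) * [:mres k p q:])"
    unfolding S' by (simp only: prod.neutral_const mult_1_right mult_1_left mult_ac)
  moreover have "(\<Prod>i<?N. ?X i) \<noteq> 0" unfolding prodX by simp
  ultimately have "det ?S' = (\<Prod>i<?N. ?X (e i)) * [:mres k p q:]"
    by (rule mult_left_cancel[THEN iffD1, rotated])
  also have "\<dots> = monom (mres k p q) (\<Sum>i<?N. e i)"
    unfolding prodX by (simp add: smult_monom mult.commute[of _ "[:mres k p q:]"])
  finally have "hom_in V (\<Sum>i<?N. e i) (mres k p q)"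
    unfolding hom_in_iff_grade[OF V(1)] grR .
  then show ?thesis ..
qed

lemma mvars_of_int [simp]: "mvars (of_int z) = {}"
proof -
  interpret comm_ring_hom mC by (rule comm_ring_hom_mC)
  have "of_int z = mC (of_int z)" by (simp add: hom_of_int)
  then show ?thesis by (simp only: mvars_mC)
qed

lemma mvars_mres:
  assumes "mvars p - {k} \<subseteq> A" "mvars q - {k} \<subseteq> A"
  shows "mvars (mres k p q) \<subseteq> A"
proof -
  let ?S = "sylvester_mat (to_univ k p) (to_univ k q)"
  let ?N = "degree (to_univ k p) + degree (to_univ k q)"
  have entry: "mvars (?S $$ (i, j)) \<subseteq> A" if "i < ?N" "j < ?N" for i j
    using mvars_coeff_to_univ[of k p] mvars_coeff_to_univ[of k q] assms
    by (simp add: sylvester_index_mat[OF that]) blast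
  have "mvars (of_int (sign \<pi>) * (\<Prod>i = 0..<?N. ?S $$ (i, \<pi> i))) \<subseteq> A"
    if "\<pi> permutes {0..<?N}" for \<pi>
  proof -
    have "mvars (\<Prod>i = 0..<?N. ?S $$ (i, \<pi> i)) \<subseteq> (\<Union>i\<in>{0..<?N}. mvars (?S $$ (i, \<pi> i)))"
      by (rule mvars_prod)
    also have "\<dots> \<subseteq> A"
      using permutes_in_image[OF that] by (intro UN_least entry) auto
    finally show ?thesis
      using mvars_mult[of "of_int (sign \<pi>)" "\<Prod>i = 0..<?N. ?S $$ (i, \<pi> i)"] by simp
  qed
  then show ?thesis
    unfolding mres_def resultant_def det_def'[OF sylvester_carrier_mat]
    by (intro order.trans[OF mvars_sum] UN_least) auto
qed

subsection \<open>Homogenization and special slopes\<close>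

lemma meval_single: "meval (single m c) a = c * mono_ev a m"
  by (simp add: meval_mev mev_single)

lemma mVar_neq_0 [simp]: "mVar i \<noteq> 0"
  using meval_mVar[of i "\<lambda>_. 1"] by (metis meval.hom_zero zero_neq_one)

text \<open>The factor theorem for \<open>p\<close> as a polynomial in the variable
  \<open>k\<close>.\<close>

lemma dvd_of_msubst_0:
  assumes "msubst (mVar(k := q)) p = 0"
  shows "(mVar k - q) dvd p"
proof -
  have "poly (to_univ k p) q = 0" by (simp add: poly_to_univ assms)
  then have "[:- q, 1:] dvd to_univ k p" by (simp only: poly_eq_0_iff_dvd)
  then obtain r where "to_univ k p = [:- q, 1:] * r" by (elim dvdE)
  then have "p = poly ([:- q, 1:] * r) (mVar k)"
    using poly_to_univ_mVar[of k p] by (simp only:)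
  then have "p = (mVar k - q) * poly r (mVar k)" by (simp add: algebra_simps)
  then show ?thesis by (rule dvdI)
qed

lemma meval_dehomogenize:
  assumes "hom_in {0, 1} k p" "a 0 \<noteq> 0"
  shows "meval p a = a 0 ^ k * meval p (a(0 := 1, 1 := a 1 / a 0))"
proof -
  have "(\<lambda>i. if i \<in> {0, 1} then a 0 * (a(0 := 1, 1 := a 1 / a 0)) i else (a(0 := 1, 1 := a 1 / a 0)) i) = a"
    by (rule ext) (use assms(2) in auto)
  then show ?thesis
    using meval_hom_in[OF _ assms(1), of "a 0" "a(0 := 1, 1 := a 1 / a 0)"] by simp
qed

lemma finite_dehomogenized_zeros:
  assumes "hom_in {0, 1} k p" "mvars p \<subseteq> {0, 1}" "p \<noteq> 0"
  shows "finite {t. meval p (pt2 1 t) = 0}"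
proof -
  have "mVar 0 * p \<noteq> 0" using assms(3) by simp
  then obtain a where "meval (mVar 0 * p) a \<noteq> 0" using exists_meval_neq_0 by blast
  then have a: "a 0 \<noteq> 0" "meval p a \<noteq> 0" by (auto simp: meval.hom_mult)
  then have "meval p (a(0 := 1, 1 := a 1 / a 0)) \<noteq> 0"
    using meval_dehomogenize[OF assms(1), of a] a by auto
  also have "meval p (a(0 := 1, 1 := a 1 / a 0)) = meval p (pt2 1 (a 1 / a 0))"
    by (rule meval_cong) (use assms(2) in \<open>auto simp: pt2_def\<close>)
  finally have nz: "meval p (pt2 1 (a 1 / a 0)) \<noteq> 0" .
  obtain q where q: "meval p (pt2 1 t) = poly q t" for t
    using meval_pt2_line[of p 1 0 0 1] by auto
  with nz have "q \<noteq> 0" by auto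
  then show ?thesis unfolding q by (rule poly_roots_finite)
qed

abbreviation pt5 :: "complex \<Rightarrow> complex \<Rightarrow> complex \<Rightarrow> complex \<Rightarrow> nat \<Rightarrow> complex" where
  "pt5 y1 y2 s b \<equiv> (\<lambda>i. if i = 0 then y1 else if i = 1 then y2 else if i = 3 then s else if i = 4 then b else 0)"

lemma eventually_meval_pt5_neq_0:
  assumes "meval p (pt5 y1 y2 s b) \<noteq> 0"
  shows "\<forall>\<^sub>F b in cofinite. \<forall>\<^sub>F s in cofinite. meval p (pt5 y1 y2 s b) \<noteq> 0"
proof -
  let ?\<sigma> = "\<lambda>i::nat. if i = 0 then [:[:y1:]:] else if i = 1 then [:[:y2:]:] else
      if i = 3 then [:[:0, 1:]:] else if i = 4 then [:0, 1:] else 0"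
  have \<sigma>: "bi (to_bi ?\<sigma> p) s b = meval p (pt5 y1 y2 s b)" for s b
  proof -
    have "(\<lambda>i. bi (?\<sigma> i) s b) = pt5 y1 y2 s b" by (rule ext) simp
    then show ?thesis by (simp only: bi_to_bi)
  qed
  have "to_bi ?\<sigma> p \<noteq> 0" using assms unfolding \<sigma>[symmetric] by auto
  from eventually_cofinite_bi_neq_0[OF this] show ?thesis by (simp only: \<sigma>)
qed

section \<open>The homogenized curve on lines through the origin\<close>

context plane_curve
begin

definition n :: nat where "n = deg_set {0, 1} f"

lemma lookup_le_n: "m \<in> keys f \<Longrightarrow> lookup m 0 + lookup m 1 \<le> n"
  unfolding n_def deg_set_def by (rule Max_ge) auto

lemma keys_monomial_subset: "m \<in> keys f \<Longrightarrow> keys m \<subseteq> {0, 1}"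
  using f_vars by (auto simp: mvars_def)

lemma lookup_f_eq_0: "m \<in> keys f \<Longrightarrow> i \<notin> {0, 1} \<Longrightarrow> lookup m i = 0"
  using keys_monomial_subset[of m] by (metis in_keys_iff subsetD)

lemma meval_homog:
  assumes "a 2 \<noteq> 0"
  shows "meval (homog f) a = a 2 ^ n * F0 (a 0 / a 2) (a 1 / a 2)"
proof -
  have "mono_ev a (m + single 2 (n - (lookup m 0 + lookup m 1)))
      = a 2 ^ n * mono_ev (pt2 (a 0 / a 2) (a 1 / a 2)) m" if m: "m \<in> keys f" for m
  proof -
    let ?i = "lookup m 0" and ?j = "lookup m 1"
    have ev: "mono_ev b m = b 0 ^ ?i * b 1 ^ ?j" for b :: "nat \<Rightarrow> complex"
      using mono_ev_superset[of "{0, 1}" m b] keys_monomial_subset[OF m] by simp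
    have "a 2 ^ n = a 2 ^ (n - (?i + ?j)) * (a 2 ^ ?i * a 2 ^ ?j)"
      using lookup_le_n[OF m] by (simp flip: power_add)
    then show ?thesis
      using assms by (simp add: mono_ev_add mono_ev_single ev power_divide)
  qed
  note mono = this
  have "meval (homog f) a = (\<Sum>m\<in>keys f. a 2 ^ n *
      (lookup f m * mono_ev (pt2 (a 0 / a 2) (a 1 / a 2)) m))"
    unfolding homog_def n_def[symmetric] meval.hom_sum meval_single
    by (rule sum.cong[OF refl]) (simp only: mono mult_ac)
  also have "\<dots> = a 2 ^ n * F0 (a 0 / a 2) (a 1 / a 2)"
    by (simp add: meval_mev mev_def sum_distrib_left)
  finally show ?thesis .
qed

lemma meval_mpderiv_homog:
  assumes "a 2 \<noteq> 0"
  shows "a 2 * meval (mpderiv 0 (homog f)) a = a 2 ^ n * F1 (a 0 / a 2) (a 1 / a 2)"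
    and "a 2 * meval (mpderiv 1 (homog f)) a = a 2 ^ n * F2 (a 0 / a 2) (a 1 / a 2)"
proof -
  have "((\<lambda>z. meval (homog f) (a(0 := z))) has_field_derivative meval (mpderiv 0 (homog f)) (a(0 := a 0))) (at (a 0))"
    by (rule DERIV_meval_fun_upd)
  then have 1: "((\<lambda>z. a 2 ^ n * F0 (z / a 2) (a 1 / a 2)) has_field_derivative meval (mpderiv 0 (homog f)) a) (at (a 0))"
    using assms by (simp add: meval_homog)
  have "((\<lambda>z. F0 (z / a 2) (a 1 / a 2)) has_field_derivative
      F1 (a 0 / a 2) (a 1 / a 2) * (1 / a 2) + F2 (a 0 / a 2) (a 1 / a 2) * 0) (at (a 0))"
    by (rule DERIV_meval_pt2) (use assms in \<open>auto intro!: derivative_eq_intros\<close>)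
  from DERIV_unique[OF 1 DERIV_cmult[OF this, of "a 2 ^ n"]]
  show "a 2 * meval (mpderiv 0 (homog f)) a = a 2 ^ n * F1 (a 0 / a 2) (a 1 / a 2)"
    using assms by simp
  have "((\<lambda>z. meval (homog f) (a(1 := z))) has_field_derivative meval (mpderiv 1 (homog f)) (a(1 := a 1))) (at (a 1))"
    by (rule DERIV_meval_fun_upd)
  then have 1: "((\<lambda>z. a 2 ^ n * F0 (a 0 / a 2) (z / a 2)) has_field_derivative meval (mpderiv 1 (homog f)) a) (at (a 1))"
    using assms by (simp add: meval_homog)
  have "((\<lambda>z. F0 (a 0 / a 2) (z / a 2)) has_field_derivative
      F1 (a 0 / a 2) (a 1 / a 2) * 0 + F2 (a 0 / a 2) (a 1 / a 2) * (1 / a 2)) (at (a 1))"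
    by (rule DERIV_meval_pt2) (use assms in \<open>auto intro!: derivative_eq_intros\<close>)
  from DERIV_unique[OF 1 DERIV_cmult[OF this, of "a 2 ^ n"]]
  show "a 2 * meval (mpderiv 1 (homog f)) a = a 2 ^ n * F2 (a 0 / a 2) (a 1 / a 2)"
    using assms by simp
qed

lemma meval_Npoly:
  assumes "a 2 \<noteq> 0"
  shows "meval (Npoly f) a = a 2 ^ n * nrm (a 0 / a 2) (a 1 / a 2) (a 3) (a 4)"
proof -
  have 1: "a 3 * a 2 - a 0 = a 2 * (a 3 - a 0 / a 2)" "a 4 * a 2 - a 1 = a 2 * (a 4 - a 1 / a 2)"
    using assms by (simp_all add: field_simps)
  have "meval (Npoly f) a = - (a 2 * meval (mpderiv 1 (homog f)) a) * (a 3 - a 0 / a 2)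
      + (a 2 * meval (mpderiv 0 (homog f)) a) * (a 4 - a 1 / a 2)"
    unfolding Npoly_def meval.hom_add meval.hom_mult meval.hom_uminus meval.hom_minus meval_mVar 1
    by (simp add: algebra_simps)
  also have "\<dots> = a 2 ^ n * nrm (a 0 / a 2) (a 1 / a 2) (a 3) (a 4)"
    unfolding meval_mpderiv_homog[where a = a, OF assms] by (simp add: algebra_simps)
  finally show ?thesis .
qed

lemma n_pos: "n > 0"
proof (rule ccontr)
  assume "\<not> n > 0"
  have "mvars f = {}"
  proof (rule ccontr)
    assume "mvars f \<noteq> {}"
    then obtain i where "i \<in> mvars f" by blast
    then obtain m where m: "m \<in> keys f" "i \<in> keys m" by (auto simp: mvars_def)
    then have "i \<in> {0, 1}" using keys_monomial_subset by blast
    moreover have "lookup m i > 0" using m(2) by (simp add: in_keys_iff)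
    ultimately have "lookup m 0 + lookup m 1 > 0" by auto
    with lookup_le_n[OF m(1)] \<open>\<not> n > 0\<close> show False by auto
  qed
  then obtain c where c: "f = mC c" using mvars_empty by blast
  obtain a b where "F0 a b = 0" using infinite_curve not_finite_existsD by blast
  then have "c = 0" by (simp add: c)
  then have "f = 0" by (simp add: c mC_def)
  with f_irred show False by auto
qed

lemma hom_in_homog: "hom_in (insert 2 {0, 1}) n (homog f)"
  unfolding homog_def n_def[symmetric]
proof (rule hom_in_sum, rule hom_in_single)
  fix m assume m: "m \<in> keys f"
  show "wt (insert 2 {0, 1}) (m + single 2 (n - (lookup m 0 + lookup m 1))) = n"
    using lookup_le_n[OF m] lookup_f_eq_0[OF m, of 2]
    by (simp add: lookup_add lookup_single when_def)
qed

lemma mvars_homog: "mvars (homog f) \<subseteq> {0, 1, 2}"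
proof -
  have "mvars (homog f) \<subseteq> (\<Union>m\<in>keys f. keys
      (m + single 2 (n - (lookup m 0 + lookup m 1))))"
    unfolding homog_def n_def[symmetric]
    by (rule order.trans[OF mvars_sum], rule UN_mono[OF order_refl], rule mvars_single)
  also have "\<dots> \<subseteq> {0, 1, 2}"
  proof (rule UN_least)
    fix m assume "m \<in> keys f"
    then show "keys (m + single 2 (n - (lookup m 0 + lookup m 1))) \<subseteq> {0, 1, 2}"
      using keys_monomial_subset[of m] Poly_Mapping.keys_add[of m "single 2 (n - (lookup m 0 + lookup m 1))"]
      by (auto split: if_splits)
  qed
  finally show ?thesis .
qed

lemma hom_in_Npoly: "hom_in (insert 2 {0, 1}) n (Npoly f)"
proof -
  let ?V = "insert 2 {0, 1} :: nat set"
  have V: "finite ?V" by simp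
  have n: "Suc (n - 1) = n" "n - 1 + 1 = n" using n_pos by simp_all
  have v: "hom_in ?V 1 (mVar i)" if "i \<in> ?V" for i using hom_in_mVar[OF V, of i] that by simp
  have v': "hom_in ?V 0 (mVar i)" if "i \<notin> ?V" for i using hom_in_mVar[OF V, of i] that by simp
  have d: "hom_in ?V (n - 1) (mpderiv i (homog f))" if "i \<in> ?V" for i
    by (rule hom_in_mpderiv[OF V that]) (simp only: n hom_in_homog)
  have "hom_in ?V 1 (mVar i * mVar 2 - mVar j)" if "i \<notin> ?V" "j \<in> ?V" for i j
    using hom_in_diff[OF hom_in_mult[OF v'[OF that(1)] v[of 2]] ] v[OF that(2)] by simp
  from hom_in_mult[OF d this] have "hom_in ?V n (mpderiv k (homog f) * (mVar i * mVar 2 - mVar j))"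
    if "k \<in> ?V" "i \<notin> ?V" "j \<in> ?V" for k i j using that n by simp
  then show ?thesis
    unfolding Npoly_def
    by (intro hom_in_add) (simp_all add: hom_in_uminus flip: minus_mult_left)
qed

lemma mvars_Npoly: "mvars (Npoly f) \<subseteq> {0, 1, 2, 3, 4}"
proof -
  have d: "mvars (mpderiv i (homog f)) \<subseteq> {0, 1, 2, 3, 4}" for i
    using mvars_mpderiv[of i "homog f"] mvars_homog by blast
  have v: "mvars (mVar i * mVar 2 - mVar j) \<subseteq> {i, 2, j}" for i j
    using mvars_diff[of "mVar i * mVar 2" "mVar j"] mvars_mult[of "mVar i" "mVar 2"] by auto
  have "mvars (mpderiv k (homog f) * (mVar i * mVar 2 - mVar j)) \<subseteq> {0, 1, 2, 3, 4}"
    if "i \<in> {3, 4}" "j \<in> {0, 1}" for k i j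
    using mvars_mult[of "mpderiv k (homog f)" "mVar i * mVar 2 - mVar j"] d[of k] v[of i j] that by blast
  from this[of 3 0 1] this[of 4 1 0] show ?thesis
    unfolding Npoly_def minus_mult_left[symmetric]
    using mvars_add[of "- (mpderiv 1 (homog f) * (mVar 3 * mVar 2 - mVar 0))"
        "mpderiv 0 (homog f) * (mVar 4 * mVar 2 - mVar 1)"] by auto
qed

text \<open>This coefficient is the top-degree form of \<open>f\<close>. For slopes where it does
  not vanish, \<open>y3 = 0\<close> is no root, so the line has no intersection with the curve at
  infinity.\<close>

lemma homog_y3_0_neq_0: "coeff (to_univ 2 (homog f)) 0 \<noteq> 0"
proof -
  have "n \<in> insert 0 ((\<lambda>m. \<Sum>i\<in>{0, 1}. lookup m i) ` keys f)"
    unfolding n_def deg_set_def by (rule Max_in) auto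
  then obtain m where m: "m \<in> keys f" "lookup m 0 + lookup m 1 = n"
    using n_pos by auto
  let ?g = "\<lambda>m. m + single 2 (n - (lookup m 0 + lookup m 1))"
  have "lookup (homog f) (?g m) = (\<Sum>m'\<in>keys f. if m' = m then lookup f m' else 0)"
    unfolding homog_def n_def[symmetric] lookup_sum
  proof (rule sum.cong[OF refl])
    fix m' assume m': "m' \<in> keys f"
    have "m' = m" if "?g m' = ?g m"
    proof (rule poly_mapping_eqI)
      fix i show "lookup m' i = lookup m i"
        using arg_cong[OF that, of "\<lambda>m. lookup m i"] lookup_f_eq_0[OF m', of i] lookup_f_eq_0[OF m(1), of i]
        by (cases "i = 2") (auto simp: lookup_add lookup_single when_def)
    qed
    then show "lookup (single (?g m') (lookup f m')) (?g m) =
        (if m' = m then lookup f m' else 0)"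
      by (auto simp: lookup_single when_def)
  qed
  then have "lookup (homog f) (?g m) \<noteq> 0" using m(1) by (simp add: in_keys_iff)
  then have "?g m \<in> keys (homog f)" by (simp add: in_keys_iff)
  from coeff_to_univ_neq_0[OF this, of 2] show ?thesis
    using m lookup_f_eq_0[OF m(1), of 2] by (simp add: lookup_add)
qed

text \<open>Otherwise \<open>f\<close> itself is homogeneous, and the curve contains the line
  joining the origin to any other of its points.\<close>

lemma degree_homog_y3_pos: "degree (to_univ 2 (homog f)) > 0"
proof (rule ccontr)
  let ?F = "homog f" and ?p = "coeff (to_univ 2 (homog f)) 0"
  assume "\<not> ?thesis"
  then have "to_univ 2 ?F = [:?p:]" by (metis degree_eq_zeroE coeff_pCons_0 neq0_conv)
  then have "poly (to_univ 2 ?F) (mVar 2) = poly [:?p:] (mVar 2)" by (rule arg_cong)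
  then have F: "?F = ?p" by (simp only: poly_to_univ_mVar) simp
  have hp: "hom_in {0, 1} n ?p"
    using hom_in_coeff_to_univ[of "{0, 1}" 2 n ?F 0] hom_in_homog by simp
  have F0_eq: "F0 y1 y2 = meval ?p (pt3 y1 y2 1)" for y1 y2
    using meval_homog[of "pt3 y1 y2 1"] by (simp flip: F)
  have "infinite ({(a, b). F0 a b = 0} - {(0, 0)})" using infinite_curve by simp
  then have "{(a, b). F0 a b = 0} - {(0, 0)} \<noteq> {}" by (metis finite.emptyI)
  then obtain a b where ab: "F0 a b = 0" "(a, b) \<noteq> (0, 0)" by auto
  have "F0 (a * z) (b * z) = 0" for z
  proof -
    have "pt3 (a * z) (b * z) 1 = (\<lambda>i. if i \<in> {0, 1} then z * pt3 a b 1 i else pt3 a b 1 i)"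
      by (rule ext) (simp add: pt3_def)
    then have "F0 (a * z) (b * z) = z ^ n * F0 a b"
      unfolding F0_eq using meval_hom_in[OF _ hp, of z "pt3 a b 1"] by simp
    then show ?thesis using ab(1) by simp
  qed
  then have "range (\<lambda>z. (a * z, b * z)) \<subseteq> {(y1, y2). F0 y1 y2 = 0 \<and> b * y1 + (- a) * y2 + 0 = 0}"
    by auto
  moreover have "infinite (range (\<lambda>z. (a * z, b * z)))"
    using ab(2) by (subst finite_image_iff) (auto intro!: inj_onI simp: infinite_UNIV_complex)
  ultimately show False
    using finite_curve_inter_line[of b "- a" 0] ab(2) finite_subset by auto
qed

text \<open>The slopes of the lines through the origin in which the projection of the curve from the
  origin degenerates: those tangent to the curve at the origin and those through a point at infinity,
  a point of tangency, a singular point or a point with isotropic normal.\<close>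
definition special_slopes :: "complex set" where
  "special_slopes = {t. meval (lead_coeff (to_univ 2 (homog f))) (pt2 1 t) = 0} \<union>
    {t. meval (coeff (to_univ 2 (homog f)) 0) (pt2 1 t) = 0} \<union>
    (\<lambda>(y1, y2). y2 / y1) ` ({(y1, y2). F0 y1 y2 = 0 \<and> y1 * F1 y1 y2 + y2 * F2 y1 y2 = 0} \<union>
      {(y1, y2). F0 y1 y2 = 0 \<and> H y1 y2 = 0})"

lemma finite_special_slopes: "finite special_slopes"
proof -
  have V: "mvars (coeff (to_univ 2 (homog f)) j) \<subseteq> {0, 1}" for j
    using mvars_coeff_to_univ[of 2 "homog f" j] mvars_homog by auto
  have h: "hom_in {0, 1} (n - j) (coeff (to_univ 2 (homog f)) j)" for j
    using hom_in_coeff_to_univ[of "{0, 1}" 2 n "homog f" j] hom_in_homog by simp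
  have "lead_coeff (to_univ 2 (homog f)) \<noteq> 0" using degree_homog_y3_pos by auto
  then show ?thesis
    unfolding special_slopes_def
    using finite_dehomogenized_zeros[OF h V] homog_y3_0_neq_0 finite_Euler_zeros finite_H_zeros
    by (intro finite_UnI finite_imageI) auto
qed

text \<open>The curve points \<open>(1 / z, t / z)\<close> on the line of slope \<open>t\<close>,
  recorded by the value \<open>z = 1 / y1\<close> of \<open>y3\<close> when \<open>y1\<close> is
  normalized to 1.\<close>

definition fibre :: "complex \<Rightarrow> complex set" where
  "fibre t = {z. z \<noteq> 0 \<and> F0 (1 / z) (t / z) = 0}"

text \<open>Prepares \<open>resultant_sub_distinct_roots\<close>, which asks for as many distinct
  roots of \<open>F(1, t, z)\<close> in \<open>z\<close> as its degree; every way to fail is among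
  the special slopes.\<close>

lemma roots_homog_line:
  assumes t: "t \<notin> special_slopes" and a: "a 0 = 1" "a 1 = t"
  shows "{z. meval (homog f) (a(2 := z)) = 0} = fibre t"
    and "card (fibre t) = degree (to_univ 2 (homog f))"
    and "finite (fibre t)"
    and "degree (eval_univ 2 a (homog f)) = degree (to_univ 2 (homog f))"
    and "meval (lead_coeff (to_univ 2 (homog f))) a \<noteq> 0"
proof -
  let ?p = "eval_univ 2 a (homog f)"
  have ca: "meval (coeff (to_univ 2 (homog f)) j) a = meval (coeff (to_univ 2 (homog f)) j) (pt2 1 t)" for j
    by (rule meval_cong) (use mvars_coeff_to_univ[of 2 "homog f" j] mvars_homog a in \<open>auto simp: pt2_def\<close>)
  have l: "meval (lead_coeff (to_univ 2 (homog f))) a \<noteq> 0"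
    using t unfolding ca special_slopes_def by blast
  then show "meval (lead_coeff (to_univ 2 (homog f))) a \<noteq> 0" .
  show deg: "degree ?p = degree (to_univ 2 (homog f))" using l by (rule map_poly_degree_eq)
  have p0: "?p \<noteq> 0" using deg degree_homog_y3_pos by auto
  have z0: "meval (homog f) (a(2 := 0)) \<noteq> 0"
  proof -
    have "meval (homog f) (a(2 := 0)) = coeff ?p 0" by (simp flip: poly_eval_univ add: poly_0_coeff_0)
    also have "\<dots> = meval (coeff (to_univ 2 (homog f)) 0) a" by (simp add: coeff_map_poly)
    finally show ?thesis using t unfolding ca special_slopes_def by auto
  qed
  have nz: "meval (homog f) (a(2 := z)) = z ^ n * F0 (1 / z) (t / z)" if "z \<noteq> 0" for z
    using meval_homog[of "a(2 := z)"] that a by simp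
  show roots: "{z. meval (homog f) (a(2 := z)) = 0} = fibre t"
  proof -
    have "meval (homog f) (a(2 := z)) = 0 \<longleftrightarrow> z \<in> fibre t" for z
    proof (cases "z = 0")
      case True
      then show ?thesis using z0 by (simp add: fibre_def)
    next
      case False
      then show ?thesis by (simp add: fibre_def nz)
    qed
    then show ?thesis by blast
  qed
  have simple: "poly (pderiv ?p) z \<noteq> 0" if z: "poly ?p z = 0" for z
  proof
    assume d: "poly (pderiv ?p) z = 0"
    have zf: "z \<noteq> 0" "F0 (1 / z) (t / z) = 0" using z roots by (auto simp: fibre_def)
    \<comment> \<open>Up to the factor \<open>- 1 / z\<close> this is the Euler expression at the
      curve point, so a multiple root makes \<open>t\<close> special.\<close>
    let ?u = "F1 (1 / z) (t / z) * (- (1 / z^2)) + F2 (1 / z) (t / z) * (- (t / z^2))"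
    have D: "((\<lambda>w. F0 (1 / w) (t / w)) has_field_derivative ?u) (at z)"
      by (rule DERIV_meval_pt2) (use zf(1) in \<open>auto intro!: derivative_eq_intros simp: power2_eq_square\<close>)
    have "((\<lambda>w. w ^ n * F0 (1 / w) (t / w)) has_field_derivative z ^ n * ?u) (at z)"
      using DERIV_mult[OF DERIV_power[OF DERIV_ident, of n] D] zf(2) by (simp add: mult.commute)
    then have "(poly ?p has_field_derivative z ^ n * ?u) (at z)"
      by (rule has_field_derivative_transform_within_open[of _ _ _ "- {0}"]) (use zf(1) nz in auto)
    from DERIV_unique[OF poly_DERIV this] d zf(1) have "?u = 0" by simp
    moreover have "?u = - (1 / z) * (1 / z * F1 (1 / z) (t / z) + t / z * F2 (1 / z) (t / z))"
      by (simp add: power2_eq_square algebra_simps)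
    ultimately have "1 / z * F1 (1 / z) (t / z) + t / z * F2 (1 / z) (t / z) = 0"
      using zf(1) by simp
    moreover have "(t / z) / (1 / z) = t" using zf(1) by simp
    ultimately have "t \<in> special_slopes"
      using zf(2) unfolding special_slopes_def by force
    with t show False ..
  qed
  have rp: "{z. poly ?p z = 0} = fibre t" by (simp add: roots)
  show "card (fibre t) = degree (to_univ 2 (homog f))"
    using card_roots_simple[OF p0 simple] unfolding rp deg .
  show "finite (fibre t)" using poly_roots_finite[OF p0] unfolding rp .
qed

text \<open>Poisson's product formula for \<open>F(1, t, z)\<close>, whose degree and number of
  roots survive the specialization at a non-special slope.\<close>

lemma meval_mres_homog:
  assumes t: "t \<notin> special_slopes" and a: "a 0 = 1" "a 1 = t"
  shows "meval (mres 2 (homog f) P) a =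
    meval (lead_coeff (to_univ 2 (homog f))) a ^ degree (to_univ 2 P) * (\<Prod>z\<in>fibre t. meval P (a(2 := z)))"
proof -
  let ?p = "eval_univ 2 a (homog f)"
  note r = roots_homog_line[OF t a]
  have rp: "{z. poly ?p z = 0} = fibre t" by (simp add: r(1))
  have "?p \<noteq> 0" using r(4) degree_homog_y3_pos by auto
  moreover have "card {z. poly ?p z = 0} = degree (to_univ 2 (homog f))" unfolding rp by (rule r(2))
  ultimately have "resultant_sub (degree (to_univ 2 (homog f))) (degree (to_univ 2 P)) ?p (eval_univ 2 a P) =
      lead_coeff ?p ^ degree (to_univ 2 P) * (\<Prod>z | poly ?p z = 0. poly (eval_univ 2 a P) z)"
    using r(4) by (intro resultant_sub_distinct_roots) (auto simp: degree_map_poly_le)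
  moreover have "lead_coeff ?p = meval (lead_coeff (to_univ 2 (homog f))) a"
    unfolding r(4) by (simp add: coeff_map_poly)
  ultimately show ?thesis
    unfolding mres_def resultant_sub_hom[OF comm_ring_hom_meval] rp by simp
qed

end

subsection \<open>The primitive part of the resultant\<close>

lemma order_prod:
  fixes p :: "'i \<Rightarrow> 'a::idom poly"
  assumes "finite A" "\<And>i. i \<in> A \<Longrightarrow> p i \<noteq> 0"
  shows "order x (\<Prod>i\<in>A. p i) = (\<Sum>i\<in>A. order x (p i))"
  using assms
proof (induction A)
  case (insert i A)
  then have "order x (p i * (\<Prod>i\<in>A. p i)) = order x (p i) + order x (\<Prod>i\<in>A. p i)"
    by (intro order_mult) auto
  with insert show ?case by simp
qed (simp add: order_0I)

lemma poly_eq_if_eq_nonzero: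
  fixes p q :: "complex poly"
  assumes "\<And>z. z \<noteq> 0 \<Longrightarrow> poly p z = poly q z"
  shows "p = q"
proof (rule ccontr)
  assume "p \<noteq> q"
  then have "finite {z. poly (p - q) z = 0}" by (intro poly_roots_finite) simp
  moreover have "UNIV - {0} \<subseteq> {z. poly (p - q) z = 0}" using assms by auto
  ultimately have "finite (UNIV - {0 :: complex})" by (rule finite_subset[rotated])
  then have "finite (UNIV :: complex set)" by (subst (asm) finite_Diff2) simp_all
  with infinite_UNIV_complex show False by contradiction
qed

text \<open>\<open>u\<close> and \<open>w\<close> are the two charts of a binary form of degree
  \<open>e\<close>. A non-zero value of \<open>w\<close> at 0 says that no root of the form lies at
  infinity in the chart of \<open>u\<close>.\<close>

lemma degree_of_reflection:
  fixes u w :: "complex poly"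
  assumes "\<And>t. t \<noteq> 0 \<Longrightarrow> poly u t = t ^ e * poly w (1 / t)" "poly w 0 \<noteq> 0"
  shows "degree u = e" and "u \<noteq> 0"
proof -
  have w0: "coeff w 0 \<noteq> 0" using assms(2) by (simp add: poly_0_coeff_0)
  have eq: "monom 1 (degree w) * u = monom 1 e * reflect_poly w"
  proof (rule poly_eq_if_eq_nonzero)
    fix z :: complex assume z: "z \<noteq> 0"
    then have "poly (reflect_poly w) z = z ^ degree w * poly w (1 / z)"
      by (simp add: poly_reflect_poly_nz inverse_eq_divide)
    then show "poly (monom 1 (degree w) * u) z = poly (monom 1 e * reflect_poly w) z"
      using assms(1)[OF z] by (simp add: poly_monom)
  qed
  have r0: "reflect_poly w \<noteq> 0" using w0 by auto
  then have "monom 1 e * reflect_poly w \<noteq> 0" by simp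
  with eq show "u \<noteq> 0" by auto
  have "degree (monom 1 (degree w) * u) = degree w + degree u"
    using \<open>u \<noteq> 0\<close> by (simp add: degree_mult_eq degree_monom_eq)
  moreover have "degree (monom 1 e * reflect_poly w) = e + degree w"
    using r0 w0 by (simp add: degree_mult_eq degree_monom_eq degree_reflect_poly_eq)
  ultimately show "degree u = e" using eq by simp
qed

lemma exists_if_eventually_cofinite: "\<forall>\<^sub>F a in cofinite. P a \<Longrightarrow> \<exists>a::complex. P a"
  using infinite_if_eventually_cofinite[of P] not_finite_existsD by blast

lemma mres_common_root:
  assumes "meval p (a(k := z)) = 0" "meval q (a(k := z)) = 0" "0 < degree (to_univ k p) + degree (to_univ k q)"
  shows "meval (mres k p q) a = 0"
  unfolding mres_def resultant_sub_hom[OF comm_ring_hom_meval]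
  by (rule resultant_sub_common_root[where z = z]) (use assms in \<open>auto simp: degree_map_poly_le\<close>)

locale curve_with_normal_resultant = plane_curve +
  fixes c Q :: mpoly
  assumes c_gcd: "is_gcd_of (range (xcoeff {3, 4} (mres 2 (homog f) (Npoly f)))) c"
    and c_neq_0: "c \<noteq> 0" and R_eq: "mres 2 (homog f) (Npoly f) = c * Q"
begin

abbreviation R :: mpoly where "R \<equiv> mres 2 (homog f) (Npoly f)"

definition e :: nat where "e = deg_set {0, 1} Q"

lemma R_neq_0: "R \<noteq> 0"
proof
  assume "R = 0"
  \<comment> \<open>All coefficients are zero, so 0 is a common divisor of them.\<close>
  then have "0 dvd c" using c_gcd by (auto simp: is_gcd_of_def xcoeff_def)
  with c_neq_0 show False by simp
qed

lemma Q_neq_0: "Q \<noteq> 0"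
  using R_neq_0 R_eq by auto

lemma mvars_R: "mvars R \<subseteq> {0, 1, 3, 4}"
  using mvars_mres[of "homog f" 2 "{0, 1, 3, 4}" "Npoly f"] mvars_homog mvars_Npoly by blast

lemma mvars_Q: "mvars Q \<subseteq> {0, 1, 3, 4}"
  using mvars_dvd[of Q R] R_neq_0 R_eq mvars_R by (metis dvd_triv_right order_trans)

lemma mvars_c: "mvars c \<subseteq> {0, 1}"
proof -
  obtain m where m: "m \<in> keys R" using R_neq_0 keys_eq_empty by blast
  have "c dvd xcoeff {3, 4} R m" using c_gcd by (auto simp: is_gcd_of_def)
  moreover have "xcoeff {3, 4} R m \<noteq> 0" by (rule xcoeff_self[OF _ m]) simp
  ultimately have "mvars c \<subseteq> mvars (xcoeff {3, 4} R m)" by (rule mvars_dvd)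
  also have "\<dots> \<subseteq> mvars R - {3, 4}" by (rule mvars_xcoeff) simp
  finally show ?thesis using mvars_R by blast
qed

lemma hom_in_R: "\<exists>k. hom_in {0, 1} k (c * Q)"
  using hom_in_mres[of "{0, 1}" 2 n "homog f" "Npoly f"] hom_in_homog hom_in_Npoly R_eq by simp

lemma hom_in_c: "\<exists>k. hom_in {0, 1} k c"
  and hom_in_Q: "hom_in {0, 1} e Q"
proof -
  obtain k where "hom_in {0, 1} k (c * Q)" using hom_in_R by blast
  from hom_in_factors[OF _ this] obtain k l where kl: "hom_in {0, 1} k c" "hom_in {0, 1} l Q"
    using c_neq_0 Q_neq_0 by auto
  then show "\<exists>k. hom_in {0, 1} k c" by blast
  have "e = l" unfolding e_def using kl(2) Q_neq_0 by (rule deg_set_hom_in)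
  with kl(2) show "hom_in {0, 1} e Q" by simp
qed

text \<open>A factor \<open>l\<close> free of \<open>x\<close> can be moved into the content:
  \<open>c * l\<close> divides all coefficients of the resultant, hence divides
  \<open>c\<close>.\<close>

lemma Q_primitive:
  assumes "mvars l \<subseteq> {0, 1}" "l dvd Q"
  shows "l dvd 1"
proof -
  obtain k where k: "Q = l * k" using assms(2) by (elim dvdE)
  have "mvars (c * l) \<inter> {3, 4} = {}"
    using mvars_mult[of c l] mvars_c assms(1) by fastforce
  then have "xcoeff {3, 4} ((c * l) * k) \<alpha> = (c * l) * xcoeff {3, 4} k \<alpha>" for \<alpha>
    by (intro xcoeff_mult) auto
  then have "c * l dvd xcoeff {3, 4} R \<alpha>" for \<alpha>
    unfolding R_eq k by (simp add: mult.assoc)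
  then have "c * l dvd c" using c_gcd by (auto simp: is_gcd_of_def)
  then obtain m where "c = (c * l) * m" by (elim dvdE)
  then have "c * 1 = c * (l * m)" by (simp only: mult.assoc mult_1_right)
  then have "1 = l * m" using c_neq_0 by (simp only: mult_left_cancel not_False_eq_True)
  then show ?thesis by (rule dvdI)
qed

lemma meval_Q_pt5: "meval Q a = meval Q (pt5 (a 0) (a 1) (a 3) (a 4))"
  by (rule meval_cong) (use mvars_Q in auto)

lemma meval_Q_scale: "meval Q (pt5 (r * y1) (r * y2) s b) = r ^ e * meval Q (pt5 y1 y2 s b)"
proof -
  have "(\<lambda>i. if i \<in> {0, 1} then r * pt5 y1 y2 s b i else pt5 y1 y2 s b i) = pt5 (r * y1) (r * y2) s b"
    by (rule ext) simp
  then show ?thesis using meval_hom_in[OF _ hom_in_Q, of r "pt5 y1 y2 s b"] by simp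
qed

text \<open>Vanishing at slope \<open>t\<close> for all \<open>x\<close> would make the linear form
  \<open>y2 - t y1\<close> a factor of \<open>Q\<close>, against primitivity.\<close>

lemma Q_slope_neq_0: "\<exists>s b. meval Q (pt5 1 t s b) \<noteq> 0"
proof (rule ccontr)
  assume "\<not> ?thesis"
  then have z: "meval Q (pt5 1 t s b) = 0" for s b by blast
  let ?l = "mVar 1 - mC t * mVar 0"
  have "mVar 0 * msubst (mVar(1 := mC t * mVar 0)) Q = 0"
  proof (rule mpoly_eq_0I)
    fix a
    have "meval (msubst (mVar(1 := mC t * mVar 0)) Q) a = meval Q (pt5 (a 0 * 1) (a 0 * t) (a 3) (a 4))"
      unfolding meval_msubst
      by (subst meval_Q_pt5) (simp add: meval.hom_mult mult.commute cong: if_cong)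
    then show "meval (mVar 0 * msubst (mVar(1 := mC t * mVar 0)) Q) a = 0"
      unfolding meval_Q_scale by (simp add: meval.hom_mult z)
  qed
  then have "?l dvd Q" by (intro dvd_of_msubst_0) simp
  moreover have "mvars ?l \<subseteq> {0, 1}"
    using mvars_diff[of "mVar 1" "mC t * mVar 0"] mvars_mult[of "mC t" "mVar 0"] by auto
  ultimately have "?l dvd 1" by (intro Q_primitive)
  then obtain k where "1 = ?l * k" by (elim dvdE)
  from arg_cong[OF this, of "\<lambda>p. meval p (\<lambda>_. 0)"] show False
    by (simp add: meval.hom_mult meval.hom_minus)
qed

lemma Q_vertical_neq_0: "\<exists>s b. meval Q (pt5 0 1 s b) \<noteq> 0"
proof (rule ccontr)
  assume "\<not> ?thesis"
  then have z: "meval Q (pt5 0 1 s b) = 0" for s b by blast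
  have "mVar 1 * msubst (mVar(0 := 0)) Q = 0"
  proof (rule mpoly_eq_0I)
    fix a
    have "meval (msubst (mVar(0 := 0)) Q) a = meval Q (pt5 (a 1 * 0) (a 1 * 1) (a 3) (a 4))"
      unfolding meval_msubst by (subst meval_Q_pt5) (simp cong: if_cong)
    then show "meval (mVar 1 * msubst (mVar(0 := 0)) Q) a = 0"
      unfolding meval_Q_scale by (simp add: meval.hom_mult z)
  qed
  then have "mVar 0 - 0 dvd Q" by (intro dvd_of_msubst_0) simp
  then have "mVar 0 dvd 1" by (intro Q_primitive) simp_all
  then obtain k where "1 = mVar 0 * k" by (elim dvdE)
  from arg_cong[OF this, of "\<lambda>p. meval p (\<lambda>_. 0)"] show False
    by (simp add: meval.hom_mult)
qed

section \<open>Generic points and the number of their feet\<close>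

definition bad_slopes :: "complex set" where
  "bad_slopes = special_slopes \<union> {t. meval c (pt2 1 t) = 0}"

text \<open>The points that the slope chart cannot treat: those with \<open>y1 = 0\<close>, and
  those whose slope is special or a zero of the content, where the value of the resultant does not
  determine that of \<open>Q\<close>.\<close>

definition bad_points :: "(complex \<times> complex) set" where
  "bad_points = {(y1, y2). F0 y1 y2 = 0 \<and> H y1 y2 \<noteq> 0 \<and> (y1 = 0 \<or> y2 / y1 \<in> bad_slopes)}"

lemma finite_bad_slopes: "finite bad_slopes"
  using hom_in_c finite_dehomogenized_zeros[OF _ mvars_c c_neq_0] finite_special_slopes
  by (auto simp: bad_slopes_def)

lemma finite_bad_points: "finite bad_points"
proof -
  have "bad_points \<subseteq> {(y1, y2). F0 y1 y2 = 0 \<and> 1 * y1 + 0 * y2 + 0 = 0} \<union>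
      (\<Union>t\<in>bad_slopes. {(y1, y2). F0 y1 y2 = 0 \<and> t * y1 + (- 1) * y2 + 0 = 0})"
    by (auto simp: bad_points_def)
  moreover have "finite ({(y1, y2). F0 y1 y2 = 0 \<and> 1 * y1 + 0 * y2 + 0 = 0} \<union>
      (\<Union>t\<in>bad_slopes. {(y1, y2). F0 y1 y2 = 0 \<and> t * y1 + (- 1) * y2 + 0 = 0}))"
    by (intro finite_UnI finite_UN_I finite_bad_slopes finite_curve_inter_line) simp_all
  ultimately show ?thesis by (rule finite_subset)
qed

lemma Q_product:
  assumes t: "t \<notin> special_slopes"
  obtains \<kappa> where "\<kappa> \<noteq> 0" "\<And>s b. meval c (pt2 1 t) * meval Q (pt5 1 t s b) =
    \<kappa> * (\<Prod>z\<in>fibre t. z ^ n * nrm (1 / z) (t / z) s b)"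
proof
  let ?l = "lead_coeff (to_univ 2 (homog f))"
  have l: "meval ?l (pt5 1 t s b) = meval ?l (pt2 1 t)" for s b
    by (rule meval_cong)
       (use mvars_coeff_to_univ[of 2 "homog f" "degree (to_univ 2 (homog f))"] mvars_homog in \<open>auto simp: pt2_def\<close>)
  have c: "meval c (pt5 1 t s b) = meval c (pt2 1 t)" for s b
    by (rule meval_cong) (use mvars_c in \<open>auto simp: pt2_def\<close>)
  show "meval ?l (pt2 1 t) ^ degree (to_univ 2 (Npoly f)) \<noteq> 0"
    using roots_homog_line(5)[OF t, of "pt5 1 t 0 0"] unfolding l by simp
  fix s b
  have "meval c (pt2 1 t) * meval Q (pt5 1 t s b) = meval R (pt5 1 t s b)"
    unfolding R_eq meval.hom_mult c ..
  also have "\<dots> = meval ?l (pt2 1 t) ^ degree (to_univ 2 (Npoly f)) *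
      (\<Prod>z\<in>fibre t. meval (Npoly f) ((pt5 1 t s b)(2 := z)))"
    unfolding l[of s b, symmetric] by (rule meval_mres_homog[OF t]) simp_all
  also have "(\<Prod>z\<in>fibre t. meval (Npoly f) ((pt5 1 t s b)(2 := z))) =
      (\<Prod>z\<in>fibre t. z ^ n * nrm (1 / z) (t / z) s b)"
  proof (rule prod.cong[OF refl])
    fix z assume "z \<in> fibre t"
    then have "z \<noteq> 0" by (simp add: fibre_def)
    then show "meval (Npoly f) ((pt5 1 t s b)(2 := z)) = z ^ n * nrm (1 / z) (t / z) s b"
      by (subst meval_Npoly) simp_all
  qed
  finally show "meval c (pt2 1 t) * meval Q (pt5 1 t s b) =
      meval ?l (pt2 1 t) ^ degree (to_univ 2 (Npoly f)) * (\<Prod>z\<in>fibre t. z ^ n * nrm (1 / z) (t / z) s b)" .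
qed

text \<open>\<open>Q\<close> on the line \<open>x\<^sub>2 = b\<close>, as a polynomial in the slope \<open>t = y\<^sub>2 / y\<^sub>1\<close> over \<open>\<complex>[x\<^sub>1]\<close>.\<close>
definition QP :: "complex \<Rightarrow> complex poly poly" where
  "QP b = to_bi (\<lambda>i. if i = 0 then 1 else if i = 1 then [:0, 1:] else if i = 3 then [:[:0, 1:]:]
    else if i = 4 then [:[:b:]:] else 0) Q"

lemma bi_QP: "bi (QP b) s t = meval Q (pt5 1 t s b)"
proof -
  have "(\<lambda>i::nat. bi (if i = 0 then 1 else if i = 1 then [:0, 1:] else if i = 3 then [:[:0, 1:]:]
    else if i = 4 then [:[:b:]:] else 0) s t) = pt5 1 t s b"
    by (rule ext) simp
  then show ?thesis unfolding QP_def bi_to_bi by simp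
qed

text \<open>The vertical slope is the point at infinity of the chart \<open>t = y2 / y1\<close>;
  since \<open>Q\<close> does not vanish there, setting \<open>y1 = 1\<close> loses no
  degree.\<close>

lemma degree_inner_QP:
  assumes "meval Q (pt5 0 1 s b) \<noteq> 0"
  shows "degree (inner_at s (QP b)) = e"
proof -
  obtain w where w: "meval Q (\<lambda>i. poly (if i = 0 then [:0, 1:] else if i = 1 then 1 else
      if i = 3 then [:s:] else if i = 4 then [:b:] else 0) t) = poly w t" for t
    using meval_poly_curve[of Q "\<lambda>i. if i = 0 then [:0, 1:] else if i = 1 then 1 else
      if i = 3 then [:s:] else if i = 4 then [:b:] else 0"] by blast
  have w': "meval Q (pt5 t 1 s b) = poly w t" for t
  proof -
    have "(\<lambda>i::nat. poly (if i = 0 then [:0, 1:] else if i = 1 then 1 else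
      if i = 3 then [:s:] else if i = 4 then [:b:] else 0) t) = pt5 t 1 s b" by (rule ext) simp
    then show ?thesis using w[of t] by simp
  qed
  show ?thesis
  proof (rule degree_of_reflection(1))
    fix t :: complex assume "t \<noteq> 0"
    then have "t * (1 / t) = 1" "t * 1 = t" by simp_all
    then have "meval Q (pt5 1 t s b) = t ^ e * meval Q (pt5 (1 / t) 1 s b)"
      using meval_Q_scale[of t "1 / t" 1 s b] by (simp only:)
    then show "poly (inner_at s (QP b)) t = t ^ e * poly w (1 / t)" by (simp only: poly_inner_at bi_QP w')
  next
    show "poly w 0 \<noteq> 0" using assms w' by simp
  qed
qed

text \<open>The conditions keep the roots of \<open>Q\<close> away from the bad and the vertical
  slopes and the feet away from the bad points, and they allow the order in \<open>t\<close> to be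
  exchanged for the order in \<open>s\<close>.\<close>

definition good :: "complex \<Rightarrow> complex \<Rightarrow> bool" where
  "good s b \<longleftrightarrow> (\<forall>t\<in>bad_slopes. meval Q (pt5 1 t s b) \<noteq> 0) \<and> meval Q (pt5 0 1 s b) \<noteq> 0 \<and>
    (\<forall>(y1, y2)\<in>bad_points. nrm y1 y2 s b \<noteq> 0) \<and>
    (\<forall>t. poly (QP b) [:t:] \<noteq> 0) \<and> inner_at s (QP b) \<noteq> 0 \<and>
    (\<forall>t. order t (inner_at s (QP b)) = order s (poly (QP b) [:t:]))"

lemma fibre_point:
  assumes "t \<notin> special_slopes" "z \<in> fibre t"
  shows "F0 (1 / z) (t / z) = 0" "H (1 / z) (t / z) \<noteq> 0" "z \<noteq> 0"
proof -
  show 1: "F0 (1 / z) (t / z) = 0" "z \<noteq> 0" using assms(2) by (auto simp: fibre_def)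
  show "H (1 / z) (t / z) \<noteq> 0"
  proof
    assume "H (1 / z) (t / z) = 0"
    with 1(1) have "(1 / z, t / z) \<in> {(y1, y2). F0 y1 y2 = 0 \<and> H y1 y2 = 0}" by blast
    moreover have "t = (\<lambda>(y1, y2). y2 / y1) (1 / z, t / z)" using 1(2) by simp
    ultimately have "t \<in> special_slopes" unfolding special_slopes_def by blast
    with assms(1) show False ..
  qed
qed

lemma eventually_good: "\<forall>\<^sub>F b in cofinite. \<forall>\<^sub>F s in cofinite. good s b"
proof -
  have "\<forall>\<^sub>F b in cofinite. \<forall>t\<in>bad_slopes. \<forall>\<^sub>F s in cofinite. meval Q (pt5 1 t s b) \<noteq> 0"
  proof (rule eventually_ball_finite[OF finite_bad_slopes], rule ballI)
    fix t
    obtain s b where "meval Q (pt5 1 t s b) \<noteq> 0" using Q_slope_neq_0 by blast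
    then show "\<forall>\<^sub>F b in cofinite. \<forall>\<^sub>F s in cofinite. meval Q (pt5 1 t s b) \<noteq> 0"
      by (rule eventually_meval_pt5_neq_0)
  qed
  moreover have "\<forall>\<^sub>F b in cofinite. \<forall>\<^sub>F s in cofinite. meval Q (pt5 0 1 s b) \<noteq> 0"
    using Q_vertical_neq_0 eventually_meval_pt5_neq_0 by blast
  ultimately show ?thesis
    using eventually_not_snd_F2_zero
  proof eventually_elim
    case (elim b)
    have slopes: "\<forall>\<^sub>F s in cofinite. \<forall>t\<in>bad_slopes. meval Q (pt5 1 t s b) \<noteq> 0"
      using elim(1) by (intro eventually_ball_finite finite_bad_slopes)
    have points: "\<forall>\<^sub>F s in cofinite. \<forall>(y1, y2)\<in>bad_points. nrm y1 y2 s b \<noteq> 0"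
      by (rule eventually_off_normals[OF finite_bad_points _ elim(3)]) (auto simp: bad_points_def)
    \<comment> \<open>This is needed for every \<open>t\<close> at once. The finitely many bad
      slopes are settled by the choice of \<open>b\<close>; for any other \<open>t\<close> the
      product formula is evaluated at an \<open>s\<close>, depending on \<open>t\<close>, off the
      normals at the fibre.\<close>
    have QPt: "poly (QP b) [:t:] \<noteq> 0" for t
    proof -
      have "\<exists>s. meval Q (pt5 1 t s b) \<noteq> 0"
      proof (cases "t \<in> bad_slopes")
        case True
        then show ?thesis using elim(1) exists_if_eventually_cofinite by blast
      next
        case False
        then have t: "t \<notin> special_slopes" by (simp add: bad_slopes_def)
        let ?Y = "(\<lambda>z. (1 / z, t / z)) ` fibre t"
        have fin: "finite (fibre t)" by (rule roots_homog_line(3)[OF t, of "pt2 1 t"]) simp_all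
        have "\<forall>\<^sub>F s in cofinite. \<forall>(y1, y2)\<in>?Y. nrm y1 y2 s b \<noteq> 0"
          by (rule eventually_off_normals[OF finite_imageI[OF fin] _ elim(3)])
             (use fibre_point[OF t] in blast)
        then obtain s where s: "\<forall>(y1, y2)\<in>?Y. nrm y1 y2 s b \<noteq> 0"
          using exists_if_eventually_cofinite by blast
        obtain \<kappa> where \<kappa>: "\<kappa> \<noteq> 0" "meval c (pt2 1 t) * meval Q (pt5 1 t s b) =
            \<kappa> * (\<Prod>z\<in>fibre t. z ^ n * nrm (1 / z) (t / z) s b)"
          by (rule Q_product[OF t]) blast
        have "(\<Prod>z\<in>fibre t. z ^ n * nrm (1 / z) (t / z) s b) \<noteq> 0"
          using fin
        proof (subst prod_zero_iff, simp, intro notI, elim bexE)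
          fix z assume z: "z \<in> fibre t" "z ^ n * nrm (1 / z) (t / z) s b = 0"
          moreover have "z \<noteq> 0" by (rule fibre_point(3)[OF t z(1)])
          moreover have "nrm (1 / z) (t / z) s b \<noteq> 0" using s z(1) by blast
          ultimately show False by (simp only: mult_eq_0_iff power_eq_0_iff simp_thms)
        qed
        then have "meval Q (pt5 1 t s b) \<noteq> 0" using \<kappa> by auto
        then show ?thesis ..
      qed
      then show ?thesis
        unfolding bi_QP[symmetric] bi_def by auto
    qed
    have "QP b \<noteq> 0" using QPt[of 0] by auto
    from eventually_order_inner_eq_order_outer[OF this QPt] slopes points elim(2)
    show ?case
    proof eventually_elim
      case (elim s)
      then show ?case unfolding good_def using QPt by blast
    qed
  qed
qed

lemma good_root_not_bad: "good s b \<Longrightarrow> meval Q (pt5 1 t s b) = 0 \<Longrightarrow> t \<notin> bad_slopes \<and> t \<notin> special_slopes"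
  by (auto simp: good_def bad_slopes_def)

text \<open>The foot makes one factor in the product formula vanish, and the content is non-zero at
  a slope that is not bad.\<close>

lemma foot_slope_root:
  assumes "(y1, y2) \<in> foot x1 x2" "(y1, y2) \<notin> bad_points"
  shows "y1 \<noteq> 0" "y2 / y1 \<notin> bad_slopes" "1 / y1 \<in> fibre (y2 / y1)" "meval Q (pt5 1 (y2 / y1) x1 x2) = 0"
proof -
  let ?t = "y2 / y1" and ?z = "1 / y1"
  have y: "F0 y1 y2 = 0" "nrm y1 y2 x1 x2 = 0" "H y1 y2 \<noteq> 0" using assms(1) unfolding foot_def by blast+
  then show y1: "y1 \<noteq> 0" and t: "?t \<notin> bad_slopes" using assms(2) unfolding bad_points_def by blast+
  then have ts: "?t \<notin> special_slopes" and ct: "meval c (pt2 1 ?t) \<noteq> 0" by (auto simp: bad_slopes_def)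
  have yy: "1 / ?z = y1" "?t / ?z = y2" using y1 by simp_all
  show zf: "?z \<in> fibre ?t" using y(1) y1 by (simp add: fibre_def)
  have fin: "finite (fibre ?t)" by (rule roots_homog_line(3)[OF ts, of "pt2 1 ?t"]) simp_all
  obtain \<kappa> where "meval c (pt2 1 ?t) * meval Q (pt5 1 ?t x1 x2) =
      \<kappa> * (\<Prod>z\<in>fibre ?t. z ^ n * nrm (1 / z) (?t / z) x1 x2)"
    by (rule Q_product[OF ts]) blast
  also have "(\<Prod>z\<in>fibre ?t. z ^ n * nrm (1 / z) (?t / z) x1 x2) = 0"
    by (rule prod_zero[OF fin], rule bexI[OF _ zf]) (simp only: yy y(2) mult_zero_right)
  finally show "meval Q (pt5 1 ?t x1 x2) = 0" using ct by simp
qed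

lemma card_foot:
  assumes g: "good s b"
  shows "card (foot s b) = e" and "finite (foot s b)"
proof -
  let ?u = "inner_at s (QP b)"
  define T where "T = {t. poly ?u t = 0}"
  define Z where "Z t = {z \<in> fibre t. nrm (1 / z) (t / z) s b = 0}" for t
  have u0: "?u \<noteq> 0" using g by (simp add: good_def)
  have T: "t \<in> T \<longleftrightarrow> meval Q (pt5 1 t s b) = 0" for t by (simp add: T_def bi_QP)
  have finT: "finite T" unfolding T_def by (rule poly_roots_finite[OF u0])
  have ts: "t \<notin> special_slopes" "meval c (pt2 1 t) \<noteq> 0" if "t \<in> T" for t
    using good_root_not_bad[OF g] that unfolding T bad_slopes_def by blast+
  have fin: "finite (fibre t)" if "t \<in> T" for t
    by (rule roots_homog_line(3)[OF ts(1)[OF that], of "pt2 1 t"]) simp_all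
  have ord: "order t ?u = card (Z t)" if t: "t \<in> T" for t
  proof -
    obtain \<kappa> where \<kappa>: "\<kappa> \<noteq> 0" "\<And>s b. meval c (pt2 1 t) * meval Q (pt5 1 t s b) =
        \<kappa> * (\<Prod>z\<in>fibre t. z ^ n * nrm (1 / z) (t / z) s b)"
      by (rule Q_product[OF ts(1)[OF t]]) blast
    \<comment> \<open>The normal equation at a fibre point as a polynomial of degree at most 1 in
      \<open>s\<close>.\<close>
    define N where "N z = smult (z ^ n) [:F2 (1 / z) (t / z) * (1 / z) + F1 (1 / z) (t / z) * (b - t / z), - F2 (1 / z) (t / z):]" for z
    have N: "poly (N z) x = z ^ n * nrm (1 / z) (t / z) x b" for x z
      by (simp add: N_def algebra_simps)
    have eq: "smult (meval c (pt2 1 t)) (poly (QP b) [:t:]) = smult \<kappa> (\<Prod>z\<in>fibre t. N z)"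
    proof (rule poly_eq_if_eq_nonzero)
      fix x
      have "poly (poly (QP b) [:t:]) x = meval Q (pt5 1 t x b)" unfolding bi_QP[symmetric] bi_def ..
      then show "poly (smult (meval c (pt2 1 t)) (poly (QP b) [:t:])) x = poly (smult \<kappa> (\<Prod>z\<in>fibre t. N z)) x"
        using \<kappa>(2)[of x b] by (simp add: poly_prod N)
    qed
    have "smult (meval c (pt2 1 t)) (poly (QP b) [:t:]) \<noteq> 0"
      using ts(2)[OF t] g by (simp add: good_def)
    then have "(\<Prod>z\<in>fibre t. N z) \<noteq> 0" unfolding eq by auto
    then have N0: "N z \<noteq> 0" if "z \<in> fibre t" for z using fin[OF t] that by (auto simp: prod_zero_iff)
    have "order t ?u = order s (poly (QP b) [:t:])" using g by (simp add: good_def)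
    also have "\<dots> = order s (smult (meval c (pt2 1 t)) (poly (QP b) [:t:]))"
      using ts(2)[OF t] by (simp add: order_smult)
    also have "\<dots> = order s (\<Prod>z\<in>fibre t. N z)" unfolding eq using \<kappa>(1) by (simp add: order_smult)
    also have "\<dots> = (\<Sum>z\<in>fibre t. order s (N z))" by (rule order_prod[OF fin[OF t] N0])
    \<comment> \<open>A non-zero factor of degree at most 1 has order 1 at \<open>s\<close> if its
      normal passes through \<open>(s, b)\<close>, and order 0 otherwise.\<close>
    also have "\<dots> = (\<Sum>z\<in>fibre t. if z \<in> Z t then 1 else 0)"
    proof (rule sum.cong[OF refl])
      fix z assume z: "z \<in> fibre t"
      then have "z \<noteq> 0" by (simp add: fibre_def)
      have "order s (N z) \<le> degree (N z)" using order_degree[OF N0[OF z]] .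
      also have "\<dots> \<le> 1" unfolding N_def by (rule order.trans[OF degree_smult_le]) simp
      finally have "order s (N z) \<le> 1" .
      moreover have "order s (N z) \<noteq> 0 \<longleftrightarrow> z \<in> Z t"
        using order_root[of "N z" s] N0[OF z] z \<open>z \<noteq> 0\<close> unfolding N Z_def by auto
      ultimately show "order s (N z) = (if z \<in> Z t then 1 else 0)" by auto
    qed
    also have "\<dots> = card (Z t)"
      using fin[OF t] by (simp add: Z_def sum.If_cases Int_def conj_commute)
    finally show ?thesis .
  qed
  have finZ: "finite (Z t)" if "t \<in> T" for t using fin[OF that] by (simp add: Z_def)
  \<comment> \<open>The coordinates are \<open>t = y2 / y1\<close> and \<open>z = 1 / y1\<close>;
    goodness keeps all feet inside this chart.\<close>
  have bij: "bij_betw (\<lambda>(t, z). (1 / z, t / z)) (SIGMA t:T. Z t) (foot s b)"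
  proof (rule bij_betw_byWitness[where f' = "\<lambda>(y1, y2). (y2 / y1, 1 / y1)"])
    have nb: "y \<notin> bad_points" if "y \<in> foot s b" for y
      using that g unfolding good_def foot_def by blast
    show "(\<lambda>(t, z). (1 / z, t / z)) ` (SIGMA t:T. Z t) \<subseteq> foot s b"
    proof clarify
      fix t z assume "t \<in> T" "z \<in> Z t"
      then have "z \<in> fibre t" "nrm (1 / z) (t / z) s b = 0" by (auto simp: Z_def)
      with fibre_point[OF ts(1)[OF \<open>t \<in> T\<close>]] show "(1 / z, t / z) \<in> foot s b"
        unfolding foot_def by blast
    qed
    show "(\<lambda>(y1, y2). (y2 / y1, 1 / y1)) ` foot s b \<subseteq> (SIGMA t:T. Z t)"
    proof clarify
      fix y1 y2 assume y: "(y1, y2) \<in> foot s b"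
      note r = foot_slope_root[OF y nb[OF y]]
      have "nrm y1 y2 s b = 0" using y unfolding foot_def by blast
      moreover have "1 / (1 / y1) = y1" "y2 / y1 / (1 / y1) = y2" using r(1) by simp_all
      ultimately have "nrm (1 / (1 / y1)) (y2 / y1 / (1 / y1)) s b = 0" by (simp only:)
      then have "1 / y1 \<in> Z (y2 / y1)" using r(3) unfolding Z_def by blast
      then show "y2 / y1 \<in> T \<and> 1 / y1 \<in> Z (y2 / y1)" using r(4) T by blast
    qed
    show "\<forall>a\<in>SIGMA t:T. Z t. (\<lambda>(y1, y2). (y2 / y1, 1 / y1)) ((\<lambda>(t, z). (1 / z, t / z)) a) = a"
      by (auto simp: Z_def fibre_def)
    show "\<forall>a'\<in>foot s b. (\<lambda>(t, z). (1 / z, t / z)) ((\<lambda>(y1, y2). (y2 / y1, 1 / y1)) a') = a'"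
      using foot_slope_root(1) nb by fastforce
  qed
  have "e = degree ?u" using degree_inner_QP g by (simp add: good_def)
  also have "\<dots> = (\<Sum>t\<in>T. order t ?u)" unfolding T_def by (rule degree_eq_sum_order[OF u0])
  also have "\<dots> = (\<Sum>t\<in>T. card (Z t))" by (rule sum.cong[OF refl ord])
  also have "\<dots> = card (SIGMA t:T. Z t)" using finT finZ by simp
  also have "\<dots> = card (foot s b)" by (rule bij_betw_same_card[OF bij])
  finally show "card (foot s b) = e" ..
  have "finite (SIGMA t:T. Z t)" using finT finZ by blast
  then show "finite (foot s b)" using bij_betw_finite[OF bij] by blast
qed

end

subsection \<open>Elimination\<close>

context curve_with_normal_resultant
begin

text \<open>The distance equation multiplied by \<open>y3^2\<close>, in the coordinates of
  \<open>Npoly\<close>, with \<open>d\<close> as variable 5.\<close>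

definition dist_poly :: mpoly where
  "dist_poly = (mVar 3 * mVar 2 - mVar 0)^2 + (mVar 4 * mVar 2 - mVar 1)^2 - (mVar 5)^2 * (mVar 2)^2"

text \<open>At a root \<open>t\<close> of \<open>Q\<close>, the normal and the distance equation may
  hold at different points of the fibre, which separate resultants cannot distinguish. For a
  suitable \<open>\<epsilon>\<close> the combination vanishes at a fibre point only if both
  equations hold there.\<close>

definition pencil_res :: "complex \<Rightarrow> mpoly" where
  "pencil_res \<epsilon> = mres 2 (homog f) (Npoly f + mC \<epsilon> * dist_poly)"

text \<open>The summand \<open>Q y\<^sub>2\<^sup>M\<close> does not change the common zeros; it only makes the leading coefficient
  of the second polynomial that of \<open>Q\<close>, so that evaluation preserves the degrees.\<close>
definition elim_poly :: "complex \<Rightarrow> mpoly" where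
  "elim_poly \<epsilon> = mres 1 Q (pencil_res \<epsilon> + Q * mVar 1 ^ Suc (degree (to_univ 1 (pencil_res \<epsilon>))))"

abbreviation pt_xd :: "complex \<Rightarrow> complex \<Rightarrow> complex \<Rightarrow> nat \<Rightarrow> complex" where
  "pt_xd x1 x2 d \<equiv> (\<lambda>i. if i = 0 then 1 else if i = 3 then x1 else if i = 4 then x2 else if i = 5 then d else 0)"

lemma meval_dist_poly:
  assumes "z \<noteq> 0"
  shows "meval dist_poly ((pt_xd x1 x2 d)(1 := t, 2 := z)) = z^2 * (dist2 (1 / z) (t / z) x1 x2 - d^2)"
proof -
  have "x1 * z - 1 = z * (x1 - 1 / z)" "x2 * z - t = z * (x2 - t / z)" using assms by (simp_all add: field_simps)
  moreover have "meval dist_poly ((pt_xd x1 x2 d)(1 := t, 2 := z)) = (x1 * z - 1)^2 + (x2 * z - t)^2 - d^2 * z^2"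
    by (simp add: dist_poly_def meval.hom_add meval.hom_minus meval.hom_mult meval.hom_power)
  ultimately have "meval dist_poly ((pt_xd x1 x2 d)(1 := t, 2 := z)) =
      z^2 * (x1 - 1 / z)^2 + z^2 * (x2 - t / z)^2 - d^2 * z^2"
    by (simp only: power_mult_distrib)
  then show ?thesis by (simp add: algebra_simps)
qed

lemma meval_Npoly_pt_xd:
  assumes "z \<noteq> 0"
  shows "meval (Npoly f) ((pt_xd x1 x2 d)(1 := t, 2 := z)) = z ^ n * nrm (1 / z) (t / z) x1 x2"
  using assms by (subst meval_Npoly) simp_all

lemma meval_Q_pt_xd: "meval Q ((pt_xd x1 x2 d)(1 := t)) = meval Q (pt5 1 t x1 x2)"
  by (rule meval_cong) (use mvars_Q in auto)

lemma elim_poly_degree: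
  assumes "Suc (degree (to_univ 1 W)) = M"
  shows "degree (to_univ 1 (W + Q * mVar 1 ^ M)) = degree (to_univ 1 Q) + M"
    and "coeff (to_univ 1 (W + Q * mVar 1 ^ M)) (degree (to_univ 1 Q) + M) = lead_coeff (to_univ 1 Q)"
proof -
  let ?q = "to_univ 1 Q"
  have q0: "?q \<noteq> 0" using poly_to_univ_mVar[of 1 Q] Q_neq_0 by fastforce
  have eq: "to_univ 1 (W + Q * mVar 1 ^ M) = to_univ 1 W + monom 1 M * ?q"
    by (simp add: to_univ.hom_add to_univ.hom_mult to_univ.hom_power to_univ_mVar monom_altdef mult.commute)
  have deg: "degree (monom 1 M * ?q) = degree ?q + M"
    using q0 by (simp add: degree_mult_eq degree_monom_eq)
  show "degree (to_univ 1 (W + Q * mVar 1 ^ M)) = degree ?q + M"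
    unfolding eq using deg assms by (subst degree_add_eq_right) auto
  have "coeff (to_univ 1 W) (degree ?q + M) = 0"
    using assms by (intro coeff_eq_0) simp
  then show "coeff (to_univ 1 (W + Q * mVar 1 ^ M)) (degree ?q + M) = lead_coeff ?q"
    unfolding eq by (simp add: coeff_monom_mult)
qed

text \<open>The slope of the foot is a common root: of \<open>Q\<close> because of the normal
  equation, and of the pencil resultant because both members of the pencil vanish at the
  foot.\<close>

lemma elim_poly_vanishes:
  assumes y: "(y1, y2) \<in> foot x1 x2" "(y1, y2) \<notin> bad_points" and d: "dist2 y1 y2 x1 x2 = d^2"
  shows "meval (elim_poly \<epsilon>) (pt_xd x1 x2 d) = 0"
proof -
  let ?t = "y2 / y1" and ?z = "1 / y1" and ?A = "pt_xd x1 x2 d"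
  note r = foot_slope_root[OF y]
  have z: "?z \<noteq> 0" "1 / ?z = y1" "?t / ?z = y2" using r(1) by simp_all
  have Qt: "meval Q (?A(1 := ?t)) = 0" using r(4) by (simp only: meval_Q_pt_xd)
  have "meval (pencil_res \<epsilon>) (?A(1 := ?t)) = 0"
    unfolding pencil_res_def
  proof (rule mres_common_root[where z = ?z])
    show "meval (homog f) (?A(1 := ?t, 2 := ?z)) = 0"
    proof -
      have "F0 y1 y2 = 0" using y(1) unfolding foot_def by blast
      then show ?thesis using z by (subst meval_homog) simp_all
    qed
    have "nrm y1 y2 x1 x2 = 0" using y(1) unfolding foot_def by blast
    then show "meval (Npoly f + mC \<epsilon> * dist_poly) (?A(1 := ?t, 2 := ?z)) = 0"
      unfolding meval.hom_add meval.hom_mult meval_Npoly_pt_xd[OF z(1)] meval_dist_poly[OF z(1)] z(2,3) d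
      by simp
    show "0 < degree (to_univ 2 (homog f)) + degree (to_univ 2 (Npoly f + mC \<epsilon> * dist_poly))"
      using degree_homog_y3_pos by simp
  qed
  then show ?thesis
    unfolding elim_poly_def
    using Qt elim_poly_degree(1)[OF refl, of "pencil_res \<epsilon>"]
    by (intro mres_common_root[where z = ?t]) (simp_all add: meval.hom_add meval.hom_mult)
qed

lemma elim_poly_neq_0:
  assumes g: "good s b" and nd: "\<And>y1 y2. (y1, y2) \<in> foot s b \<Longrightarrow> dist2 y1 y2 s b \<noteq> d^2"
  shows "\<exists>\<epsilon>. meval (elim_poly \<epsilon>) (pt_xd s b d) \<noteq> 0"
proof -
  let ?A = "pt_xd s b d"
  let ?u = "inner_at s (QP b)"
  define T where "T = {t. poly ?u t = 0}"
  have u0: "?u \<noteq> 0" using g by (simp add: good_def)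
  have T: "t \<in> T \<longleftrightarrow> meval Q (pt5 1 t s b) = 0" for t by (simp add: T_def bi_QP)
  have finT: "finite T" unfolding T_def by (rule poly_roots_finite[OF u0])
  have ts: "t \<notin> special_slopes" if "t \<in> T" for t
    using good_root_not_bad[OF g] that unfolding T by blast
  have fin: "finite (fibre t)" if "t \<in> T" for t
    by (rule roots_homog_line(3)[OF ts[OF that], of "pt2 1 t"]) simp_all
  define N where "N t z = z ^ n * nrm (1 / z) (t / z) s b" for t z
  define B where "B t z = z^2 * (dist2 (1 / z) (t / z) s b - d^2)" for t z
  \<comment> \<open>These are the values of \<open>\<epsilon>\<close> at which some combination
    could vanish. Where \<open>B t z = 0\<close> the quotient is 0 by convention, and that case is
    settled by \<open>nd\<close> instead.\<close>
  have "finite ((\<lambda>(t, z). - N t z / B t z) ` (SIGMA t:T. fibre t))"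
    using finT fin by (intro finite_imageI finite_SigmaI)
  then obtain \<epsilon> where \<epsilon>: "\<epsilon> \<notin> (\<lambda>(t, z). - N t z / B t z) ` (SIGMA t:T. fibre t)"
    using ex_new_if_finite[OF infinite_UNIV_complex] by blast
  have NB: "N t z + \<epsilon> * B t z \<noteq> 0" if t: "t \<in> T" and z: "z \<in> fibre t" for t z
  proof
    assume eq: "N t z + \<epsilon> * B t z = 0"
    note fp = fibre_point[OF ts[OF t] z]
    show False
    proof (cases "B t z = 0")
      case True
      with eq have "N t z = 0" by simp
      then have "nrm (1 / z) (t / z) s b = 0" using fp(3) unfolding N_def by (simp only: mult_eq_0_iff power_eq_0_iff simp_thms)
      then have "(1 / z, t / z) \<in> foot s b" using fp(1,2) unfolding foot_def by blast
      from nd[OF this] True fp(3) show False unfolding B_def by simp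
    next
      case False
      have "\<epsilon> * B t z = - N t z" using eq by (simp add: add_eq_0_iff)
      then have "\<epsilon> = - N t z / B t z" using False by (simp add: field_simps)
      then have "\<epsilon> \<in> (\<lambda>(t, z). - N t z / B t z) ` (SIGMA t:T. fibre t)"
        using t z by (intro image_eqI[where x = "(t, z)"]) auto
      with \<epsilon> show False ..
    qed
  qed
  let ?W = "pencil_res \<epsilon>"
  let ?M = "Suc (degree (to_univ 1 ?W))"
  let ?V = "?W + Q * mVar 1 ^ ?M"
  have W: "meval ?W (?A(1 := t)) \<noteq> 0" if t: "t \<in> T" for t
  proof -
    have "meval ?W (?A(1 := t)) = meval (lead_coeff (to_univ 2 (homog f))) (?A(1 := t)) ^
        degree (to_univ 2 (Npoly f + mC \<epsilon> * dist_poly)) *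
        (\<Prod>z\<in>fibre t. meval (Npoly f + mC \<epsilon> * dist_poly) (?A(1 := t, 2 := z)))"
      unfolding pencil_res_def by (rule meval_mres_homog[OF ts[OF t]]) simp_all
    moreover have "meval (lead_coeff (to_univ 2 (homog f))) (?A(1 := t)) \<noteq> 0"
      by (rule roots_homog_line(5)[OF ts[OF t]]) simp_all
    moreover have "meval (Npoly f + mC \<epsilon> * dist_poly) (?A(1 := t, 2 := z)) \<noteq> 0" if z: "z \<in> fibre t" for z
      using NB[OF t z] fibre_point(3)[OF ts[OF t] z]
      unfolding meval.hom_add meval.hom_mult meval_mC N_def B_def
      by (simp only: meval_Npoly_pt_xd meval_dist_poly simp_thms)
    ultimately show ?thesis using fin[OF t] by (simp add: prod_zero_iff)
  qed
  let ?p = "eval_univ 1 ?A Q" and ?q = "eval_univ 1 ?A ?V"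
  have pu: "?p = ?u"
    by (rule poly_eq_if_eq_nonzero) (simp only: poly_eval_univ poly_inner_at bi_QP meval_Q_pt_xd)
  have "degree ?p = e" unfolding pu using g by (intro degree_inner_QP) (simp add: good_def)
  \<comment> \<open>Homogeneity bounds the degree of \<open>Q\<close> in \<open>y2\<close> by
    \<open>e\<close>, and at a good point the specialized polynomial attains \<open>e\<close>. No
    degree drops, so evaluation commutes with the resultant.\<close>
  moreover have "degree (to_univ 1 Q) \<le> e"
    using hom_in_Q degree_to_univ_le_hom[of "{0}" 1 e Q] by (simp add: insert_commute)
  ultimately have degp: "degree ?p = degree (to_univ 1 Q)"
    using degree_map_poly_le[of "\<lambda>q. meval q ?A" "to_univ 1 Q"] by simp
  have lq: "meval (lead_coeff (to_univ 1 Q)) ?A \<noteq> 0"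
  proof -
    have "lead_coeff ?p \<noteq> 0" using u0 by (simp only: pu leading_coeff_0_iff simp_thms)
    then show ?thesis unfolding degp by (simp add: coeff_map_poly)
  qed
  have degq: "degree ?q = degree (to_univ 1 ?V)"
  proof (rule map_poly_degree_eq)
    show "meval (lead_coeff (to_univ 1 ?V)) ?A \<noteq> 0"
      unfolding elim_poly_degree(1)[OF refl] elim_poly_degree(2)[OF refl] by (rule lq)
  qed
  have "resultant ?p ?q \<noteq> 0"
  proof
    assume "resultant ?p ?q = 0"
    then have "degree (gcd ?p ?q) \<noteq> 0" unfolding resultant_0_gcd .
    then have "\<not> constant (poly (gcd ?p ?q))" unfolding constant_degree .
    then obtain t where t: "poly (gcd ?p ?q) t = 0" using fundamental_theorem_of_algebra by blast
    then have dv: "[:- t, 1:] dvd gcd ?p ?q" unfolding poly_eq_0_iff_dvd .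
    have "poly ?p t = 0" "poly ?q t = 0"
      unfolding poly_eq_0_iff_dvd by (rule dvd_trans[OF dv gcd_dvd1], rule dvd_trans[OF dv gcd_dvd2])
    then have Qt: "meval Q (?A(1 := t)) = 0" and Vt: "meval ?V (?A(1 := t)) = 0" by (simp_all only: poly_eval_univ)
    \<comment> \<open>At a root of \<open>Q\<close> the added summand vanishes and leaves the pencil
      resultant, which is non-zero there by \<open>W\<close>.\<close>
    have "t \<in> T" using Qt unfolding T meval_Q_pt_xd .
    from W[OF this] Vt Qt show False by (simp only: meval.hom_add meval.hom_mult mult_zero_left add_0_right simp_thms)
  qed
  moreover have "meval (elim_poly \<epsilon>) ?A = resultant ?p ?q"
    unfolding elim_poly_def mres_def
    by (rule comm_ring_hom.resultant_map_poly[OF comm_ring_hom_meval degp degq, symmetric])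
  ultimately show ?thesis by metis
qed

section \<open>The roots of the offset equation and its degree\<close>

definition normal_poly :: "complex \<times> complex \<Rightarrow> mpoly" where
  "normal_poly = (\<lambda>(y1, y2). mC (- F2 y1 y2) * (mVar 0 - mC y1) + mC (F1 y1 y2) * (mVar 1 - mC y2))"

lemma meval_normal_poly: "meval (normal_poly (y1, y2)) (pt3 x1 x2 d) = nrm y1 y2 x1 x2"
  by (simp add: normal_poly_def meval.hom_add meval.hom_mult meval.hom_minus)

lemma mvars_normal_poly: "mvars (normal_poly y) \<subseteq> {0, 1}"
proof -
  have "mvars (mC c * (mVar i - mC y)) \<subseteq> {i}" for c y i
    using mvars_mult[of "mC c" "mVar i - mC y"] mvars_diff[of "mVar i" "mC y"] by auto
  then show ?thesis
    unfolding normal_poly_def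
    by (cases y) (use mvars_add in \<open>fastforce simp only: prod.case\<close>)
qed

text \<open>If \<open>d\<close> belonged to no foot, \<open>?q\<close> would vanish on the projected
  set but not at \<open>(s, b, d)\<close>, which membership in the closure forbids. Goodness makes
  the factors \<open>normal_poly\<close> non-zero at \<open>(s, b)\<close>.\<close>

lemma offset_equation_roots:
  assumes g: "good s b" and off: "(s, b, d) \<in> generic_offset f"
  shows "\<exists>(y1, y2)\<in>foot s b. dist2 y1 y2 s b = d^2"
proof (rule ccontr)
  assume "\<not> ?thesis"
  then obtain \<epsilon> where \<epsilon>: "meval (elim_poly \<epsilon>) (pt_xd s b d) \<noteq> 0"
    using elim_poly_neq_0[OF g, of d] by blast
  let ?\<sigma> = "\<lambda>i::nat. if i = 0 then 1 else if i = 3 then mVar 0 else if i = 4 then mVar 1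
    else if i = 5 then mVar 2 else 0"
  let ?q = "msubst ?\<sigma> (elim_poly \<epsilon>) * (\<Prod>y\<in>bad_points. normal_poly y)"
  have \<sigma>: "meval (msubst ?\<sigma> p) (pt3 x1 x2 d) = meval p (pt_xd x1 x2 d)" for p x1 x2 d
  proof -
    have "(\<lambda>i. meval (?\<sigma> i) (pt3 x1 x2 d)) = pt_xd x1 x2 d" by (rule ext) simp
    then show ?thesis by (simp only: meval_msubst)
  qed
  have q: "meval ?q (pt3 x1 x2 d) = meval (elim_poly \<epsilon>) (pt_xd x1 x2 d) * (\<Prod>(y1, y2)\<in>bad_points. nrm y1 y2 x1 x2)"
    for x1 x2 d
  proof -
    have "(\<Prod>y\<in>bad_points. meval (normal_poly y) (pt3 x1 x2 d)) = (\<Prod>(y1, y2)\<in>bad_points. nrm y1 y2 x1 x2)"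
      by (rule prod.cong[OF refl]) (auto simp only: meval_normal_poly split: prod.split)
    then show ?thesis by (simp only: meval.hom_mult meval.hom_prod \<sigma>)
  qed
  have "mvars (msubst ?\<sigma> (elim_poly \<epsilon>)) \<subseteq> {0, 1, 2}"
    by (rule order.trans[OF mvars_msubst], rule UN_least) auto
  moreover have "mvars (\<Prod>y\<in>bad_points. normal_poly y) \<subseteq> {0, 1, 2}"
    by (rule order.trans[OF mvars_prod], rule UN_least) (use mvars_normal_poly in blast)
  ultimately have vars: "mvars ?q \<subseteq> {0, 1, 2}"
    by (intro order.trans[OF mvars_mult] Un_least)
  have van: "meval ?q (pt3 x1 x2 d) = 0" if xd: "(x1, x2, d) \<in> offset_proj f" for x1 x2 d
  proof -
    obtain y1 y2 where y: "(y1, y2) \<in> foot x1 x2" "dist2 y1 y2 x1 x2 = d^2"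
      using xd unfolding offset_proj_iff by blast
    show ?thesis
    proof (cases "(y1, y2) \<in> bad_points")
      case True
      have "nrm y1 y2 x1 x2 = 0" using y(1) unfolding foot_def by blast
      then have "(\<Prod>(y1, y2)\<in>bad_points. nrm y1 y2 x1 x2) = 0"
        by (intro prod_zero[OF finite_bad_points] bexI[OF _ True]) (simp only: prod.case)
      then show ?thesis by (simp only: q mult_zero_right)
    next
      case False
      from elim_poly_vanishes[OF y(1) this y(2)] show ?thesis by (simp only: q mult_zero_left)
    qed
  qed
  have "meval ?q (pt3 s b d) = 0"
    using off vars van unfolding generic_offset_def zariski_closure3_def by blast
  moreover have "(\<Prod>(y1, y2)\<in>bad_points. nrm y1 y2 s b) \<noteq> 0"
  proof -
    have "(case y of (y1, y2) \<Rightarrow> nrm y1 y2 s b) \<noteq> 0" if y: "y \<in> bad_points" for y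
    proof -
      obtain y1 y2 where y': "y = (y1, y2)" by fastforce
      have "nrm y1 y2 s b \<noteq> 0" using g y unfolding good_def y' by blast
      then show ?thesis by (simp only: y' prod.case simp_thms)
    qed
    then show ?thesis unfolding prod_zero_iff[OF finite_bad_points] by blast
  qed
  ultimately show False using \<epsilon> unfolding q by (simp only: mult_eq_0_iff simp_thms)
qed

lemma offset_proj_subset: "offset_proj f \<subseteq> generic_offset f"
  unfolding generic_offset_def zariski_closure3_def by blast

theorem deg_var_offset_equation:
  assumes "is_generic_offset_eq f g"
  shows "deg_var 2 g = 2 * deg_set {0, 1} Q"
proof -
  note eq = assms[unfolded is_generic_offset_eq_def]
  have g: "mvars g \<subseteq> {0, 1, 2}" "squarefree g"
      "{(a, b, c). meval g (pt3 a b c) = 0} = generic_offset f"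
    by (rule eq[THEN conjunct2, THEN conjunct1])
       (rule eq[THEN conjunct2, THEN conjunct2, THEN conjunct1],
        rule eq[THEN conjunct2, THEN conjunct2, THEN conjunct2, THEN conjunct1])
  have g_iff: "meval g (pt3 x1 x2 d) = 0 \<longleftrightarrow> (x1, x2, d) \<in> generic_offset f" for x1 x2 d
    using g(3) by blast
  let ?reg = "\<lambda>s b. \<forall>(y1, y2)\<in>foot s b.
     (b - y2) * K y1 y2 \<noteq> H y1 y2 * F2 y1 y2 \<and> F2 y1 y2 \<noteq> 0 \<and> dist2 y1 y2 s b \<noteq> 0"
  let ?simple = "\<lambda>s b. card {d. meval g (pt3 s b d) = 0} = deg_var 2 g \<and>
    (\<forall>d. meval g (pt3 s b d) = 0 \<longrightarrow> meval (mpderiv 2 g) (pt3 s b d) \<noteq> 0)"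
  have "\<forall>\<^sub>F b in cofinite. \<forall>\<^sub>F s in cofinite. good s b \<and> ?reg s b \<and> ?simple s b"
    using eventually_good eventually_foot_regular eventually_simple_roots[OF g(1,2)]
  proof eventually_elim
    case (elim b)
    then show ?case by eventually_elim blast
  qed
  then obtain b where "\<forall>\<^sub>F s in cofinite. good s b \<and> ?reg s b \<and> ?simple s b"
    using exists_if_eventually_cofinite by blast
  then obtain s where s: "good s b" "?reg s b" "?simple s b"
    using exists_if_eventually_cofinite by blast
  define \<Delta> where "\<Delta> = (\<lambda>(y1, y2). {d. d^2 = dist2 y1 y2 s b})"
  have roots: "{d. meval g (pt3 s b d) = 0} = (\<Union>y\<in>foot s b. \<Delta> y)"
  proof (intro equalityI subsetI)
    fix d assume "d \<in> {d. meval g (pt3 s b d) = 0}"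
    then have "(s, b, d) \<in> generic_offset f" by (simp add: g_iff)
    from offset_equation_roots[OF s(1) this] show "d \<in> (\<Union>y\<in>foot s b. \<Delta> y)"
      unfolding \<Delta>_def by force
  next
    fix d assume "d \<in> (\<Union>y\<in>foot s b. \<Delta> y)"
    then have "(s, b, d) \<in> offset_proj f" unfolding offset_proj_iff \<Delta>_def by force
    then show "d \<in> {d. meval g (pt3 s b d) = 0}" using offset_proj_subset by (auto simp: g_iff)
  qed
  \<comment> \<open>At a regular foot the squared distance is non-zero and has two square roots;
    this is the factor 2 of the theorem.\<close>
  have card\<Delta>: "card (\<Delta> y) = 2 \<and> finite (\<Delta> y)" if "y \<in> foot s b" for y
  proof -
    obtain y1 y2 where y: "y = (y1, y2)" by fastforce
    define r where "r = csqrt (dist2 y1 y2 s b)"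
    have r2: "dist2 y1 y2 s b = r^2" by (simp add: r_def)
    have "dist2 y1 y2 s b \<noteq> 0" using s(2) that y by blast
    then have "r \<noteq> 0" unfolding r2 by simp
    then have "r \<noteq> - r" by (simp add: eq_neg_iff_add_eq_0 flip: mult_2)
    moreover have "\<Delta> y = {r, - r}"
      unfolding \<Delta>_def y prod.case r2 by (auto simp: power2_eq_iff)
    ultimately show ?thesis by simp
  qed
  \<comment> \<open>A shared \<open>d\<close> would be a simple root of \<open>g\<close>, from which
    \<open>foot_distance_injective\<close> recovers a single foot.\<close>
  have disj: "\<Delta> y \<inter> \<Delta> y' = {}" if y: "y \<in> foot s b" "y' \<in> foot s b" "y \<noteq> y'" for y y'
  proof (rule ccontr)
    assume "\<Delta> y \<inter> \<Delta> y' \<noteq> {}"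
    then obtain d where d: "d \<in> \<Delta> y" "d \<in> \<Delta> y'" by blast
    then have "meval g (pt3 s b d) = 0" using roots y(1) by blast
    then have simple: "meval (mpderiv 2 g) (pt3 s b d) \<noteq> 0" using s(3) by blast
    obtain y1 y2 y1' y2' where yy: "y = (y1, y2)" "y' = (y1', y2')" by fastforce
    have "(y1, y2) = (y1', y2')"
    proof (rule foot_distance_injective[OF _ s(2) _ _ _ _ simple])
      show "meval g (pt3 x1 x2 d) = 0" if "(x1, x2, d) \<in> offset_proj f" for x1 x2 d
        using that offset_proj_subset g_iff by blast
      show "(y1, y2) \<in> foot s b" "(y1', y2') \<in> foot s b" using y yy by simp_all
      show "dist2 y1 y2 s b = d^2" "dist2 y1' y2' s b = d^2" using d yy by (simp_all add: \<Delta>_def)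
    qed
    with y(3) yy show False by simp
  qed
  have "deg_var 2 g = card (\<Union>y\<in>foot s b. \<Delta> y)" using s(3) roots by simp
  also have "\<dots> = (\<Sum>y\<in>foot s b. card (\<Delta> y))"
    using card_foot(2)[OF s(1)] card\<Delta> disj by (intro card_UN_disjoint) blast+
  also have "\<dots> = 2 * card (foot s b)" using card\<Delta> by simp
  also have "card (foot s b) = deg_set {0, 1} Q" using card_foot(1)[OF s(1)] by (simp add: e_def)
  finally show ?thesis .
qed

end

theorem mainTheorem15:
  fixes f g Q :: mpoly
  assumes f_vars: "mvars f \<subseteq> {0, 1}"
    and f_irred: "irreducible f"
    and not_line: "\<not> (\<exists>a b c. (a, b) \<noteq> (0, 0) \<and>
          {(y1, y2). meval f (pt2 y1 y2) = 0} = {(y1, y2). a * y1 + b * y2 + c = 0})"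
    and not_dvd: "\<not> f dvd (mpderiv 0 f)^2 + (mpderiv 1 f)^2"
    and g_eq: "is_generic_offset_eq f g"
    and Q_PP: "is_PP {3, 4} (mres 2 (homog f) (Npoly f)) Q"
  shows "deg_var 2 g = 2 * deg_set {0, 1} Q"
proof -
  obtain c where c: "is_gcd_of (range (xcoeff {3, 4} (mres 2 (homog f) (Npoly f)))) c" "c \<noteq> 0"
      "mres 2 (homog f) (Npoly f) = c * Q"
    using Q_PP unfolding is_PP_def by blast
  interpret curve_with_normal_resultant f c Q
    by unfold_locales (fact f_vars f_irred not_line not_dvd c)+
  show ?thesis by (rule deg_var_offset_equation[OF g_eq])
qed

end
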